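(* Let $n\ge1$ and $1\le k\le n$, and for $g\in S_n$ let $\alpha_k(g)$ be the number of cycles of length $k$ in $g$. Then, as functions on $S_n$, $$\alpha_k=\frac1k\sum_{\rho}a_\rho\,\chi_\rho,$$ where the sum is over all partitions $\rho$ of $n$, $\chi_\rho$ is the character of the irreducible representation of $S_n$ indexed by $\rho$, and $$a_\rho=\begin{cases}1&\rho=[n],\\(-1)^{i+1}&\rho=[k-i-1,\,n-k+1,\,1^i]\text{ for some }i\in\{0,\dotsc,2k-n-2\},\\(-1)^i&\rho=[n-k,\,k-i,\,1^i]\text{ for some }i\in\{\max\{2k-n,0\},\dotsc,k-1\},\\0&\text{otherwise.}\end{cases}$$
   Context: Partitions of $n$ are written $[\lambda_1,\dotsc,\lambda_r]$ with $\lambda_1\ge\dotsb\ge\lambda_r>0$ and $\sum\lambda_i=n$; $1^i$ denotes $i$ parts equal to $1$. A range $\{a,\dotsc,b\}$ with $b<a$ is empty. Fixed points count as cycles of length 1. The irreducible complex representations $U_\rho$ of $S_n$ are indexed by partitions $\rho$ of $n$ in the standard way (Specht modules; $U_{[n]}$ is the trivial representation and $U_{[1^n]}$ is the sign representation), and $\chi_\rho(g)=\operatorname{tr}(U_\rho(g))$. *)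

theory Defs
  imports "HOL-Combinatorics.Combinatorics" "HOL-Library.Function_Algebras" Complex_Main
begin

definition cycles_of_length :: "nat \<Rightarrow> nat \<Rightarrow> (nat \<Rightarrow> nat) \<Rightarrow> nat" where
  "cycles_of_length n k g = card {C \<in> orbit g ` {1..n}. card C = k}"

definition partitions_of :: "nat \<Rightarrow> nat list set" where
  "partitions_of n = {\<rho>. sorted_wrt (\<ge>) \<rho> \<and> (\<forall>p\<in>set \<rho>. p > 0) \<and> sum_list \<rho> = n}"

definition fun_scale :: "complex \<Rightarrow> ('a \<Rightarrow> complex) \<Rightarrow> 'a \<Rightarrow> complex" where
  "fun_scale c v = (\<lambda>x. c * v x)"

global_interpretation fun_vs: vector_space "fun_scale :: complex \<Rightarrow> ('a \<Rightarrow> complex) \<Rightarrow> _"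
  by unfold_locales (simp_all add: fun_scale_def fun_eq_iff algebra_simps)

text \<open>Trace of a linear map on an invariant finite-dimensional subspace, computed in some basis.\<close>

definition trace_on :: "('a \<Rightarrow> complex) set \<Rightarrow> (('a \<Rightarrow> complex) \<Rightarrow> ('a \<Rightarrow> complex)) \<Rightarrow> complex" where
  "trace_on V f =
    (let B = (SOME B. fun_vs.independent B \<and> fun_vs.span B = V)
     in \<Sum>b\<in>B. fun_vs.representation B (f b) b)"

text \<open>Cells, rows and columns of Young diagrams are counted from 0; the entries of a tableau are
  \<open>1, \<dots>, n\<close>. Only the values of a tableau on the cells of its diagram matter.\<close>

definition young_diagram :: "nat list \<Rightarrow> (nat \<times> nat) set" where
  "young_diagram \<rho> = {(i, j). i < length \<rho> \<and> j < \<rho> ! i}"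

definition tableaux :: "nat list \<Rightarrow> (nat \<times> nat \<Rightarrow> nat) set" where
  "tableaux \<rho> = {t. bij_betw t (young_diagram \<rho>) {1..sum_list \<rho>}}"

definition row_set :: "nat list \<Rightarrow> (nat \<times> nat \<Rightarrow> nat) \<Rightarrow> nat \<Rightarrow> nat set" where
  "row_set \<rho> t i = {t (i, j) |j. (i, j) \<in> young_diagram \<rho>}"

definition column_set :: "nat list \<Rightarrow> (nat \<times> nat \<Rightarrow> nat) \<Rightarrow> nat \<Rightarrow> nat set" where
  "column_set \<rho> t j = {t (i, j) |i. (i, j) \<in> young_diagram \<rho>}"

definition column_stabilizer :: "nat list \<Rightarrow> (nat \<times> nat \<Rightarrow> nat) \<Rightarrow> (nat \<Rightarrow> nat) set" where
  "column_stabilizer \<rho> t =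
    {\<pi>. \<pi> permutes {1..sum_list \<rho>} \<and> (\<forall>j. \<pi> ` column_set \<rho> t j = column_set \<rho> t j)}"

text \<open>A tabloid (row-equivalence class of tableaux) is given by its sequence of row sets; the
  permutation module consists of complex-valued functions on tabloids, the tabloid \<open>T\<close> itself
  being the basis vector \<open>tabloid_vec T\<close>.\<close>

type_synonym tabloid = "nat \<Rightarrow> nat set"

definition tabloid_of :: "nat list \<Rightarrow> (nat \<times> nat \<Rightarrow> nat) \<Rightarrow> tabloid" where
  "tabloid_of \<rho> t = row_set \<rho> t"

definition tabloid_vec :: "tabloid \<Rightarrow> tabloid \<Rightarrow> complex" where
  "tabloid_vec T = (\<lambda>T'. if T' = T then 1 else 0)"

definition polytabloid :: "nat list \<Rightarrow> (nat \<times> nat \<Rightarrow> nat) \<Rightarrow> tabloid \<Rightarrow> complex" where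
  "polytabloid \<rho> t =
    (\<Sum>\<pi>\<in>column_stabilizer \<rho> t. fun_scale (of_int (sign \<pi>)) (tabloid_vec (tabloid_of \<rho> (\<pi> \<circ> t))))"

definition specht_module :: "nat list \<Rightarrow> (tabloid \<Rightarrow> complex) set" where
  "specht_module \<rho> = fun_vs.span (polytabloid \<rho> ` tableaux \<rho>)"

text \<open>The linear extension of the action on tabloids; see \<open>perm_act_tabloid_vec\<close>.\<close>

definition perm_act :: "(nat \<Rightarrow> nat) \<Rightarrow> (tabloid \<Rightarrow> complex) \<Rightarrow> tabloid \<Rightarrow> complex" where
  "perm_act g v = (\<lambda>T. v (\<lambda>i. inv g ` T i))"

lemma perm_act_tabloid_vec:
  assumes "g permutes {1..n}"
  shows "perm_act g (tabloid_vec (tabloid_of \<rho> t)) = tabloid_vec (tabloid_of \<rho> (g \<circ> t))"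
proof -
  have "bij g" using assms by (rule permutes_bij)
  have inv1: "inv g ` g ` A = A" for A
    using \<open>bij g\<close> by (simp add: image_image bij_is_inj)
  have inv2: "g ` inv g ` A = A" for A
    using \<open>bij g\<close> by (simp add: image_image bij_is_surj surj_f_inv_f)
  have g: "tabloid_of \<rho> (g \<circ> t) = (\<lambda>i. g ` tabloid_of \<rho> t i)"
    by (auto simp: tabloid_of_def row_set_def fun_eq_iff)
  have "(\<lambda>i. inv g ` T i) = tabloid_of \<rho> t \<longleftrightarrow> T = tabloid_of \<rho> (g \<circ> t)" for T
    unfolding g fun_eq_iff by (metis inv1 inv2)
  then show ?thesis
    by (simp add: perm_act_def tabloid_vec_def)
qed

definition specht_character :: "nat list \<Rightarrow> (nat \<Rightarrow> nat) \<Rightarrow> complex" where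
  "specht_character \<rho> g = trace_on (specht_module \<rho>) (perm_act g)"

definition coeff_shape1 :: "nat \<Rightarrow> nat \<Rightarrow> nat list \<Rightarrow> nat \<Rightarrow> bool" where
  "coeff_shape1 n k \<rho> i \<longleftrightarrow> int i \<in> {0..2 * int k - int n - 2} \<and>
    \<rho> = [k - i - 1, n - k + 1] @ replicate i 1"

definition coeff_shape2 :: "nat \<Rightarrow> nat \<Rightarrow> nat list \<Rightarrow> nat \<Rightarrow> bool" where
  "coeff_shape2 n k \<rho> i \<longleftrightarrow> int i \<in> {max (2 * int k - int n) 0..int k - 1} \<and>
    \<rho> = [n - k, k - i] @ replicate i 1"

text \<open>The index \<open>i\<close> is unique, as \<open>length \<rho> = i + 2\<close> in both cases; the cases exclude each other,
  and the truncated subtractions are exact in the given ranges.\<close>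

definition cycle_coeff :: "nat \<Rightarrow> nat \<Rightarrow> nat list \<Rightarrow> int" where
  "cycle_coeff n k \<rho> =
    (if \<rho> = [n] then 1
     else if \<exists>i. coeff_shape1 n k \<rho> i then (-1) ^ ((THE i. coeff_shape1 n k \<rho> i) + 1)
     else if \<exists>i. coeff_shape2 n k \<rho> i then (-1) ^ (THE i. coeff_shape2 n k \<rho> i)
     else 0)"

end

theory Submission
  imports Defs
begin

text \<open>
  Let \<open>h\<^sub>a h\<^sub>b e\<^sub>i\<close> denote the character induced from the trivial, trivial and sign characters of
  \<open>S\<^sub>a \<times> S\<^sub>b \<times> S\<^sub>i\<close>. Its module is a weight space of the Lie superalgebra \<open>gl(2|1)\<close> acting on a tensor
  power of the defining representation, realised here as functions on permutations that are
  invariant, respectively alternating, under right multiplication by the three factors; the odd and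
  even root vectors are sums over cosets. The Specht module of shape \<open>[a, b, 1\<^sup>i]\<close> is the space of
  highest weight vectors: polytabloids are highest weight vectors by a pigeonhole argument, and no
  nonzero highest weight vector is orthogonal to all of them, because the columns of the column
  antisymmetriser can be peeled off one at a time.

  Koszul exactness computes the trace on the kernel of the odd root vector between the second row
  and the alternating part, and for \<open>a \<ge> b\<close> a composite of two odd root vectors maps this kernel
  onto another one of the same kind, annihilating exactly the highest weight vectors. Hence
  \<open>\<chi>\<^bsub>[a, b, 1\<^sup>i]\<^esub> = g(a, b, i) - g(b - 1, a + 1, i)\<close> with
  \<open>g(a, b, i) = \<Sum>\<^sub>j (-1)\<^sup>j h\<^sub>a h\<^bsub>b + j\<^esub> e\<^bsub>i - j\<^esub>\<close>. The right-hand side is antisymmetric under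
  \<open>(a, b) \<mapsto> (b - 1, a + 1)\<close>, which merges the two families of shapes into one sum over \<open>i < k\<close>.
  That sum collapses to \<open>k \<alpha>\<^sub>k - 1\<close> since the alternating sum of signs over the \<open>g\<close>-stable subsets
  of a nonempty stable set vanishes.
\<close>

section \<open>Traces on finite-dimensional function spaces\<close>

text \<open>A permutation \<open>t\<close> of \<open>N\<close> is read as a filling: arguments are
  positions, values are entries. All weight spaces then lie in the single space
  \<open>perm_fns N\<close>; root vectors act on positions from the right, \<open>g\<close> acts on
  entries from the left, and equivariance is associativity of composition. Characters are obtained
  solely from additivity of the trace along exact sequences, so the image of every map must be known
  exactly, and surjectivity is the obstacle. Two devices overcome it. For the Koszul maps, an odd
  root vector composed with its opposite is a positive scalar on the relevant kernel, which gives
  explicit preimages. For the shift maps and for the span of the polytabloids, the standard inner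
  product is used: coset sums are self-adjoint and multiply functions already invariant under the
  larger block by \<open>card S + 1\<close>, so a vector orthogonal to the image is again killed by
  root vectors, and positivity of norms excludes it. Tabloids impose no symmetry on the one-cell
  rows; a polytabloid is nevertheless alternating there because these cells share a column.\<close>

abbreviation lin :: "(('a \<Rightarrow> complex) \<Rightarrow> ('b \<Rightarrow> complex)) \<Rightarrow> bool" where
  "lin f \<equiv> Vector_Spaces.linear fun_scale fun_scale f"

abbreviation basis_of :: "('a \<Rightarrow> complex) set \<Rightarrow> ('a \<Rightarrow> complex) set \<Rightarrow> bool" where
  "basis_of B V \<equiv> finite B \<and> fun_vs.independent B \<and> fun_vs.span B = V"

lemma linI:
  assumes "\<And>x y. f (x + y) = f x + f y" "\<And>c x. f (fun_scale c x) = fun_scale c (f x)"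
  shows "lin f"
  by unfold_locales (simp_all add: assms)

lemma lin_add: "lin f \<Longrightarrow> f (x + y) = f x + f y"
  using module_hom.add[of fun_scale fun_scale f] by (simp add: module_hom_iff_linear)

lemma lin_diff: "lin f \<Longrightarrow> f (x - y) = f x - f y"
  using module_hom.diff[of fun_scale fun_scale f] by (simp add: module_hom_iff_linear)

lemma lin_scale: "lin f \<Longrightarrow> f (fun_scale c x) = fun_scale c (f x)"
  using module_hom.scale[of fun_scale fun_scale f] by (simp add: module_hom_iff_linear)

lemma lin_0: "lin f \<Longrightarrow> f 0 = 0"
  using module_hom.zero[of fun_scale fun_scale f] by (simp add: module_hom_iff_linear)

lemma lin_sum: "lin f \<Longrightarrow> f (sum h A) = (\<Sum>a\<in>A. f (h a))"
  using module_hom.sum[of fun_scale fun_scale f] by (simp add: module_hom_iff_linear)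

lemma basis_expansion:
  assumes "basis_of B V" "v \<in> V"
  shows "(\<Sum>b\<in>B. fun_scale (fun_vs.representation B v b) b) = v"
  using assms by (intro fun_vs.sum_representation_eq) auto

lemma representation_sum_scale:
  assumes "basis_of B V" "\<And>c. c \<in> C \<Longrightarrow> h c \<in> V"
  shows "fun_vs.representation B (\<Sum>c\<in>C. fun_scale (u c) (h c)) b =
    (\<Sum>c\<in>C. u c * fun_vs.representation B (h c) b)"
proof -
  have "fun_vs.representation B (\<Sum>c\<in>C. fun_scale (u c) (h c)) b =
      (\<Sum>c\<in>C. fun_vs.representation B (fun_scale (u c) (h c)) b)"
    using assms by (subst fun_vs.representation_sum) (auto intro: fun_vs.span_scale)
  also have "\<dots> = (\<Sum>c\<in>C. u c * fun_vs.representation B (h c) b)"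
    using assms by (intro sum.cong refl) (subst fun_vs.representation_scale, auto)
  finally show ?thesis .
qed

lemma representation_of_basis:
  assumes "basis_of B V" "c \<in> B"
  shows "fun_vs.representation B c b = (if b = c then 1 else 0)"
  using assms by (subst fun_vs.representation_basis) auto

text \<open>Cyclicity of the trace for two mutually inverse base changes: \<open>b\<close> and then
  \<open>f c\<close> are expanded in \<open>C\<close>, and after exchanging the sums the coordinates
  of \<open>C\<close> in \<open>B\<close> meet those of \<open>B\<close> in \<open>C\<close> and
  cancel.\<close>

lemma trace_basis_change:
  assumes B: "basis_of B V" and C: "basis_of C V" and f: "lin f" and inv: "f ` V \<subseteq> V"
  shows "(\<Sum>b\<in>B. fun_vs.representation B (f b) b) = (\<Sum>c\<in>C. fun_vs.representation C (f c) c)"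
proof -
  let ?P = "fun_vs.representation C" and ?Q = "fun_vs.representation B"
  have BV: "b \<in> V" if "b \<in> B" for b using B that fun_vs.span_base by auto
  have CV: "c \<in> V" if "c \<in> C" for c using C that fun_vs.span_base by auto
  have fC: "f c \<in> V" if "c \<in> C" for c using CV that inv by auto
  have "?Q (f b) b = (\<Sum>c\<in>C. \<Sum>d\<in>C. ?P b c * ?P (f c) d * ?Q d b)" if "b \<in> B" for b
  proof -
    have "f b = f (\<Sum>c\<in>C. fun_scale (?P b c) c)"
      using basis_expansion[OF C BV[OF that]] by simp
    also have "\<dots> = (\<Sum>c\<in>C. fun_scale (?P b c) (f c))"
      by (simp add: lin_sum[OF f] lin_scale[OF f])
    finally have "?Q (f b) b = (\<Sum>c\<in>C. ?P b c * ?Q (f c) b)"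
      by (simp add: representation_sum_scale[OF B] fC)
    also have "\<dots> = (\<Sum>c\<in>C. ?P b c * (\<Sum>d\<in>C. ?P (f c) d * ?Q d b))"
    proof (intro sum.cong refl)
      fix c assume c: "c \<in> C"
      have "?Q (f c) b = ?Q (\<Sum>d\<in>C. fun_scale (?P (f c) d) d) b"
        using basis_expansion[OF C fC[OF c]] by simp
      also have "\<dots> = (\<Sum>d\<in>C. ?P (f c) d * ?Q d b)"
        by (rule representation_sum_scale[OF B CV])
      finally show "?P b c * ?Q (f c) b = ?P b c * (\<Sum>d\<in>C. ?P (f c) d * ?Q d b)" by simp
    qed
    finally show ?thesis by (simp add: sum_distrib_left mult.assoc)
  qed
  then have "(\<Sum>b\<in>B. ?Q (f b) b) = (\<Sum>b\<in>B. \<Sum>c\<in>C. \<Sum>d\<in>C. ?P b c * ?P (f c) d * ?Q d b)"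
    by (rule sum.cong[OF refl])
  also have "\<dots> = (\<Sum>c\<in>C. \<Sum>b\<in>B. \<Sum>d\<in>C. ?P b c * ?P (f c) d * ?Q d b)"
    by (rule sum.swap)
  also have "\<dots> = (\<Sum>c\<in>C. \<Sum>d\<in>C. \<Sum>b\<in>B. ?P b c * ?P (f c) d * ?Q d b)"
    by (rule sum.cong[OF refl], rule sum.swap)
  also have "\<dots> = (\<Sum>c\<in>C. \<Sum>d\<in>C. ?P (f c) d * (if d = c then 1 else 0))"
  proof (intro sum.cong refl)
    fix c d assume c: "c \<in> C" and d: "d \<in> C"
    have "(\<Sum>b\<in>B. ?Q d b * ?P b c) = ?P (\<Sum>b\<in>B. fun_scale (?Q d b) b) c"
      by (rule representation_sum_scale[OF C BV, symmetric])
    also have "\<dots> = ?P d c" by (simp add: basis_expansion[OF B CV[OF d]])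
    also have "\<dots> = (if d = c then 1 else 0)"
      using representation_of_basis[OF C d, of c] by auto
    finally have *: "(\<Sum>b\<in>B. ?Q d b * ?P b c) = (if d = c then 1 else 0)" .
    have "(\<Sum>b\<in>B. ?P b c * ?P (f c) d * ?Q d b) = (\<Sum>b\<in>B. ?P (f c) d * (?Q d b * ?P b c))"
      by (intro sum.cong refl) simp
    then show "(\<Sum>b\<in>B. ?P b c * ?P (f c) d * ?Q d b) = ?P (f c) d * (if d = c then 1 else 0)"
      by (simp only: sum_distrib_left[symmetric] *)
  qed
  also have "\<dots> = (\<Sum>c\<in>C. ?P (f c) c)"
    using C by (intro sum.cong refl) (simp add: if_distrib sum.delta' cong: if_cong)
  finally show ?thesis .
qed

lemma trace_on_eq:
  assumes B: "basis_of B V" and f: "lin f" and inv: "f ` V \<subseteq> V"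
  shows "trace_on V f = (\<Sum>b\<in>B. fun_vs.representation B (f b) b)"
proof -
  define C where "C = (SOME B. fun_vs.independent B \<and> fun_vs.span B = V)"
  have C: "fun_vs.independent C" "fun_vs.span C = V"
    using someI_ex[of "\<lambda>B. fun_vs.independent B \<and> fun_vs.span B = V"] B by (auto simp: C_def)
  have "finite C"
    using fun_vs.independent_span_bound[of B C] B C fun_vs.span_superset[of C] by auto
  then have "basis_of C V" using C by auto
  from trace_basis_change[OF this B f inv] show ?thesis
    by (simp add: trace_on_def C_def Let_def)
qed

text \<open>The spanning set may leave \<open>V\<close>, so the property passes to subspaces at
  once.\<close>

definition fin_dim :: "('a \<Rightarrow> complex) set \<Rightarrow> bool" where
  "fin_dim V \<longleftrightarrow> fun_vs.subspace V \<and> (\<exists>S. finite S \<and> V \<subseteq> fun_vs.span S)"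

lemma fin_dim_extend_basis:
  assumes V: "fin_dim V" and K: "K \<subseteq> V" "fun_vs.independent K"
  shows "\<exists>L. K \<subseteq> L \<and> basis_of L V"
proof -
  obtain L where L: "K \<subseteq> L" "L \<subseteq> V" "fun_vs.independent L" "V \<subseteq> fun_vs.span L"
    using fun_vs.maximal_independent_subset_extend[OF K] by blast
  obtain S where S: "finite S" "V \<subseteq> fun_vs.span S" using V by (auto simp: fin_dim_def)
  have "finite L" using fun_vs.independent_span_bound[OF S(1) L(3)] L S by auto
  moreover have "fun_vs.span L = V"
    using L V fun_vs.span_minimal[of L V] by (auto simp: fin_dim_def)
  ultimately show ?thesis using L by blast
qed

lemma fin_dim_subset: "fin_dim V \<Longrightarrow> U \<subseteq> V \<Longrightarrow> fun_vs.subspace U \<Longrightarrow> fin_dim U"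
  unfolding fin_dim_def by blast

lemma fin_dim_basis: "fin_dim V \<Longrightarrow> \<exists>L. basis_of L V"
  using fin_dim_extend_basis[of V "{}"] fun_vs.independent_empty by blast

text \<open>In a basis of \<open>V\<close> extending one of the kernel of \<open>T\<close>, the
  matrix of \<open>f\<close> is block triangular; \<open>T\<close> carries the added vectors to a
  basis of \<open>U\<close>, in which \<open>g\<close> has the second diagonal block as its
  matrix.\<close>

lemma trace_exact:
  assumes V: "fin_dim V" and T: "lin T" and TV: "T ` V = U"
    and f: "lin f" and fV: "f ` V \<subseteq> V" and g: "lin g"
    and comm: "\<And>v. v \<in> V \<Longrightarrow> T (f v) = g (T v)"
  shows "trace_on V f = trace_on {v\<in>V. T v = 0} f + trace_on U g"
proof -
  define W where "W = {v\<in>V. T v = 0}"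
  have subV: "fun_vs.subspace V" using V by (simp add: fin_dim_def)
  have subW: "fun_vs.subspace W"
    using subV by (auto simp: W_def fun_vs.subspace_def lin_add[OF T] lin_scale[OF T] lin_0[OF T])
  have "fin_dim W" using fin_dim_subset[OF V _ subW] by (auto simp: W_def)
  then obtain K where K: "basis_of K W" using fin_dim_basis by blast
  have KW: "K \<subseteq> W" using K fun_vs.span_superset by blast
  obtain L where L: "K \<subseteq> L" "basis_of L V"
    using fin_dim_extend_basis[OF V, of K] K KW by (auto simp: W_def)
  have LV: "L \<subseteq> V" using L fun_vs.span_superset by blast
  define D where "D = L - K"
  have finD: "finite D" and finK: "finite K" using L K by (auto simp: D_def)
  have indD: "fun_vs.independent D" using L fun_vs.independent_mono[of L D] by (auto simp: D_def)
  have LKD: "L = K \<union> D" "K \<inter> D = {}" using L by (auto simp: D_def)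
  have inj: "inj_on T (fun_vs.span D)"
  proof (subst module_hom.inj_on_iff_eq_0)
    show "module_hom fun_scale fun_scale T" using T by (simp add: module_hom_iff_linear)
    show "\<forall>x\<in>fun_vs.span D. T x = 0 \<longrightarrow> x = 0"
    proof (intro ballI impI)
      fix x assume x: "x \<in> fun_vs.span D" "T x = 0"
      have "x \<in> V" using x(1) LV L fun_vs.span_mono[of D L] by (auto simp: D_def)
      with x have "x \<in> fun_vs.span K" using K by (auto simp: W_def)
      have "fun_vs.representation L x = fun_vs.representation D x"
        using L x(1) by (intro fun_vs.representation_extend) (auto simp: D_def)
      moreover have "fun_vs.representation L x = fun_vs.representation K x"
        using L \<open>x \<in> fun_vs.span K\<close> by (intro fun_vs.representation_extend) auto
      ultimately have eq: "fun_vs.representation D x = fun_vs.representation K x" by simp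
      \<comment> \<open>The coordinates of \<open>x\<close> are supported in \<open>D\<close> and
        also in \<open>K\<close>, and these are disjoint.\<close>
      have "fun_vs.representation D x b = 0" for b
        using fun_vs.representation_ne_zero[of D x b] fun_vs.representation_ne_zero[of K x b]
          eq LKD by (auto simp: fun_eq_iff)
      then have "(\<Sum>b\<in>D. fun_scale (fun_vs.representation D x b) b) = 0" by simp
      then show "x = 0"
        using fun_vs.sum_representation_eq[OF indD x(1) finD] by simp
    qed
  qed (rule fun_vs.subspace_span)
  have injD: "inj_on T D" using inj fun_vs.span_superset inj_on_subset by blast
  have indTD: "fun_vs.independent (T ` D)"
    using module_hom.independent_injective_image[of fun_scale fun_scale T D] T indD inj
    by (simp add: module_hom_iff_linear)
  have spTD: "fun_vs.span (T ` D) = U"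
  proof -
    have "fun_vs.span (T ` L) = T ` fun_vs.span L"
      using module_hom.span_image[of fun_scale fun_scale T L] T by (simp add: module_hom_iff_linear)
    moreover have "T ` L - {0} = T ` D - {0}"
      using KW by (auto simp: LKD W_def)
    then have "fun_vs.span (T ` L) = fun_vs.span (T ` D)"
      by (metis fun_vs.span_delete_0)
    ultimately show ?thesis using L TV by auto
  qed
  have TD: "basis_of (T ` D) U" using indTD spTD finD by auto
  have gU: "g ` U \<subseteq> U" using fV comm TV by force
  have fW: "f ` W \<subseteq> W" using fV comm lin_0[OF g] by (force simp: W_def)
  have 1: "fun_vs.representation L (f b) b = fun_vs.representation K (f b) b" if "b \<in> K" for b
  proof -
    have "f b \<in> fun_vs.span K" using K KW fW that by auto
    with L show ?thesis by (subst fun_vs.representation_extend[of L _ K]) auto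
  qed
  have 2: "fun_vs.representation (T ` D) (g (T d)) (T d) = fun_vs.representation L (f d) d"
    if d: "d \<in> D" for d
  proof -
    let ?r = "fun_vs.representation L (f d)"
    have fd: "f d \<in> V" using d LV fV by (auto simp: D_def)
    have "g (T d) = T (f d)" using d LV comm by (auto simp: D_def)
    also have "\<dots> = T (\<Sum>b\<in>L. fun_scale (?r b) b)" by (simp add: basis_expansion[OF L(2) fd])
    also have "\<dots> = (\<Sum>b\<in>L. fun_scale (?r b) (T b))" by (simp add: lin_sum[OF T] lin_scale[OF T])
    also have "\<dots> = (\<Sum>b\<in>D. fun_scale (?r b) (T b))"
      using L KW by (intro sum.mono_neutral_right) (auto simp: D_def W_def)
    finally have "fun_vs.representation (T ` D) (g (T d)) (T d) =
        (\<Sum>b\<in>D. ?r b * fun_vs.representation (T ` D) (T b) (T d))"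
      using LV TV by (subst representation_sum_scale[OF TD, symmetric]) (auto simp: D_def)
    also have "\<dots> = (\<Sum>b\<in>D. if b = d then ?r b else 0)"
      using injD d by (intro sum.cong refl) (auto simp: representation_of_basis[OF TD] dest: inj_onD)
    also have "\<dots> = ?r d" using finD d by simp
    finally show ?thesis .
  qed
  have "trace_on V f = (\<Sum>b\<in>K. fun_vs.representation L (f b) b) + (\<Sum>b\<in>D. fun_vs.representation L (f b) b)"
    unfolding trace_on_eq[OF L(2) f fV] LKD(1) using finK finD LKD(2) by (subst sum.union_disjoint) auto
  also have "(\<Sum>b\<in>K. fun_vs.representation L (f b) b) = trace_on W f"
    unfolding trace_on_eq[OF K f fW] using 1 by simp
  also have "(\<Sum>b\<in>D. fun_vs.representation L (f b) b) = trace_on U g"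
    unfolding trace_on_eq[OF TD g gU] using 2 injD by (simp add: sum.reindex)
  finally show ?thesis unfolding W_def .
qed

lemma trace_on_0: "trace_on {0} f = 0" if "lin f"
  using trace_on_eq[of "{}" "{0}" f] that lin_0[OF that] fun_vs.independent_empty by simp

lemma trace_iso:
  assumes "fin_dim V" "lin T" "T ` V = U" "lin f" "f ` V \<subseteq> V" "lin g"
    "\<And>v. v \<in> V \<Longrightarrow> T (f v) = g (T v)" "\<And>v. v \<in> V \<Longrightarrow> T v = 0 \<Longrightarrow> v = 0"
  shows "trace_on V f = trace_on U g"
proof -
  have "0 \<in> V" using assms(1) fun_vs.subspace_0 by (auto simp: fin_dim_def)
  then have "{v\<in>V. T v = 0} = {0}" using assms(8) lin_0[OF assms(2)] by auto
  then show ?thesis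
    using trace_exact[OF assms(1-7)] trace_on_0[OF assms(4)] by simp
qed

section \<open>Functions on permutations and coset sums\<close>

text \<open>Functions on the symmetric group of \<open>N\<close>, extended by zero to all self-maps
  so that identities between values at \<open>t\<close> and \<open>t \<circ> p\<close> can be stated
  for every \<open>t\<close>.\<close>

definition perm_fns :: "'a set \<Rightarrow> (('a \<Rightarrow> 'a) \<Rightarrow> complex) set" where
  "perm_fns N = {V. \<forall>t. \<not> t permutes N \<longrightarrow> V t = 0}"

definition twist :: "bool \<Rightarrow> ('a \<Rightarrow> 'a) \<Rightarrow> complex" where
  "twist s p = (if s then of_int (sign p) else 1)"

definition eqv :: "bool \<Rightarrow> 'a set \<Rightarrow> (('a \<Rightarrow> 'a) \<Rightarrow> complex) \<Rightarrow> bool" where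
  "eqv s S V \<longleftrightarrow> (\<forall>p t. p permutes S \<longrightarrow> V (t \<circ> p) = twist s p * V t)"

text \<open>The root vector that moves an entry from the block of \<open>q\<close> into the block \<open>S\<close>, which is
  alternating if \<open>s\<close> holds and symmetric otherwise: for \<open>q \<notin> S\<close> the transpositions \<open>(c q)\<close> represent
  the cosets of the permutations of \<open>S\<close> in those of \<open>insert q S\<close>.\<close>

definition coset_sum :: "bool \<Rightarrow> 'a \<Rightarrow> 'a set \<Rightarrow> (('a \<Rightarrow> 'a) \<Rightarrow> complex) \<Rightarrow> ('a \<Rightarrow> 'a) \<Rightarrow> complex" where
  "coset_sum s q S V = (\<lambda>t. \<Sum>c\<in>insert q S. twist s (transpose c q) * V (t \<circ> transpose c q))"

definition perm_inner :: "'a set \<Rightarrow> (('a \<Rightarrow> 'a) \<Rightarrow> complex) \<Rightarrow> (('a \<Rightarrow> 'a) \<Rightarrow> complex) \<Rightarrow> complex" where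
  "perm_inner N V W = (\<Sum>t | t permutes N. V t * cnj (W t))"

definition left_mult :: "('a \<Rightarrow> 'a) \<Rightarrow> (('a \<Rightarrow> 'a) \<Rightarrow> complex) \<Rightarrow> ('a \<Rightarrow> 'a) \<Rightarrow> complex" where
  "left_mult g V = (\<lambda>t. V (inv g \<circ> t))"

lemma twist_mult: "permutation p \<Longrightarrow> permutation q \<Longrightarrow> twist s (p \<circ> q) = twist s p * twist s q"
  by (simp add: twist_def sign_compose)

lemma twist_transpose: "twist s (transpose a b) = (if s \<and> a \<noteq> b then -1 else 1)"
  by (simp add: twist_def sign_swap_id)

lemma cnj_twist [simp]: "cnj (twist s p) = twist s p"
  by (simp add: twist_def)

lemma eqvD: "eqv s S V \<Longrightarrow> p permutes S \<Longrightarrow> V (t \<circ> p) = twist s p * V t"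
  by (simp add: eqv_def)

lemma eqv_transpose: "eqv s S V \<Longrightarrow> a \<in> S \<Longrightarrow> b \<in> S \<Longrightarrow>
    V (t \<circ> transpose a b) = (if s \<and> a \<noteq> b then - V t else V t)"
  using eqvD[of s S V "transpose a b" t] permutes_swap_id[of a S b] by (simp add: twist_transpose)

lemma eqv_subset: "eqv s S V \<Longrightarrow> T \<subseteq> S \<Longrightarrow> eqv s T V"
  unfolding eqv_def using permutes_subset by blast

lemma coset_sum_split:
  assumes "finite S" "q \<notin> S"
  shows "coset_sum s q S V t = V t + (if s then -1 else 1) * (\<Sum>c\<in>S. V (t \<circ> transpose c q))"
proof -
  have "(\<Sum>c\<in>S. twist s (transpose c q) * V (t \<circ> transpose c q)) =
      (\<Sum>c\<in>S. (if s then -1 else 1) * V (t \<circ> transpose c q))"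
    using assms(2) by (intro sum.cong) (auto simp: twist_transpose)
  then show ?thesis
    using assms by (simp add: coset_sum_def twist_transpose sum_distrib_left sum_negf transpose_same)
qed

lemma bij_comp_transpose: "bij p \<Longrightarrow> p \<circ> transpose a b = transpose (p a) (p b) \<circ> p"
  by (auto simp: fun_eq_iff transpose_def bij_def dest: injD)

text \<open>The factor \<open>p\<close> permutes the cosets:
  \<open>p \<circ> transpose c q = transpose (p c) q \<circ> r\<close>, where \<open>r\<close> fixes
  \<open>q\<close>, hence permutes \<open>S\<close> and is absorbed by \<open>V\<close> together
  with its sign.\<close>

lemma coset_sum_eqv:
  assumes S: "finite S" "q \<notin> S" and V: "eqv s S V"
  shows "eqv s (insert q S) (coset_sum s q S V)"
  unfolding eqv_def
proof (intro allI impI)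
  fix p :: "'a \<Rightarrow> 'a" and t :: "'a \<Rightarrow> 'a" assume p: "p permutes insert q S"
  have fin: "finite (insert q S)" using S by simp
  have perm: "permutation f" if "f permutes insert q S" for f :: "'a \<Rightarrow> 'a"
    using fin that permutation_permutes by blast
  have tr: "transpose c q permutes insert q S" if "c \<in> insert q S" for c
    using that by (intro permutes_swap_id) auto
  have "coset_sum s q S V (t \<circ> p) =
      (\<Sum>c\<in>insert q S. twist s (transpose c q) * V (t \<circ> (p \<circ> transpose c q)))"
    by (simp add: coset_sum_def o_assoc)
  also have "\<dots> = (\<Sum>c\<in>insert q S. twist s p * (twist s (transpose (p c) q) * V (t \<circ> transpose (p c) q)))"
  proof (intro sum.cong refl)
    fix c assume c: "c \<in> insert q S"
    have pc: "p c \<in> insert q S" using c permutes_in_image[OF p] by blast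
    define r where "r = transpose (p c) q \<circ> p \<circ> transpose c q"
    have r: "r permutes insert q S"
      unfolding r_def using p tr[OF c] tr[OF pc] by (intro permutes_compose)
    have "r q = q" by (simp add: r_def)
    then have rS: "r permutes S" using r by (intro permutes_superset[OF r]) auto
    have "p \<circ> transpose c q = transpose (p c) q \<circ> r"
      by (simp add: r_def o_assoc)
    then have "V (t \<circ> (p \<circ> transpose c q)) = twist s r * V (t \<circ> transpose (p c) q)"
      using eqvD[OF V rS, of "t \<circ> transpose (p c) q"] by (simp add: o_assoc)
    moreover have "twist s r = twist s (transpose (p c) q) * twist s p * twist s (transpose c q)"
      unfolding r_def using perm[OF p] perm[OF tr[OF c]] perm[OF tr[OF pc]]
      by (simp add: twist_mult permutation_compose)
    ultimately show "twist s (transpose c q) * V (t \<circ> (p \<circ> transpose c q)) =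
        twist s p * (twist s (transpose (p c) q) * V (t \<circ> transpose (p c) q))"
      by (simp add: twist_transpose)
  qed
  also have "\<dots> = twist s p * (\<Sum>c\<in>insert q S. twist s (transpose (p c) q) * V (t \<circ> transpose (p c) q))"
    by (simp only: sum_distrib_left)
  also have "(\<Sum>c\<in>insert q S. twist s (transpose (p c) q) * V (t \<circ> transpose (p c) q)) = coset_sum s q S V t"
    unfolding coset_sum_def
    by (subst (2) sum.permute[OF p]) (rule sum.cong, simp_all)
  finally show "coset_sum s q S V (t \<circ> p) = twist s p * coset_sum s q S V t" .
qed

text \<open>Renaming positions moves both the block and the added point. With \<open>p\<close> a
  transposition that preserves the block, this compares the operators at two different points, which
  is its main use below.\<close>

lemma coset_sum_conj:
  assumes "bij p"
  shows "coset_sum s q S V (t \<circ> p) = coset_sum s (p q) (p ` S) (\<lambda>t. V (t \<circ> p)) t"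
proof -
  have inj: "inj_on p (insert q S)" using assms by (simp add: bij_def inj_on_def)
  have "(\<Sum>c\<in>p ` insert q S. twist s (transpose c (p q)) * V (t \<circ> transpose c (p q) \<circ> p)) =
      (\<Sum>c\<in>insert q S. twist s (transpose (p c) (p q)) * V (t \<circ> transpose (p c) (p q) \<circ> p))"
    by (subst sum.reindex[OF inj]) (rule sum.cong, simp_all)
  also have "\<dots> = (\<Sum>c\<in>insert q S. twist s (transpose c q) * V (t \<circ> p \<circ> transpose c q))"
    using assms bij_comp_transpose[OF assms] bij_is_inj[OF assms]
    by (intro sum.cong refl) (simp add: twist_transpose o_assoc[symmetric] inj_eq)
  finally show ?thesis by (simp add: coset_sum_def)
qed

lemma coset_sum_scale: "coset_sum s q S (\<lambda>t. c * V t) t = c * coset_sum s q S V t"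
  by (simp add: coset_sum_def sum_distrib_left mult_ac)

lemma coset_sum_eqv_other:
  assumes V: "eqv s' T V" and "T \<inter> insert q S = {}"
  shows "eqv s' T (coset_sum s q S V)"
  unfolding eqv_def
proof (intro allI impI)
  fix p :: "'a \<Rightarrow> 'a" and t :: "'a \<Rightarrow> 'a" assume p: "p permutes T"
  have fixes_S: "p c = c" if "c \<in> insert q S" for c
    using that assms(2) p by (auto simp: permutes_def)
  then have pS: "p ` S = S" by (auto simp: image_iff)
  have "coset_sum s q S V (t \<circ> p) = coset_sum s q S (\<lambda>t. V (t \<circ> p)) t"
    using coset_sum_conj[OF permutes_bij[OF p], of s q S V t] fixes_S[of q] pS by simp
  also have "\<dots> = twist s' p * coset_sum s q S V t"
    by (simp add: eqvD[OF V p] coset_sum_scale)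
  finally show "coset_sum s q S V (t \<circ> p) = twist s' p * coset_sum s q S V t" .
qed

lemma permutes_comp_iff: "p permutes N \<Longrightarrow> t \<circ> p permutes N \<longleftrightarrow> t permutes N"
proof
  assume p: "p permutes N" and tp: "t \<circ> p permutes N"
  have "t \<circ> p \<circ> inv p permutes N" using permutes_compose[OF permutes_inv[OF p] tp] .
  then show "t permutes N" using permutes_inv_o(1)[OF p] by (simp add: o_assoc[symmetric])
qed (rule permutes_compose)

lemma coset_sum_fns:
  assumes "V \<in> perm_fns N" "insert q S \<subseteq> N"
  shows "coset_sum s q S V \<in> perm_fns N"
proof -
  have "V (t \<circ> transpose c q) = 0" if "\<not> t permutes N" "c \<in> insert q S" for t c
    using assms that permutes_comp_iff[OF permutes_swap_id[of c N q]] by (auto simp: perm_fns_def)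
  then show ?thesis by (simp add: perm_fns_def coset_sum_def)
qed

lemma lin_coset_sum: "lin (coset_sum s q S)"
  by (rule linI) (auto simp: coset_sum_def fun_scale_def fun_eq_iff sum.distrib sum_distrib_left algebra_simps)

lemma lin_left_mult: "lin (left_mult g)"
  by (rule linI) (auto simp: left_mult_def fun_scale_def)

lemma left_mult_coset_sum: "left_mult g (coset_sum s q S V) = coset_sum s q S (left_mult g V)"
  by (simp add: left_mult_def coset_sum_def o_assoc)

lemma left_mult_eqv: "eqv s S V \<Longrightarrow> eqv s S (left_mult g V)"
  by (simp add: eqv_def left_mult_def o_assoc)

lemma left_mult_fns:
  assumes "g permutes N" "V \<in> perm_fns N"
  shows "left_mult g V \<in> perm_fns N"
proof -
  have "t permutes N" if "inv g \<circ> t permutes N" for t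
    using permutes_compose[OF that assms(1)] permutes_inv_o(1)[OF assms(1)] by (simp add: o_assoc)
  then show ?thesis using assms(2) by (auto simp: perm_fns_def left_mult_def)
qed

lemma perm_fns_subspace: "fun_vs.subspace (perm_fns N)"
  by (auto simp: fun_vs.subspace_def perm_fns_def fun_scale_def)

section \<open>The inner product on functions on permutations\<close>

lemma perm_inner_comp:
  assumes p: "p permutes N"
  shows "perm_inner N (\<lambda>t. V (t \<circ> p)) (\<lambda>t. W (t \<circ> p)) = perm_inner N V W"
  unfolding perm_inner_def
  using sum_permutations_compose_right[OF p, of "\<lambda>t. V t * cnj (W t)"] by simp

lemma perm_inner_self: "perm_inner N V V = of_real (\<Sum>t | t permutes N. (cmod (V t))\<^sup>2)"
  by (simp only: perm_inner_def complex_norm_square of_real_sum)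

lemma perm_inner_definite:
  assumes "finite N" "V \<in> perm_fns N" "perm_inner N V V = 0"
  shows "V = 0"
proof -
  have "(\<Sum>t | t permutes N. (cmod (V t))\<^sup>2) = 0"
    using assms(3) by (simp only: perm_inner_self of_real_eq_0_iff)
  then have "\<forall>t\<in>{t. t permutes N}. (cmod (V t))\<^sup>2 = 0"
    using finite_permutations[OF assms(1)] by (subst (asm) sum_nonneg_eq_0_iff) auto
  then show ?thesis using assms(2) by (auto simp: perm_fns_def fun_eq_iff)
qed

lemma perm_inner_sum_left: "perm_inner N (\<lambda>t. \<Sum>c\<in>C. u c * V c t) W = (\<Sum>c\<in>C. u c * perm_inner N (V c) W)"
  unfolding perm_inner_def sum_distrib_right sum_distrib_left by (subst sum.swap) (simp add: mult_ac)

lemma perm_inner_sum_right: "perm_inner N W (\<lambda>t. \<Sum>c\<in>C. u c * V c t) = (\<Sum>c\<in>C. cnj (u c) * perm_inner N W (V c))"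
  unfolding perm_inner_def sum_distrib_right sum_distrib_left cnj_sum by (subst sum.swap) (simp add: mult_ac)

lemma perm_inner_cnj: "perm_inner N W V = cnj (perm_inner N V W)"
  by (simp add: perm_inner_def cnj_sum mult.commute)

lemma perm_inner_transpose:
  assumes "a \<in> N" "b \<in> N"
  shows "perm_inner N (\<lambda>t. V (t \<circ> transpose a b)) W = perm_inner N V (\<lambda>t. W (t \<circ> transpose a b))"
  using perm_inner_comp[OF permutes_swap_id[OF assms], of V "\<lambda>t. W (t \<circ> transpose a b)"]
  by (simp add: o_assoc[symmetric])

text \<open>Transpositions are involutions and the twists are real, so each summand is
  self-adjoint.\<close>

lemma perm_inner_coset_sum_adjoint:
  assumes "insert q S \<subseteq> N"
  shows "perm_inner N (coset_sum s q S V) W = perm_inner N V (coset_sum s q S W)"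
  using assms unfolding coset_sum_def perm_inner_sum_left perm_inner_sum_right
  by (intro sum.cong refl) (auto simp: perm_inner_transpose)

lemma coset_sum_of_eqv:
  assumes "eqv s (insert q S) W" "finite S" "q \<notin> S"
  shows "coset_sum s q S W t = of_nat (card S + 1) * W t"
proof -
  have "coset_sum s q S W t = (\<Sum>c\<in>insert q S. W t)"
    unfolding coset_sum_def using eqv_transpose[OF assms(1)]
    by (intro sum.cong refl) (auto simp: twist_transpose)
  then show ?thesis using assms by simp
qed

text \<open>The operator is moved to \<open>W\<close>, where invariance makes all
  \<open>card S + 1\<close> summands equal.\<close>

lemma perm_inner_coset_sum:
  assumes "insert q S \<subseteq> N" "eqv s (insert q S) W" "finite S" "q \<notin> S"
  shows "perm_inner N (coset_sum s q S V) W = of_nat (card S + 1) * perm_inner N V W"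
  unfolding perm_inner_coset_sum_adjoint[OF assms(1)]
  by (simp add: coset_sum_of_eqv[OF assms(2-4)] perm_inner_def sum_distrib_left mult_ac)

text \<open>An odd root vector squares to zero. The result \<open>?Q\<close> is symmetric in
  \<open>r\<close> and \<open>y\<close> while \<open>w\<close> changes sign, so the two are
  orthogonal; since \<open>?Q\<close> is invariant under both enlarged blocks, adjointness turns its
  norm into a multiple of \<open>perm_inner N w ?Q\<close>.\<close>

lemma coset_sum_coset_sum_zero:
  assumes N: "finite N" "insert y (insert r S) \<subseteq> N" and w: "w \<in> perm_fns N" "eqv False S w"
    and anti: "\<And>t. w (t \<circ> transpose r y) = - w t" and r: "r \<notin> S" "y \<notin> S" "r \<noteq> y"
  shows "coset_sum False y (insert r S) (coset_sum False r S w) = 0"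
proof (rule perm_inner_definite)
  let ?Q = "coset_sum False y (insert r S) (coset_sum False r S w)"
  have fin: "finite S" using N by (auto intro: finite_subset)
  have Q: "eqv False (insert y (insert r S)) ?Q"
    using fin r w by (intro coset_sum_eqv) auto
  have "perm_inner N w ?Q = - perm_inner N w ?Q"
  proof -
    have "perm_inner N w ?Q = perm_inner N (\<lambda>t. w (t \<circ> transpose r y)) (\<lambda>t. ?Q (t \<circ> transpose r y))"
      using N by (intro perm_inner_comp[symmetric] permutes_swap_id) auto
    also have "\<dots> = - perm_inner N w ?Q"
      using eqv_transpose[OF Q, of r y] by (simp add: anti perm_inner_def sum_negf)
    finally show ?thesis .
  qed
  then have "perm_inner N w ?Q = 0" by simp
  then have "perm_inner N (coset_sum False r S w) ?Q = 0"
    using N fin r eqv_subset[OF Q, of "insert r S"] by (subst perm_inner_coset_sum) auto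
  then show "perm_inner N ?Q ?Q = 0"
    using N fin r Q by (subst perm_inner_coset_sum) auto
  show "?Q \<in> perm_fns N" using w N by (intro coset_sum_fns) auto
qed fact

lemma fin_dim_perm_fns: 
  assumes "finite N" shows "fin_dim (perm_fns N)"
  unfolding fin_dim_def
proof (intro conjI exI)
  let ?d = "\<lambda>t. (\<lambda>u. if u = t then 1 else 0 :: complex)"
  show "finite (?d ` {t. t permutes N})" using finite_permutations[OF assms] by simp
  show "perm_fns N \<subseteq> fun_vs.span (?d ` {t. t permutes N})"
  proof
    fix V :: "('a \<Rightarrow> 'a) \<Rightarrow> complex" assume V: "V \<in> perm_fns N"
    have "(\<Sum>t\<in>T. fun_scale (V t) (?d t)) u = (if u \<in> T then V u else 0)" if "finite T" for u T
      using that by induction (auto simp: fun_scale_def)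
    then have "V = (\<Sum>t | t permutes N. fun_scale (V t) (?d t))"
      using V finite_permutations[OF assms] by (auto simp: fun_eq_iff perm_fns_def)
    also have "\<dots> \<in> fun_vs.span (?d ` {t. t permutes N})"
      by (intro fun_vs.span_sum fun_vs.span_scale fun_vs.span_base) auto
    finally show "V \<in> fun_vs.span (?d ` {t. t permutes N})" .
  qed
qed (rule perm_fns_subspace)

section \<open>Koszul exactness\<close>

text \<open>\<open>A\<close> and \<open>B\<close> are the positions of the first two rows,
  \<open>X\<close> those of the one-cell rows. Each may be empty.\<close>

definition blocks :: "'a set \<Rightarrow> 'a set \<Rightarrow> 'a set \<Rightarrow> 'a set \<Rightarrow> bool" where
  "blocks N A B X \<longleftrightarrow> finite N \<and> A \<union> B \<union> X = N \<and> A \<inter> B = {} \<and> A \<inter> X = {} \<and> B \<inter> X = {}"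

definition young_mod :: "'a set \<Rightarrow> 'a set \<Rightarrow> 'a set \<Rightarrow> 'a set \<Rightarrow> (('a \<Rightarrow> 'a) \<Rightarrow> complex) set" where
  "young_mod N A B X = {V \<in> perm_fns N. eqv False A V \<and> eqv False B V \<and> eqv True X V}"

text \<open>Quantifying over all \<open>x\<close> makes this the whole Young module when
  \<open>X\<close> is empty; otherwise a single \<open>x\<close> suffices, see
  \<open>koszul_ker_eq_kernel\<close>.\<close>

definition koszul_ker :: "'a set \<Rightarrow> 'a set \<Rightarrow> 'a set \<Rightarrow> 'a set \<Rightarrow> (('a \<Rightarrow> 'a) \<Rightarrow> complex) set" where
  "koszul_ker N A B X = {V \<in> young_mod N A B X. \<forall>x\<in>X. coset_sum False x B V = 0}"

definition hw_space :: "'a set \<Rightarrow> 'a set \<Rightarrow> 'a set \<Rightarrow> 'a set \<Rightarrow> (('a \<Rightarrow> 'a) \<Rightarrow> complex) set" where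
  "hw_space N A B X = {V \<in> young_mod N A B X. (\<forall>y\<in>B \<union> X. coset_sum False y A V = 0) \<and> (\<forall>x\<in>X. coset_sum False x B V = 0)}"

lemma partD:
  assumes "blocks N A B X"
  shows "finite N" "finite A" "finite B" "finite X" "A \<subseteq> N" "B \<subseteq> N" "X \<subseteq> N"
    "A \<inter> B = {}" "A \<inter> X = {}" "B \<inter> X = {}" "A \<union> B \<union> X = N"
  using assms unfolding blocks_def by (auto intro: finite_subset)

lemma young_mod_subspace: "fun_vs.subspace (young_mod N A B X)"
  by (auto simp: fun_vs.subspace_def young_mod_def perm_fns_def eqv_def fun_scale_def algebra_simps)

lemma koszul_ker_subspace: "fun_vs.subspace (koszul_ker N A B X)"
  using young_mod_subspace[of N A B X]
  by (auto simp: fun_vs.subspace_def koszul_ker_def lin_add[OF lin_coset_sum] lin_scale[OF lin_coset_sum] lin_0[OF lin_coset_sum])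

lemma hw_space_subspace: "fun_vs.subspace (hw_space N A B X)"
  using young_mod_subspace[of N A B X]
  by (auto simp: fun_vs.subspace_def hw_space_def lin_add[OF lin_coset_sum] lin_scale[OF lin_coset_sum] lin_0[OF lin_coset_sum])

lemma young_mod_fns: "young_mod N A B X \<subseteq> perm_fns N" and koszul_ker_young_mod: "koszul_ker N A B X \<subseteq> young_mod N A B X"
  and hw_space_koszul_ker: "hw_space N A B X \<subseteq> koszul_ker N A B X"
  by (auto simp: young_mod_def koszul_ker_def hw_space_def)

lemma fin_dim_young_mod: "finite N \<Longrightarrow> fin_dim (young_mod N A B X)"
  and fin_dim_koszul_ker: "finite N \<Longrightarrow> fin_dim (koszul_ker N A B X)"
  by (rule fin_dim_subset[OF fin_dim_perm_fns];
      use young_mod_fns[of N A B X] koszul_ker_young_mod[of N A B X] young_mod_subspace koszul_ker_subspace in blast)+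

lemma left_mult_young_mod: "g permutes N \<Longrightarrow> left_mult g ` young_mod N A B X \<subseteq> young_mod N A B X"
  by (auto simp: young_mod_def left_mult_fns left_mult_eqv)

lemma left_mult_koszul_ker: "g permutes N \<Longrightarrow> left_mult g ` koszul_ker N A B X \<subseteq> koszul_ker N A B X"
  using left_mult_young_mod[of g N A B X] lin_0[OF lin_left_mult] by (auto simp: koszul_ker_def left_mult_coset_sum[symmetric])

lemma left_mult_hw_space: "g permutes N \<Longrightarrow> left_mult g ` hw_space N A B X \<subseteq> hw_space N A B X"
  using left_mult_young_mod[of g N A B X] lin_0[OF lin_left_mult] by (auto simp: hw_space_def left_mult_coset_sum[symmetric])

lemma coset_sum_False: "coset_sum False q S V t = (\<Sum>c\<in>insert q S. V (t \<circ> transpose c q))"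
  by (simp add: coset_sum_def twist_def)

lemma coset_sum_True:
  "finite S \<Longrightarrow> q \<notin> S \<Longrightarrow> coset_sum True q S V t = V t - (\<Sum>c\<in>S. V (t \<circ> transpose c q))"
  by (simp add: coset_sum_split)

lemma transpose_comp_transpose:
  "x \<noteq> c \<Longrightarrow> x \<noteq> q \<Longrightarrow> transpose c q \<circ> transpose x q = transpose x c \<circ> transpose c q"
  using bij_comp_transpose[OF bij_transpose, of c q x q] by simp

text \<open>Opposite odd root vectors compose to a Casimir-like element: \<open>transpose c q
  \<circ> transpose x q = transpose c x \<circ> transpose c q\<close>, and \<open>u\<close> absorbs
  the last factor, so that only transpositions between \<open>X\<close> and
  \<open>insert q S\<close> remain.\<close>

lemma coset_sum_coset_sum_casimir:
  assumes S: "finite S" "q \<notin> S" and X: "finite X" "q \<notin> X" "S \<inter> X = {}"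
    and u: "eqv False (insert q S) u"
  shows "coset_sum False q S (coset_sum True q X u) t =
    of_nat (card S + 1) * u t - (\<Sum>x\<in>X. \<Sum>c\<in>insert q S. u (t \<circ> transpose c x))"
proof -
  have "coset_sum False q S (coset_sum True q X u) t =
      (\<Sum>c\<in>insert q S. u (t \<circ> transpose c q) - (\<Sum>x\<in>X. u (t \<circ> transpose c q \<circ> transpose x q)))"
    unfolding coset_sum_False by (intro sum.cong refl coset_sum_True X)
  also have "\<dots> = (\<Sum>c\<in>insert q S. u t - (\<Sum>x\<in>X. u (t \<circ> transpose c x)))"
  proof (intro sum.cong refl arg_cong2[of _ _ _ _ "(-)"])
    fix c assume c: "c \<in> insert q S"
    show "u (t \<circ> transpose c q) = u t" using eqv_transpose[OF u c, of q] by simp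
    fix x assume x: "x \<in> X"
    have "t \<circ> transpose c q \<circ> transpose x q = t \<circ> transpose c x \<circ> transpose c q"
    proof -
      have "x \<noteq> c" "x \<noteq> q" using x c X by auto
      from transpose_comp_transpose[OF this] show ?thesis
        by (simp only: o_assoc[symmetric] transpose_commute[of x c])
    qed
    then show "u (t \<circ> transpose c q \<circ> transpose x q) = u (t \<circ> transpose c x)"
      using eqv_transpose[OF u c, of q "t \<circ> transpose c x"] by simp
  qed
  also have "\<dots> = of_nat (card S + 1) * u t - (\<Sum>x\<in>X. \<Sum>c\<in>insert q S. u (t \<circ> transpose c x))"
    using S by (simp only: sum_subtractf sum_constant card_insert_disjoint) (simp add: sum.swap[of _ X])
  finally show ?thesis .
qed

lemma young_mod_coset_sum:
  assumes P: "blocks N A B X" and V: "V \<in> young_mod N A B X" and q: "q \<in> X"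
  shows "coset_sum False q B V \<in> young_mod N A (insert q B) (X - {q})"
proof -
  note P' = partD[OF P]
  have V': "V \<in> perm_fns N" "eqv False A V" "eqv False B V" "eqv True (X - {q}) V"
    using V eqv_subset[of True X V "X - {q}"] by (auto simp: young_mod_def)
  show ?thesis
    unfolding young_mod_def mem_Collect_eq using P' q V'
    by (intro conjI coset_sum_fns coset_sum_eqv coset_sum_eqv_other) auto
qed

text \<open>One inclusion is the vanishing of the square. For the other, the alternating coset sum
  serves as a contracting homotopy: on the kernel the Casimir formula reduces the composite to the
  scalar \<open>?m\<close>, and division by it yields a preimage.\<close>

lemma koszul_image:
  assumes P: "blocks N A B X" and q: "q \<in> X"
  shows "coset_sum False q B ` young_mod N A B X = koszul_ker N A (insert q B) (X - {q})"
proof (intro equalityI subsetI)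
  fix W assume "W \<in> coset_sum False q B ` young_mod N A B X"
  then obtain V where V: "V \<in> young_mod N A B X" and W: "W = coset_sum False q B V" by auto
  have "coset_sum False x (insert q B) W = 0" if x: "x \<in> X - {q}" for x
    unfolding W
  proof (rule coset_sum_coset_sum_zero)
    show "V (t \<circ> transpose q x) = - V t" for t
      using eqv_transpose[of True X V q x t] V x q by (auto simp: young_mod_def)
  qed (use V partD[OF P] x q in \<open>auto simp: young_mod_def\<close>)
  then show "W \<in> koszul_ker N A (insert q B) (X - {q})"
    using young_mod_coset_sum[OF P V q] by (auto simp: koszul_ker_def W)
next
  fix u assume u: "u \<in> koszul_ker N A (insert q B) (X - {q})"
  let ?X = "X - {q}" and ?m = "of_nat (card B + 1 + card (X - {q})) :: complex"
  note P' = partD[OF P]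
  have uM: "u \<in> perm_fns N" "eqv False A u" "eqv False (insert q B) u" "eqv True ?X u"
    using u by (auto simp: koszul_ker_def young_mod_def)
  define V where "V = coset_sum True q ?X u"
  have "V \<in> young_mod N A B X"
    unfolding young_mod_def mem_Collect_eq V_def
  proof (intro conjI)
    show "coset_sum True q ?X u \<in> perm_fns N" using uM P' q by (intro coset_sum_fns) auto
    show "eqv False A (coset_sum True q ?X u)" using uM P' q by (intro coset_sum_eqv_other) auto
    show "eqv False B (coset_sum True q ?X u)"
      using eqv_subset[OF uM(3), of B] P' q by (intro coset_sum_eqv_other) auto
    have "insert q ?X = X" using q by auto
    then show "eqv True X (coset_sum True q ?X u)"
      using coset_sum_eqv[of ?X q True u] uM P' by auto
  qed
  moreover have "coset_sum False q B V = fun_scale ?m u"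
  proof
    fix t
    \<comment> \<open>The kernel condition at \<open>x\<close> with its trivial coset split off; it
      evaluates the sum of transpositions in the Casimir formula.\<close>
    have "u t + (\<Sum>c\<in>insert q B. u (t \<circ> transpose c x)) = 0" if "x \<in> ?X" for x
    proof -
      have "x \<notin> insert q B" using that P' q by auto
      then have "coset_sum False x (insert q B) u t = u t + (\<Sum>c\<in>insert q B. u (t \<circ> transpose c x))"
        using P' by (subst coset_sum_split) auto
      then show ?thesis using u that by (simp add: koszul_ker_def)
    qed
    then have "(\<Sum>x\<in>?X. \<Sum>c\<in>insert q B. u (t \<circ> transpose c x)) = (\<Sum>x\<in>?X. - u t)"
      by (intro sum.cong refl) (simp add: eq_neg_iff_add_eq_0 add.commute)
    moreover have "coset_sum False q B V t = of_nat (card B + 1) * u t -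
        (\<Sum>x\<in>?X. \<Sum>c\<in>insert q B. u (t \<circ> transpose c x))"
      unfolding V_def using P' q uM by (intro coset_sum_coset_sum_casimir) auto
    ultimately show "coset_sum False q B V t = fun_scale ?m u t"
      by (simp add: fun_scale_def algebra_simps)
  qed
  moreover have "?m \<noteq> 0" by (simp flip: of_nat_add of_nat_Suc)
  ultimately have "u = coset_sum False q B (fun_scale (inverse ?m) V)" "fun_scale (inverse ?m) V \<in> young_mod N A B X"
    using fun_vs.subspace_scale[OF young_mod_subspace, of V N A B X]
    by (simp_all only: lin_scale[OF lin_coset_sum] fun_vs.scale_scale left_inverse fun_vs.scale_one not_False_eq_True)
  then show "u \<in> coset_sum False q B ` young_mod N A B X" by blast
qed

text \<open>Conjugation by \<open>transpose q x\<close> carries the operator at \<open>q\<close> to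
  the one at \<open>x\<close>, and it changes elements of the Young module at most by a
  sign.\<close>

lemma koszul_ker_eq_kernel:
  assumes P: "blocks N A B X" and q: "q \<in> X"
  shows "koszul_ker N A B X = {V \<in> young_mod N A B X. coset_sum False q B V = 0}"
proof -
  have "coset_sum False x B V = 0" if V: "V \<in> young_mod N A B X" "coset_sum False q B V = 0" and x: "x \<in> X" for V x
  proof
    fix t
    have "transpose q x ` B = B" using partD[OF P] x q by (auto simp: transpose_def image_iff)
    then have "coset_sum False q B V (t \<circ> transpose q x) = coset_sum False x B (\<lambda>t. V (t \<circ> transpose q x)) t"
      using coset_sum_conj[OF bij_transpose, of False q B V t q x] by simp
    also have "(\<lambda>t. V (t \<circ> transpose q x)) = (\<lambda>t. (if q = x then 1 else -1) * V t)"
      using eqv_transpose[of True X V q x] V x q by (auto simp: young_mod_def)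
    finally show "coset_sum False x B V t = 0 t"
      using V by (auto simp: coset_sum_scale split: if_splits)
  qed
  then show ?thesis using q by (auto simp: koszul_ker_def)
qed

lemma trace_young_mod:
  assumes P: "blocks N A B X" and q: "q \<in> X" and g: "g permutes N"
  shows "trace_on (young_mod N A B X) (left_mult g) =
    trace_on (koszul_ker N A B X) (left_mult g) + trace_on (koszul_ker N A (insert q B) (X - {q})) (left_mult g)"
  unfolding koszul_ker_eq_kernel[OF P q]
  by (rule trace_exact[OF _ _ koszul_image[OF P q]])
     (use P g in \<open>auto simp: blocks_def fin_dim_young_mod left_mult_young_mod lin_left_mult left_mult_coset_sum intro: lin_coset_sum\<close>)

text \<open>The composite \<open>E\<^sub>1\<^sub>3 E\<^sub>3\<^sub>2\<close>: it moves \<open>r\<close> from the second row through the alternating cells into the first row.\<close>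

abbreviation shift_map where "shift_map r A X V \<equiv> coset_sum False r A (coset_sum True r X V)"

text \<open>The relation \<open>E_13 E_32 + E_32 E_13 = E_12\<close> of \<open>gl(2|1)\<close> on
  functions: pulling \<open>transpose x r\<close> to the front turns \<open>transpose p r\<close>
  into \<open>transpose p x\<close>.\<close>

lemma shift_map_expand:
  assumes A: "finite A" "r \<notin> A" and X: "finite X" "r \<notin> X" "A \<inter> X = {}"
  shows "shift_map r A X v t = coset_sum False r A v t - (\<Sum>x\<in>X. coset_sum False x A v (t \<circ> transpose x r))"
proof -
  have "shift_map r A X v t =
      (\<Sum>p\<in>insert r A. v (t \<circ> transpose p r) - (\<Sum>x\<in>X. v (t \<circ> transpose p r \<circ> transpose x r)))"
    unfolding coset_sum_False by (intro sum.cong refl coset_sum_True X)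
  also have "\<dots> = coset_sum False r A v t - (\<Sum>x\<in>X. \<Sum>p\<in>insert r A. v (t \<circ> transpose p r \<circ> transpose x r))"
    by (simp only: sum_subtractf coset_sum_False) (simp add: sum.swap[of _ X])
  also have "(\<Sum>x\<in>X. \<Sum>p\<in>insert r A. v (t \<circ> transpose p r \<circ> transpose x r)) =
      (\<Sum>x\<in>X. coset_sum False x A v (t \<circ> transpose x r))"
  proof (intro sum.cong refl)
    fix x assume x: "x \<in> X"
    have "t \<circ> transpose p r \<circ> transpose x r = t \<circ> transpose x r \<circ> transpose p x" if "p \<in> A" for p
    proof -
      have "transpose x r \<circ> transpose p x = transpose p r \<circ> transpose x r"
      proof -
        have "p \<noteq> x" "p \<noteq> r" using that x A X by auto
        then show ?thesis using bij_comp_transpose[OF bij_transpose, of x r p x] by simp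
      qed
      then show ?thesis by (simp only: o_assoc[symmetric])
    qed
    moreover have "x \<notin> A" using x X by auto
    ultimately show "(\<Sum>p\<in>insert r A. v (t \<circ> transpose p r \<circ> transpose x r)) =
        coset_sum False x A v (t \<circ> transpose x r)"
      using A by (simp add: coset_sum_split)
  qed
  finally show ?thesis .
qed

text \<open>By \<open>shift_map_expand\<close> the hypothesis expresses raising from
  \<open>B\<close> through raising from \<open>X\<close>. Substituted into a sum over
  \<open>B\<close>, this gives for each \<open>y\<close> in \<open>X\<close> a linear equation for
  the raising operator at \<open>y\<close>, with the nonzero coefficient
  \<open>1 + card B + card (X - {y})\<close>.\<close>

lemma shift_map_inj:
  assumes P: "blocks N A B X" and v: "v \<in> koszul_ker N A B X" and r: "r \<in> B" and 0: "shift_map r A X v = 0"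
  shows "v \<in> hw_space N A B X"
proof -
  note P' = partD[OF P]
  have vA: "eqv False A v" and vB: "eqv False B v" and vX: "eqv True X v" and vM: "v \<in> young_mod N A B X"
    using v by (auto simp: koszul_ker_def young_mod_def)
  have E23: "(\<Sum>c\<in>B. v (t \<circ> transpose c x)) = - v t" if "x \<in> X" for x t
  proof -
    have "coset_sum False x B v t = v t + (\<Sum>c\<in>B. v (t \<circ> transpose c x))"
      using that P' by (subst coset_sum_split) auto
    moreover have "coset_sum False x B v t = 0" using that v by (simp add: koszul_ker_def)
    ultimately show ?thesis by (simp add: eq_neg_iff_add_eq_0 add.commute)
  qed
  have tA: "transpose a b ` A = A" if "a \<notin> A" "b \<notin> A" for a b
    using that by (auto simp: transpose_def image_iff)
  have conj: "coset_sum s a A V (t \<circ> transpose b c) = coset_sum s (transpose b c a) A (\<lambda>t. V (t \<circ> transpose b c)) t"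
    if "b \<notin> A" "c \<notin> A" for s a b c t V
    using coset_sum_conj[OF bij_transpose, of s a A V t b c] tA[OF that] by simp
  \<comment> \<open>As \<open>v\<close> is symmetric in \<open>B\<close>, conjugation by
    \<open>transpose r c\<close> carries the hypothesis from \<open>r\<close> to every
    \<open>c\<close>.\<close>
  have phi0: "shift_map c A X v = 0" if c: "c \<in> B" for c
  proof
    fix t
    have nA: "r \<notin> A" "c \<notin> A" using c r P' by auto
    have tX: "transpose r c ` X = X" using c r P' by (auto simp: transpose_def image_iff)
    have "shift_map r A X v (t \<circ> transpose r c) = coset_sum False c A (\<lambda>t. coset_sum True r X v (t \<circ> transpose r c)) t"
      using conj[OF nA, of False r] by simp
    also have "(\<lambda>t. coset_sum True r X v (t \<circ> transpose r c)) = coset_sum True c X (\<lambda>t. v (t \<circ> transpose r c))"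
      using coset_sum_conj[OF bij_transpose, of True r X v _ r c] tX by auto
    also have "(\<lambda>t. v (t \<circ> transpose r c)) = v"
      using eqv_transpose[OF vB r c] by auto
    finally show "shift_map c A X v t = 0 t" by (simp add: 0)
  qed
  have a: "coset_sum False c A v t = (\<Sum>x\<in>X. coset_sum False x A v (t \<circ> transpose x c))" if "c \<in> B" for c t
  proof -
    have "shift_map c A X v t = coset_sum False c A v t - (\<Sum>x\<in>X. coset_sum False x A v (t \<circ> transpose x c))"
      using P' that by (intro shift_map_expand) auto
    then show ?thesis by (simp add: phi0[OF that])
  qed
  have D0: "coset_sum False y A v t = 0" if y: "y \<in> X" for y t
  proof -
    let ?D = "\<lambda>x. coset_sum False x A v"
    have yA: "y \<notin> A" using y P' by auto
    have sum_coset_sum: "(\<Sum>c\<in>B. coset_sum False y A (\<lambda>t. v (t \<circ> transpose c x)) t) = - ?D y t" if "x \<in> X" for x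
    proof -
      have "(\<Sum>c\<in>B. coset_sum False y A (\<lambda>t. v (t \<circ> transpose c x)) t) =
          (\<Sum>p\<in>insert y A. \<Sum>c\<in>B. v (t \<circ> transpose p y \<circ> transpose c x))"
        unfolding coset_sum_False by (rule sum.swap)
      then show ?thesis by (simp only: E23[OF that] coset_sum_False sum_negf)
    qed
    \<comment> \<open>This sum over \<open>B\<close> is evaluated twice: here through the kernel
      condition at \<open>y\<close>, and further below through the relation
      \<open>a\<close>.\<close>
    have "(\<Sum>c\<in>B. ?D c (t \<circ> transpose c y)) = (\<Sum>c\<in>B. coset_sum False y A (\<lambda>t. v (t \<circ> transpose c y)) t)"
      using P' by (intro sum.cong refl) (subst conj[OF _ yA], auto)
    then have lhs: "(\<Sum>c\<in>B. ?D c (t \<circ> transpose c y)) = - ?D y t"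
      using sum_coset_sum[OF y] by simp
    \<comment> \<open>For \<open>x = y\<close> the two transpositions cancel and every
      \<open>c\<close> contributes. For other \<open>x\<close>, alternation on \<open>X\<close> and
      the kernel condition give one sign each, leaving \<open>?D y t\<close> once.\<close>
    have summand: "(\<Sum>c\<in>B. ?D x (t \<circ> transpose c y \<circ> transpose x c)) =
        (if x = y then of_nat (card B) else 1) * ?D y t" if x: "x \<in> X" for x
    proof (cases "x = y")
      case True
      then show ?thesis by (simp add: o_assoc[symmetric] transpose_commute[of y])
    next
      case False
      have xA: "x \<notin> A" using x P' by auto
      have "(\<Sum>c\<in>B. ?D x (t \<circ> transpose c y \<circ> transpose x c)) =
          (\<Sum>c\<in>B. - ?D y (t \<circ> transpose c x))"
      proof (intro sum.cong refl)
        fix c assume c: "c \<in> B"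
        have "c \<noteq> x" "c \<noteq> y" using c x y P' by auto
        then have "transpose c x \<circ> transpose x y = transpose c y \<circ> transpose x c"
          using bij_comp_transpose[OF bij_transpose, of c x x y] False
          by (simp add: transpose_commute[of x c])
        then have "?D x (t \<circ> transpose c y \<circ> transpose x c) = ?D x (t \<circ> transpose c x \<circ> transpose x y)"
          by (simp only: o_assoc[symmetric])
        also have "\<dots> = coset_sum False y A (\<lambda>t. v (t \<circ> transpose x y)) (t \<circ> transpose c x)"
          using conj[OF xA yA, of False x] by simp
        also have "(\<lambda>t. v (t \<circ> transpose x y)) = (\<lambda>t. (-1) * v t)"
          using eqv_transpose[OF vX x y] False by auto
        finally show "?D x (t \<circ> transpose c y \<circ> transpose x c) = - ?D y (t \<circ> transpose c x)"
          by (simp only: coset_sum_scale) simp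
      qed
      also have "\<dots> = - (\<Sum>c\<in>B. coset_sum False y A (\<lambda>t. v (t \<circ> transpose c x)) t)"
        unfolding sum_negf
      proof (intro arg_cong[of _ _ uminus] sum.cong refl)
        fix c assume "c \<in> B"
        then have "c \<notin> A" "c \<noteq> y" using P' y by auto
        then show "?D y (t \<circ> transpose c x) = coset_sum False y A (\<lambda>t. v (t \<circ> transpose c x)) t"
          using conj[OF _ xA, of c False y] False by simp
      qed
      also have "\<dots> = ?D y t" using sum_coset_sum[OF x] by simp
      finally show ?thesis using False by simp
    qed
    have "- ?D y t = (\<Sum>c\<in>B. \<Sum>x\<in>X. ?D x (t \<circ> transpose c y \<circ> transpose x c))"
      unfolding lhs[symmetric] using a by (intro sum.cong refl) simp
    also have "\<dots> = (\<Sum>x\<in>X. (if x = y then of_nat (card B) else 1) * ?D y t)"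
      using summand by (subst sum.swap) (simp cong: sum.cong)
    also have "\<dots> = of_nat (card B) * ?D y t + of_nat (card (X - {y})) * ?D y t"
      using P' y by (subst sum.remove[of X y]) (auto intro!: sum.cong simp flip: sum_distrib_right)
    finally have "of_nat (1 + card B + card (X - {y})) * ?D y t = 0"
      by (simp add: algebra_simps eq_neg_iff_add_eq_0 neg_eq_iff_add_eq_0)
    then show ?thesis by (simp only: mult_eq_0_iff of_nat_eq_0_iff) simp
  qed
  have "coset_sum False c A v t = 0" if "c \<in> B" for c t
    using a[OF that] D0 by simp
  then show ?thesis using v D0 by (auto simp: hw_space_def koszul_ker_def fun_eq_iff)
qed

lemma hw_space_shift_map:
  assumes P: "blocks N A B X" and v: "v \<in> hw_space N A B X" and r: "r \<in> B"
  shows "shift_map r A X v = 0"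
proof
  fix t
  have "shift_map r A X v t = coset_sum False r A v t - (\<Sum>x\<in>X. coset_sum False x A v (t \<circ> transpose x r))"
    using partD[OF P] r by (intro shift_map_expand) auto
  then show "shift_map r A X v t = 0 t" using v r by (simp add: hw_space_def)
qed

section \<open>Surjectivity by adjointness\<close>

lemma perm_inner_add_left: "perm_inner N (V + V') W = perm_inner N V W + perm_inner N V' W"
  by (simp add: perm_inner_def sum.distrib distrib_right)

lemma perm_inner_diff_left: "perm_inner N (V - V') W = perm_inner N V W - perm_inner N V' W"
  by (simp add: perm_inner_def sum_subtractf left_diff_distrib)

lemma perm_inner_scale_left: "perm_inner N (fun_scale c V) W = c * perm_inner N V W"
  by (simp add: perm_inner_def fun_scale_def sum_distrib_left mult.assoc)

lemma perm_inner_0_left: "perm_inner N 0 W = 0"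
  by (simp add: perm_inner_def)

lemma perm_inner_span_zero:
  assumes "v \<in> fun_vs.span B" "\<And>b. b \<in> B \<Longrightarrow> perm_inner N b w = 0"
  shows "perm_inner N v w = 0"
proof -
  have "fun_vs.subspace {v. perm_inner N v w = 0}"
    by (auto simp: fun_vs.subspace_def perm_inner_add_left perm_inner_scale_left perm_inner_0_left)
  then show ?thesis using fun_vs.span_minimal[of B "{v. perm_inner N v w = 0}"] assms by auto
qed

text \<open>A Gram-Schmidt step for each added vector: \<open>b\<close> is first made orthogonal to
  the span of \<open>B\<close> by subtracting its own projection \<open>u\<close>.\<close>

lemma orthogonal_projection:
  assumes N: "finite N" and "finite B" "B \<subseteq> perm_fns N"
  shows "\<exists>s\<in>fun_vs.span B. \<forall>b\<in>B. perm_inner N (w - s) b = 0"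
  using assms(2,3)
proof (induction B arbitrary: w)
  case empty
  then show ?case by simp
next
  case (insert b B)
  obtain s where s: "s \<in> fun_vs.span B" "\<forall>c\<in>B. perm_inner N (w - s) c = 0" using insert by blast
  obtain u where u: "u \<in> fun_vs.span B" "\<forall>c\<in>B. perm_inner N (b - u) c = 0" using insert by blast
  have u_fns: "u \<in> perm_fns N"
    using u(1) insert.prems fun_vs.span_minimal[OF _ perm_fns_subspace, of B N] by auto
  have b_fns: "b - u \<in> perm_fns N"
    using u_fns insert.prems by (auto intro: fun_vs.subspace_diff[OF perm_fns_subspace])
  have mono: "fun_vs.span B \<subseteq> fun_vs.span (insert b B)" by (rule fun_vs.span_mono) auto
  \<comment> \<open>If the denominator is zero, then \<open>b - u = 0\<close> by definiteness and
    the default value 0 of the quotient is harmless.\<close>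
  define c where "c = perm_inner N (w - s) (b - u) / perm_inner N (b - u) (b - u)"
  define s' where "s' = s + fun_scale c (b - u)"
  have s': "s' \<in> fun_vs.span (insert b B)"
    unfolding s'_def using s(1) u(1) mono fun_vs.span_base[of b "insert b B"]
    by (intro fun_vs.span_add fun_vs.span_scale fun_vs.span_diff) auto
  have ws': "w - s' = w - s - fun_scale c (b - u)" by (simp add: s'_def algebra_simps)
  have orthB: "perm_inner N (w - s') d = 0" if "d \<in> B" for d
    using that s(2) u(2) unfolding ws' by (simp add: perm_inner_diff_left perm_inner_scale_left del: minus_apply)
  have orth1: "perm_inner N (w - s') (b - u) = 0"
  proof (cases "perm_inner N (b - u) (b - u) = 0")
    case True
    then have "b - u = 0" using perm_inner_definite[OF N b_fns] by simp
    then show ?thesis by (simp add: perm_inner_def)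
  next
    case False
    then show ?thesis unfolding ws' by (simp add: perm_inner_diff_left perm_inner_scale_left c_def del: minus_apply)
  qed
  have "perm_inner N u (w - s') = 0"
    using u(1)
  proof (rule perm_inner_span_zero)
    fix d assume "d \<in> B"
    then show "perm_inner N d (w - s') = 0" by (subst perm_inner_cnj) (simp only: orthB complex_cnj_zero)
  qed
  then have "perm_inner N b (w - s') = 0"
    using arg_cong[OF orth1, of cnj] unfolding perm_inner_cnj[of N "b - u" "w - s'", symmetric]
    by (simp only: perm_inner_diff_left complex_cnj_zero diff_0_right)
  then have "perm_inner N (w - s') b = 0" by (subst perm_inner_cnj) simp
  then show ?case using s' orthB by blast
qed

text \<open>The component of \<open>u\<close> orthogonal to \<open>W\<close> stays in
  \<open>U\<close>, so \<open>orth\<close> makes it vanish.\<close>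

lemma subspace_eq_if_orthogonal_zero:
  assumes N: "finite N" and W: "fun_vs.subspace W" "W \<subseteq> U" and U: "fun_vs.subspace U" "U \<subseteq> perm_fns N"
    and orth: "\<And>u. u \<in> U \<Longrightarrow> (\<And>w. w \<in> W \<Longrightarrow> perm_inner N w u = 0) \<Longrightarrow> u = 0"
  shows "W = U"
proof
  show "U \<subseteq> W"
  proof
    fix u assume u: "u \<in> U"
    have "fin_dim W" using fin_dim_subset[OF fin_dim_perm_fns[OF N] _ W(1)] W U by blast
    then obtain B where B: "basis_of B W" using fin_dim_basis by blast
    then have "B \<subseteq> W" using fun_vs.span_superset by blast
    then obtain s where s: "s \<in> W" "\<forall>b\<in>B. perm_inner N (u - s) b = 0"
      using orthogonal_projection[OF N, of B u] B W U by blast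
    have "u - s = 0"
    proof (rule orth)
      show "u - s \<in> U" using u s W U by (intro fun_vs.subspace_diff) auto
      fix w assume "w \<in> W"
      then show "perm_inner N w (u - s) = 0"
        using B s by (intro perm_inner_span_zero[of w B], blast) (subst perm_inner_cnj, simp del: minus_apply)
    qed
    then show "u \<in> W" using s by simp
  qed
qed fact

lemma adjoint_surj:
  assumes N: "finite N" and T: "lin T" and V: "fun_vs.subspace V" "T ` V \<subseteq> U"
    and U: "fun_vs.subspace U" "U \<subseteq> perm_fns N"
    and orth: "\<And>u. u \<in> U \<Longrightarrow> (\<And>v. v \<in> V \<Longrightarrow> perm_inner N (T v) u = 0) \<Longrightarrow> u = 0"
  shows "T ` V = U"
proof (rule subspace_eq_if_orthogonal_zero[OF N _ V(2) U])
  show "fun_vs.subspace (T ` V)"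
    using module_hom.subspace_image[of fun_scale fun_scale T V] T V by (simp add: module_hom_iff_linear)
qed (use orth in blast)

text \<open>This is where the dominance condition on the shape enters: the lowering map is injective on
  weights with \<open>card A > card B\<close>.\<close>

lemma lowering_inj:
  assumes P: "blocks N A B X" and u: "u \<in> young_mod N A B X" and 0: "\<And>r. r \<in> A \<Longrightarrow> coset_sum False r B u = 0"
    and less: "card B < card A"
  shows "u = 0"
proof -
  note P' = partD[OF P]
  have uM: "u \<in> perm_fns N" "eqv False A u" using u by (auto simp: young_mod_def)
  have low: "(\<Sum>c\<in>B. u (t \<circ> transpose r c)) = - u t" if "r \<in> A" for r t
  proof -
    have "coset_sum False r B u t = u t + (\<Sum>c\<in>B. u (t \<circ> transpose c r))"
      using that P' by (subst coset_sum_split) auto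
    then show ?thesis using 0[OF that]
      by (simp add: eq_neg_iff_add_eq_0 add.commute transpose_commute[of r])
  qed
  have nn: "Re (perm_inner N V V) \<ge> 0" for V by (simp add: perm_inner_self sum_nonneg)
  \<comment> \<open>The \<open>sl(2)\<close> commutator on a vector killed by lowering: the double
    sum over \<open>A\<close> and \<open>B\<close> is known from \<open>low\<close>, and the weight
    \<open>card B - card A\<close> remains.\<close>
  have "(\<Sum>c\<in>B. coset_sum False c A u t) = (of_nat (card B) - of_nat (card A)) * u t" for t
  proof -
    have "(\<Sum>c\<in>B. coset_sum False c A u t) = (\<Sum>c\<in>B. u t + (\<Sum>r\<in>A. u (t \<circ> transpose r c)))"
      using P' by (intro sum.cong refl) (subst coset_sum_split, auto)
    also have "\<dots> = of_nat (card B) * u t + (\<Sum>r\<in>A. \<Sum>c\<in>B. u (t \<circ> transpose r c))"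
      by (simp add: sum.distrib sum.swap[of _ B])
    also have "\<dots> = (of_nat (card B) - of_nat (card A)) * u t"
      by (simp add: low algebra_simps)
    finally show ?thesis .
  qed
  then have sum_coset_sum: "(\<lambda>t. \<Sum>c\<in>B. 1 * coset_sum False c A u t) = (\<lambda>t. (of_nat (card B) - of_nat (card A)) * u t)"
    by simp
  have "(\<Sum>c\<in>B. perm_inner N (coset_sum False c A u) (coset_sum False c A u)) =
      of_nat (card A + 1) * (\<Sum>c\<in>B. cnj (perm_inner N (coset_sum False c A u) u))"
    unfolding sum_distrib_left
  proof (intro sum.cong refl)
    fix c assume c: "c \<in> B"
    have cA: "c \<notin> A" "insert c A \<subseteq> N" using P' c by auto
    show "perm_inner N (coset_sum False c A u) (coset_sum False c A u) = of_nat (card A + 1) * cnj (perm_inner N (coset_sum False c A u) u)"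
      using perm_inner_coset_sum[OF cA(2) coset_sum_eqv[OF P'(2) cA(1) uM(2)] P'(2) cA(1), of u] perm_inner_cnj[of N u]
      by simp
  qed
  also have "(\<Sum>c\<in>B. cnj (perm_inner N (coset_sum False c A u) u)) = cnj (perm_inner N (\<lambda>t. \<Sum>c\<in>B. 1 * coset_sum False c A u t) u)"
    by (subst perm_inner_sum_left) simp
  also have "\<dots> = (of_nat (card B) - of_nat (card A)) * cnj (perm_inner N u u)"
    unfolding sum_coset_sum using perm_inner_scale_left[of N "of_nat (card B) - of_nat (card A)" u u]
    by (simp add: fun_scale_def)
  finally have "Re (\<Sum>c\<in>B. perm_inner N (coset_sum False c A u) (coset_sum False c A u)) =
      real (card A + 1) * ((real (card B) - real (card A)) * Re (perm_inner N u u))"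
    by simp
  \<comment> \<open>The left side was a sum of squared norms, whereas the weight
    \<open>card B - card A\<close> is negative.\<close>
  then have "0 \<le> (real (card B) - real (card A)) * Re (perm_inner N u u)"
    using sum_nonneg[of B "\<lambda>c. Re (perm_inner N (coset_sum False c A u) (coset_sum False c A u))"] nn
    by (simp add: zero_le_mult_iff)
  then have "Re (perm_inner N u u) \<le> 0" using less by (simp add: zero_le_mult_iff)
  then have "Re (perm_inner N u u) = 0" using nn[of u] by simp
  then have "perm_inner N u u = 0" by (simp add: perm_inner_self)
  then show ?thesis by (rule perm_inner_definite[OF P'(1) uM(1)])
qed

lemma blocks_swap: "blocks N A B X \<Longrightarrow> r \<in> B \<Longrightarrow> blocks N (B - {r}) (insert r A) X"
  unfolding blocks_def by auto

text \<open>The inner factor makes the function alternating on \<open>insert r X\<close>. The outer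
  factor followed by the operator at \<open>x\<close> is then an odd root vector applied
  twice.\<close>

lemma shift_map_koszul_ker:
  assumes P: "blocks N A B X" and r: "r \<in> B" and v: "v \<in> young_mod N A B X"
  shows "shift_map r A X v \<in> koszul_ker N (B - {r}) (insert r A) X"
proof -
  note P' = partD[OF P]
  define w where "w = coset_sum True r X v"
  have vM: "v \<in> perm_fns N" "eqv False A v" "eqv False (B - {r}) v" "eqv True X v"
    using v eqv_subset[of False B v "B - {r}"] by (auto simp: young_mod_def)
  have w: "w \<in> perm_fns N" "eqv False A w" "eqv False (B - {r}) w"
    unfolding w_def using vM P' r by (intro coset_sum_fns coset_sum_eqv_other; auto)+
  have wX: "eqv True (insert r X) w" unfolding w_def using vM P' r by (intro coset_sum_eqv) auto
  have "shift_map r A X v \<in> young_mod N (B - {r}) (insert r A) X"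
    unfolding young_mod_def mem_Collect_eq w_def[symmetric]
    using w eqv_subset[OF wX, of X] P' r
    by (intro conjI coset_sum_fns coset_sum_eqv coset_sum_eqv_other) auto
  moreover have "coset_sum False x (insert r A) (coset_sum False r A w) = 0" if x: "x \<in> X" for x
  proof (rule coset_sum_coset_sum_zero)
    show "w (t \<circ> transpose r x) = - w t" for t
      using eqv_transpose[OF wX, of r x t] x r P' by auto
  qed (use w P' r x in auto)
  ultimately show ?thesis by (auto simp: koszul_ker_def w_def)
qed

text \<open>Both sides reduce to the pairing of \<open>v\<close> with
  \<open>coset_sum True r X u\<close>. The scalars are the sizes of the blocks
  \<open>insert r A\<close> and \<open>B\<close>, on which \<open>u\<close> and \<open>v\<close> are
  invariant.\<close>

lemma shift_map_adjoint:
  assumes P: "blocks N A B X" and r: "r \<in> B" and v: "eqv False B v" and u: "eqv False (insert r A) u"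
  shows "of_nat (card B) * perm_inner N (shift_map r A X v) u = of_nat (card A + 1) * perm_inner N v (shift_map r (B - {r}) X u)"
proof -
  note P' = partD[OF P]
  have B: "insert r (B - {r}) = B" "card (B - {r}) + 1 = card B"
    using r P' by (auto simp: card_Diff_singleton)
       (metis One_nat_def Suc_pred card_gt_0_iff empty_iff)
  have "perm_inner N (shift_map r A X v) u = of_nat (card A + 1) * perm_inner N (coset_sum True r X v) u"
    using P' r u by (intro perm_inner_coset_sum) auto
  also have "perm_inner N (coset_sum True r X v) u = perm_inner N v (coset_sum True r X u)"
    using P' r by (intro perm_inner_coset_sum_adjoint) auto
  finally have 1: "perm_inner N (shift_map r A X v) u = of_nat (card A + 1) * perm_inner N v (coset_sum True r X u)" .
  have "perm_inner N (shift_map r (B - {r}) X u) v = of_nat (card B) * perm_inner N (coset_sum True r X u) v"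
    using perm_inner_coset_sum[of r "B - {r}" N False v "coset_sum True r X u"] P' r v B by (auto simp: insert_absorb)
  then have "perm_inner N v (shift_map r (B - {r}) X u) = of_nat (card B) * perm_inner N v (coset_sum True r X u)"
    using perm_inner_cnj[of N v] by simp
  with 1 show ?thesis by simp
qed

lemma lin_shift_map: "lin (shift_map r A X)"
  by (rule linI) (simp_all add: lin_add[OF lin_coset_sum] lin_scale[OF lin_coset_sum])

text \<open>If \<open>u\<close> is orthogonal to the image, its backward shift \<open>v\<close> has
  norm zero. By \<open>shift_map_inj\<close> with the rows exchanged, \<open>u\<close> is a highest
  weight vector whose first row, of size \<open>card B - 1\<close>, is shorter than its second, of
  size \<open>card A + 1\<close>; raising there is lowering for the reversed rows, and
  \<open>lowering_inj\<close> gives \<open>u = 0\<close>.\<close>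

lemma shift_map_image:
  assumes P: "blocks N A B X" and r: "r \<in> B" and le: "card B \<le> card A"
  shows "shift_map r A X ` koszul_ker N A B X = koszul_ker N (B - {r}) (insert r A) X"
proof (rule adjoint_surj)
  note P' = partD[OF P]
  show "shift_map r A X ` koszul_ker N A B X \<subseteq> koszul_ker N (B - {r}) (insert r A) X"
    using shift_map_koszul_ker[OF P r] koszul_ker_young_mod by blast
  show "finite N" by (rule P')
  show "koszul_ker N (B - {r}) (insert r A) X \<subseteq> perm_fns N" by (rule order_trans[OF koszul_ker_young_mod young_mod_fns])
  fix u assume u: "u \<in> koszul_ker N (B - {r}) (insert r A) X"
    and orth: "\<And>v. v \<in> koszul_ker N A B X \<Longrightarrow> perm_inner N (shift_map r A X v) u = 0"
  have Q: "blocks N (B - {r}) (insert r A) X" by (rule blocks_swap[OF P r])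
  define v where "v = shift_map r (B - {r}) X u"
  have "v \<in> koszul_ker N (insert r A - {r}) (insert r (B - {r})) X"
    unfolding v_def using u by (intro shift_map_koszul_ker[OF Q]) (auto simp: koszul_ker_def)
  moreover have "insert r A - {r} = A" "insert r (B - {r}) = B" using P' r by auto
  ultimately have v: "v \<in> koszul_ker N A B X" by simp
  have "of_nat (card A + 1) * perm_inner N v v = 0"
    using shift_map_adjoint[OF P r, of v u] orth[OF v] v u by (simp add: v_def koszul_ker_def young_mod_def)
  then have "perm_inner N v v = 0" by (simp only: mult_eq_0_iff of_nat_eq_0_iff) simp
  then have "v = 0" using perm_inner_definite[OF P'(1)] v by (auto simp: koszul_ker_def young_mod_def)
  then have hw: "u \<in> hw_space N (B - {r}) (insert r A) X"
    using shift_map_inj[OF Q u, of r] by (simp add: v_def)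
  show "u = 0"
  proof (rule lowering_inj)
    show "blocks N (insert r A) (B - {r}) X" using Q by (auto simp: blocks_def)
    show "u \<in> young_mod N (insert r A) (B - {r}) X" using hw by (auto simp: hw_space_def young_mod_def)
    show "coset_sum False c (B - {r}) u = 0" if "c \<in> insert r A" for c
      using hw that by (auto simp: hw_space_def)
    have "card (B - {r}) < card B" using r P' by (intro psubset_card_mono) auto
    also have "\<dots> \<le> card (insert r A)" using le P' card_insert_le[of A r] by linarith
    finally show "card (B - {r}) < card (insert r A)" .
  qed
qed (rule lin_shift_map koszul_ker_subspace)+

lemma trace_koszul_ker:
  assumes P: "blocks N A B X" and r: "r \<in> B" and le: "card B \<le> card A" and g: "g permutes N"
  shows "trace_on (koszul_ker N A B X) (left_mult g) =
    trace_on (hw_space N A B X) (left_mult g) + trace_on (koszul_ker N (B - {r}) (insert r A) X) (left_mult g)"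
proof -
  have "hw_space N A B X = {v \<in> koszul_ker N A B X. shift_map r A X v = 0}"
    using shift_map_inj[OF P _ r] hw_space_shift_map[OF P _ r] hw_space_koszul_ker by blast
  then show ?thesis
    using trace_exact[OF fin_dim_koszul_ker lin_shift_map shift_map_image[OF P r le] lin_left_mult left_mult_koszul_ker[OF g] lin_left_mult] partD[OF P]
    by (simp add: left_mult_coset_sum)
qed

section \<open>Polytabloids span the highest weight space\<close>

text \<open>Equality of tabloids: each position of \<open>X\<close> is a row of its own, so its
  entry has to agree.\<close>

definition rows_eq :: "'a set \<Rightarrow> 'a set \<Rightarrow> 'a set \<Rightarrow> ('a \<Rightarrow> 'a) \<Rightarrow> ('a \<Rightarrow> 'a) \<Rightarrow> bool" where
  "rows_eq A B X t u \<longleftrightarrow> t ` A = u ` A \<and> t ` B = u ` B \<and> (\<forall>x\<in>X. t x = u x)"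

lemma comp_image: "(f \<circ> g) ` S = f ` g ` S"
  by (simp add: image_comp)

lemma rows_eq_left:
  assumes "inj w"
  shows "rows_eq A B X (w \<circ> p) (w \<circ> q) = rows_eq A B X p q"
  unfolding rows_eq_def comp_image inj_image_eq_iff[OF assms] comp_apply inj_eq[OF assms] ..

lemma permutes_image_disjoint: "p permutes S \<Longrightarrow> S \<inter> T = {} \<or> T \<inter> S = {} \<Longrightarrow> p ` T = T"
  by (force simp: permutes_def image_iff)

text \<open>All that is kept of the diagram is the column of each position: a long row meets a
  column at most once, the second row uses only columns of the first, and the one-cell rows all lie
  in column \<open>c0\<close>.\<close>

locale near_hook =
  fixes N A B X :: "'a set" and col :: "'a \<Rightarrow> nat" and c0 :: nat
  assumes P: "blocks N A B X"
    and colA: "inj_on col A" and colB: "inj_on col B" and col_BA: "col ` B \<subseteq> col ` A"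
    and colX: "\<And>x. x \<in> X \<Longrightarrow> col x = c0" and c0: "c0 \<in> col ` B"
begin

lemmas P' = partD[OF P]

definition cells :: "nat set \<Rightarrow> 'a set" where "cells J = {c \<in> N. col c \<in> J}"

definition colperms :: "nat set \<Rightarrow> ('a \<Rightarrow> 'a) set" where
  "colperms J = {s. s permutes cells J \<and> (\<forall>c. col (s c) = col c)}"

definition colsum :: "nat set \<Rightarrow> (('a \<Rightarrow> 'a) \<Rightarrow> complex) \<Rightarrow> ('a \<Rightarrow> 'a) \<Rightarrow> complex" where
  "colsum J V t = (\<Sum>s\<in>colperms J. of_int (sign s) * V (t \<circ> s))"

text \<open>The polytabloid of the tableau \<open>u\<close>, evaluated at the tabloid of
  \<open>t\<close>; see \<open>on_perms_polytabloid\<close>.\<close>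

definition antisym_fn :: "('a \<Rightarrow> 'a) \<Rightarrow> ('a \<Rightarrow> 'a) \<Rightarrow> complex" where
  "antisym_fn u t = (if t permutes N then
     (\<Sum>s\<in>colperms (col ` B). of_int (sign s) * of_bool (rows_eq A B X t (u \<circ> s))) else 0)"

lemma finite_cells: "finite (cells J)"
  using P' by (auto simp: cells_def)

lemma finite_colperms: "finite (colperms J)"
  using finite_permutations[OF finite_cells[of J]] by (simp add: colperms_def)

lemma colperms_perm: "s \<in> colperms J \<Longrightarrow> s permutes N"
  unfolding colperms_def by (rule permutes_subset[of s "cells J"]) (auto simp: cells_def)

lemma colperms_permutation: "s \<in> colperms J \<Longrightarrow> permutation s"
  using colperms_perm P'(1) permutation_permutes by blast

lemma colperms_comp: "s \<in> colperms J \<Longrightarrow> u \<in> colperms J \<Longrightarrow> s \<circ> u \<in> colperms J"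
  by (auto simp: colperms_def intro: permutes_compose)

lemma colperms_inv: "s \<in> colperms J \<Longrightarrow> inv s \<in> colperms J"
  unfolding colperms_def by (auto intro: permutes_inv) (metis permutes_inverses(1))

lemma colperms_transpose:
  "c \<in> cells J \<Longrightarrow> d \<in> cells J \<Longrightarrow> col c = col d \<Longrightarrow> transpose c d \<in> colperms J"
  unfolding colperms_def by (auto intro: permutes_swap_id) (auto simp: transpose_def)

lemma colperms_fix: "s \<in> colperms J \<Longrightarrow> c \<notin> cells J \<Longrightarrow> s c = c"
  by (auto simp: colperms_def permutes_def)

lemma sum_colperms_comp:
  assumes u: "u \<in> colperms J"
  shows "(\<Sum>s\<in>colperms J. f s) = (\<Sum>s\<in>colperms J. f (s \<circ> u))"
proof (rule sum.reindex_bij_witness[of _ "\<lambda>s. s \<circ> u" "\<lambda>s. s \<circ> inv u"])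
  have "u \<circ> inv u = id" "inv u \<circ> u = id"
    using permutes_inv_o[OF colperms_perm[OF u]] by auto
  then show e: "s \<circ> inv u \<circ> u = s" "s \<circ> u \<circ> inv u = s" for s
    by (auto simp: o_assoc[symmetric])
  show "f (s \<circ> inv u \<circ> u) = f s" for s by (rule arg_cong[OF e(1)])
qed (use u colperms_comp colperms_inv in auto)

lemma sum_colperms_comp_left:
  assumes u: "u \<in> colperms J"
  shows "(\<Sum>s\<in>colperms J. f s) = (\<Sum>s\<in>colperms J. f (u \<circ> s))"
proof (rule sum.reindex_bij_witness[of _ "\<lambda>s. u \<circ> s" "\<lambda>s. inv u \<circ> s"])
  have "u \<circ> inv u = id" "inv u \<circ> u = id"
    using permutes_inv_o[OF colperms_perm[OF u]] by auto
  then show e: "u \<circ> (inv u \<circ> s) = s" "inv u \<circ> (u \<circ> s) = s" for s by (auto simp: o_assoc)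
  show "f (u \<circ> (inv u \<circ> s)) = f s" for s by (rule arg_cong[OF e(1)])
qed (use u colperms_comp colperms_inv in auto)

section \<open>Removing columns from the antisymmetriser\<close>

lemma colsum_odd:
  assumes "c \<in> cells J" "d \<in> cells J" "col c = col d" "c \<noteq> d"
    and inv: "\<And>t. W (t \<circ> transpose c d) = W t"
  shows "colsum J W t = 0"
proof -
  note tr = colperms_transpose[OF assms(1-3)]
  have "colsum J W t = (\<Sum>s\<in>colperms J. of_int (sign (s \<circ> transpose c d)) * W (t \<circ> (s \<circ> transpose c d)))"
    unfolding colsum_def by (rule sum_colperms_comp[OF tr])
  also have "\<dots> = (\<Sum>s\<in>colperms J. - (of_int (sign s) * W (t \<circ> s)))"
    using assms(4) colperms_permutation[OF tr] colperms_permutation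
    by (intro sum.cong refl) (simp add: sign_compose sign_swap_id o_assoc inv)
  also have "\<dots> = - colsum J W t" by (simp add: colsum_def sum_negf)
  finally show ?thesis by simp
qed

lemma colsum_commute:
  assumes p: "p permutes N" and fixed: "\<And>c. c \<in> cells J \<Longrightarrow> p c = c"
  shows "colsum J V (t \<circ> p) = colsum J (\<lambda>t. V (t \<circ> p)) t"
  unfolding colsum_def
proof (intro sum.cong refl)
  fix s assume s: "s \<in> colperms J"
  have "p (s c) = s (p c)" for c
  proof (cases "c \<in> cells J")
    case True
    then have "s c \<in> cells J" using s permutes_in_image[of s "cells J" c] by (simp add: colperms_def)
    with True show ?thesis by (simp add: fixed)
  next
    case False
    have "p c \<notin> cells J"
      using False fixed[of "p c"] permutes_inj[OF p] by (metis injD)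
    then show ?thesis using False colperms_fix[OF s] by simp
  qed
  then have "p \<circ> s = s \<circ> p" by auto
  then show "of_int (sign s) * V (t \<circ> p \<circ> s) = of_int (sign s) * V (t \<circ> s \<circ> p)"
    by (metis o_assoc)
qed

lemma colsum_sum: "colsum J (\<lambda>t. \<Sum>c\<in>C. V c t) t = (\<Sum>c\<in>C. colsum J (V c) t)"
  unfolding colsum_def sum_distrib_left by (rule sum.swap)

lemma cells_other:
  assumes "c \<in> N" "col c \<noteq> c0" "col c \<in> col ` B"
  shows "c \<in> A \<or> c \<in> B"
  using assms P'(11) colX by auto

lemma A_if_col: "c \<in> N \<Longrightarrow> col c \<notin> col ` B \<Longrightarrow> c \<in> A"
  using P'(11) colX[of c] c0 by auto

text \<open>A column of \<open>B\<close> other than \<open>c0\<close> has exactly the cells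
  \<open>p\<close> and \<open>z\<close>, so the larger column group consists of
  \<open>colperms J\<close> and its coset by \<open>transpose p z\<close>.\<close>

lemma colsum_insert:
  assumes p: "p \<in> A" and z: "z \<in> B" and j: "col p = col z" "col z \<noteq> c0" "col z \<notin> J"
  shows "colsum (insert (col z) J) V t = colsum J V t - colsum J V (t \<circ> transpose p z)"
proof -
  let ?tr = "transpose p z"
  have pz: "p \<noteq> z" "p \<in> N" "z \<in> N" using p z P' by auto
  have cell: "c = p \<or> c = z" if "c \<in> N" "col c = col z" for c
    using cells_other[of c] that j z p inj_onD[OF colA, of c p] inj_onD[OF colB, of c z] by auto
  have cells: "cells (insert (col z) J) = insert p (insert z (cells J))"
    using cell pz j by (auto simp: cells_def)
  have nJ: "p \<notin> cells J" "z \<notin> cells J" using j by (auto simp: cells_def)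
  have tr: "?tr \<in> colperms (insert (col z) J)"
    using j(1) by (intro colperms_transpose) (auto simp: cells)
  have sub: "colperms J \<subseteq> colperms (insert (col z) J)"
    using permutes_subset[of _ "cells J" "cells (insert (col z) J)"] cells
    by (auto simp: colperms_def)
  have in_J: "s \<in> colperms J" if s: "s \<in> colperms (insert (col z) J)" and sp: "s p = p" for s
  proof -
    have "col (s z) = col z" "s z \<in> N"
      using s pz permutes_in_image[OF colperms_perm[OF s]] by (auto simp: colperms_def)
    then have "s z = p \<or> s z = z" using cell by blast
    moreover have "s z \<noteq> s p" using permutes_inj[OF colperms_perm[OF s]] pz by (auto dest: injD)
    ultimately have sz: "s z = z" using sp by auto
    have "s permutes cells (insert (col z) J)" using s by (simp add: colperms_def)
    then have "s permutes cells J"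
      by (rule permutes_superset) (use sp sz cells in auto)
    then show ?thesis using s by (simp add: colperms_def)
  qed
  have dec: "colperms (insert (col z) J) = colperms J \<union> (\<lambda>s. ?tr \<circ> s) ` colperms J"
  proof (intro equalityI subsetI)
    fix s assume s: "s \<in> colperms (insert (col z) J)"
    have "col (s p) = col z" "s p \<in> N"
      using s pz j permutes_in_image[OF colperms_perm[OF s]] by (auto simp: colperms_def)
    then consider "s p = p" | "s p = z" using cell by blast
    then show "s \<in> colperms J \<union> (\<lambda>s. ?tr \<circ> s) ` colperms J"
    proof cases
      case 2
      then have "?tr \<circ> s \<in> colperms J" by (intro in_J colperms_comp tr s) simp
      moreover have "s = ?tr \<circ> (?tr \<circ> s)" by (simp add: o_assoc)
      ultimately show ?thesis by blast
    qed (use in_J s in auto)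
  qed (use sub tr colperms_comp in auto)
  have inj: "inj_on (\<lambda>s. ?tr \<circ> s) (colperms J)"
    by (rule inj_onI) (metis o_assoc transpose_comp_involutory id_comp)
  have disj: "colperms J \<inter> (\<lambda>s. ?tr \<circ> s) ` colperms J = {}"
  proof -
    have False if "s \<in> colperms J" "?tr \<circ> s \<in> colperms J" for s
      using colperms_fix[OF that(1) nJ(1)] colperms_fix[OF that(2) nJ(1)] pz by simp
    then show ?thesis by auto
  qed
  have "colsum (insert (col z) J) V t = colsum J V t +
      (\<Sum>s\<in>colperms J. of_int (sign (?tr \<circ> s)) * V (t \<circ> (?tr \<circ> s)))"
    unfolding colsum_def dec using finite_colperms disj
    by (subst sum.union_disjoint) (auto simp: sum.reindex[OF inj])
  also have "(\<Sum>s\<in>colperms J. of_int (sign (?tr \<circ> s)) * V (t \<circ> (?tr \<circ> s))) =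
      - colsum J V (t \<circ> ?tr)"
    unfolding colsum_def sum_negf[symmetric] using pz colperms_permutation
    by (intro sum.cong refl) (simp add: sign_compose permutation_swap_id sign_swap_id o_assoc)
  finally show ?thesis by simp
qed

context
  fixes V :: "('a \<Rightarrow> 'a) \<Rightarrow> complex"
  assumes V: "V \<in> hw_space N A B X"
begin

lemma V_eqv: "eqv False A V" "eqv False B V" "eqv True X V" "V \<in> perm_fns N"
  using V by (auto simp: hw_space_def young_mod_def)

lemma V_raise_A: "y \<in> B \<union> X \<Longrightarrow> (\<Sum>p\<in>A. V (t \<circ> transpose p y)) = - V t"
proof -
  assume y: "y \<in> B \<union> X"
  then have "y \<notin> A" using P' by auto
  then have "coset_sum False y A V t = V t + (\<Sum>p\<in>A. V (t \<circ> transpose p y))"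
    using P' by (subst coset_sum_split) auto
  then show ?thesis using V y by (simp add: hw_space_def eq_neg_iff_add_eq_0 add.commute)
qed

lemma V_raise_B: "x \<in> X \<Longrightarrow> (\<Sum>z\<in>B. V (t \<circ> transpose z x)) = - V t"
proof -
  assume x: "x \<in> X"
  then have "x \<notin> B" using P' by auto
  then have "coset_sum False x B V t = V t + (\<Sum>p\<in>B. V (t \<circ> transpose p x))"
    using P' by (subst coset_sum_split) auto
  then show ?thesis using V x by (simp add: hw_space_def eq_neg_iff_add_eq_0 add.commute)
qed

text \<open>By \<open>colsum_insert\<close> the hypothesis makes \<open>?U\<close> invariant under
  exchanging the two cells \<open>p\<close> and \<open>z\<close> of column \<open>j\<close>. Since
  \<open>?U\<close> is symmetric in the set \<open>Q\<close> of first-row cells outside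
  \<open>J\<close>, it is invariant under every \<open>transpose q z\<close> with \<open>q\<close>
  in \<open>Q\<close>. Antisymmetrising the highest weight condition that raises \<open>z\<close>
  into \<open>A\<close> then reads \<open>card Q * ?U = - ?U\<close>.\<close>

lemma peel_column:
  assumes J: "J \<subseteq> col ` B" and j: "j \<in> col ` B" "j \<noteq> c0" "j \<notin> J"
    and 0: "\<And>t. colsum (insert j J) V t = 0"
  shows "colsum J V t = 0"
proof -
  let ?U = "colsum J V"
  obtain z where z: "z \<in> B" "col z = j" using j by auto
  obtain p where p: "p \<in> A" "col p = j" using j col_BA by auto
  have pz: "p \<in> N" "z \<in> N" "p \<noteq> z" using p z P' by auto
  define Q where "Q = {q \<in> A. col q \<notin> J}"
  have Q: "finite Q" "p \<in> Q" "Q \<subseteq> A" using P' p j by (auto simp: Q_def)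
  have Uz: "?U (t \<circ> transpose p z) = ?U t" for t
    using colsum_insert[OF p(1) z(1), of J V t] 0[of t] p z j by simp
  have Up: "?U (t \<circ> transpose q p) = ?U t" if "q \<in> Q" for q t
  proof -
    have "q \<in> A" "q \<in> N" using that Q P' by auto
    have "?U (t \<circ> transpose q p) = colsum J (\<lambda>t. V (t \<circ> transpose q p)) t"
      using that Q \<open>q \<in> N\<close> pz p j
      by (intro colsum_commute permutes_swap_id) (auto simp: cells_def Q_def transpose_def)
    also have "(\<lambda>t. V (t \<circ> transpose q p)) = V"
      using eqv_transpose[OF V_eqv(1) \<open>q \<in> A\<close> p(1)] by auto
    finally show ?thesis .
  qed
  have Uqz: "?U (t \<circ> transpose q z) = ?U t" if q: "q \<in> Q" for q t
  proof -
    have "z \<noteq> q" "z \<noteq> p" using q Q z p P' by auto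
    then have "transpose q p \<circ> transpose p z = transpose q z \<circ> transpose q p"
      using bij_comp_transpose[OF bij_transpose, of q p p z] by simp
    then have "transpose q z = transpose q p \<circ> transpose p z \<circ> transpose q p"
      by (simp add: o_assoc[symmetric])
    then have "?U (t \<circ> transpose q z) = ?U (t \<circ> transpose q p \<circ> transpose p z \<circ> transpose q p)"
      by (simp add: o_assoc)
    also have "\<dots> = ?U t" by (simp only: Up[OF q] Uz)
    finally show ?thesis .
  qed
  \<comment> \<open>For \<open>q\<close> in a column of \<open>J\<close>, the second-row cell
    \<open>z'\<close> of that column makes the summand symmetric under
    \<open>transpose q z'\<close>, so the antisymmetriser kills it.\<close>
  have zero: "colsum J (\<lambda>t. V (t \<circ> transpose q z)) t = 0" if q: "q \<in> A - Q" for q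
  proof -
    obtain z' where z': "z' \<in> B" "col z' = col q" using q J by (auto simp: Q_def)
    have qN: "q \<in> N" "z' \<in> N" "q \<noteq> z'" "z \<noteq> q" using q z z' P' by auto
    have "z \<noteq> z'" using z z' j q by (auto simp: Q_def)
    show ?thesis
    proof (rule colsum_odd)
      show "q \<in> cells J" "z' \<in> cells J" using q qN z' by (auto simp: cells_def Q_def)
      fix t
      have "transpose q z \<circ> transpose z z' = transpose q z' \<circ> transpose q z"
        using bij_comp_transpose[OF bij_transpose, of q z z z'] qN \<open>z \<noteq> z'\<close> by simp
      then have "V (t \<circ> transpose q z' \<circ> transpose q z) = V (t \<circ> transpose q z \<circ> transpose z z')"
        by (simp add: o_assoc[symmetric])
      also have "\<dots> = V (t \<circ> transpose q z)"
        using eqv_transpose[OF V_eqv(2) z(1) z'(1)] by simp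
      finally show "V (t \<circ> transpose q z' \<circ> transpose q z) = V (t \<circ> transpose q z)" .
    qed (use z' qN in auto)
  qed
  have "of_nat (card Q) * ?U t = (\<Sum>q\<in>Q. ?U (t \<circ> transpose q z))" by (simp add: Uqz)
  also have "\<dots> = (\<Sum>q\<in>Q. colsum J (\<lambda>t. V (t \<circ> transpose q z)) t)"
  proof (intro sum.cong refl colsum_commute permutes_swap_id)
    fix q assume q: "q \<in> Q"
    then show "q \<in> N" "z \<in> N" using Q P' pz by auto
    show "transpose q z c = c" if "c \<in> cells J" for c
      using that q z j by (auto simp: transpose_def cells_def Q_def)
  qed
  also have "\<dots> = (\<Sum>q\<in>A. colsum J (\<lambda>t. V (t \<circ> transpose q z)) t)"
    using Q P' zero by (intro sum.mono_neutral_left) auto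
  also have "\<dots> = colsum J (\<lambda>t. - V t) t"
    using z V_raise_A by (simp add: colsum_sum[symmetric])
  also have "\<dots> = - ?U t" by (simp add: colsum_def sum_negf)
  finally have "of_nat (card Q + 1) * ?U t = 0" by (simp add: algebra_simps)
  then show ?thesis by (simp only: mult_eq_0_iff of_nat_eq_0_iff) simp
qed

lemma peel_columns:
  assumes "finite J" "J \<subseteq> col ` B - {c0}" "\<And>t. colsum (insert c0 J) V t = 0"
  shows "colsum {c0} V t = 0"
  using assms
proof (induction J arbitrary: t)
  case (insert j J)
  have "colsum (insert c0 J) V t = 0" for t
    using insert.prems insert.hyps c0
    by (intro peel_column[of "insert c0 J" j]) (auto simp: insert_commute)
  then show ?case using insert by auto
qed simp

text \<open>When only column \<open>c0\<close> is left, the alternating sum runs over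
  \<open>p0\<close>, \<open>z0\<close> and \<open>X\<close>. The cells \<open>p0\<close> and
  \<open>z0\<close> are removed in turn: symmetry along the row spreads the vanishing to all cells
  of the row, and summing over them against the highest weight condition shows that the smaller
  alternating sum equals a nonpositive multiple of itself.\<close>

lemma nondegenerate:
  assumes 0: "\<And>t. colsum (col ` B) V t = 0"
  shows "V = 0"
proof -
  have col0: "colsum {c0} V t = 0" for t
    using P' 0 c0 by (intro peel_columns[of "col ` B - {c0}"]) (auto simp: insert_absorb)
  obtain z0 where z0: "z0 \<in> B" "col z0 = c0" using c0 by auto
  obtain p0 where p0: "p0 \<in> A" "col p0 = c0" using c0 col_BA by auto
  define Y where "Y = insert z0 X"
  have Y: "finite Y" "p0 \<notin> Y" "Y \<subseteq> N" "A \<inter> Y = {}" "z0 \<notin> X" "Y \<subseteq> B \<union> X"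
    using P' z0 p0 by (auto simp: Y_def)
  have cells0: "cells {c0} = insert p0 Y"
  proof -
    have "c \<in> insert p0 Y" if "c \<in> N" "col c = c0" for c
      using that P'(11) inj_onD[OF colA, of c p0] inj_onD[OF colB, of c z0] z0 p0
      by (auto simp: Y_def)
    then show ?thesis using P' z0 p0 colX by (auto simp: cells_def Y_def)
  qed
  have colY: "col c = c0" if "c \<in> insert p0 Y" for c
    using that z0 p0 colX by (auto simp: Y_def)
  have colperms0: "colperms {c0} = {s. s permutes insert p0 Y}"
  proof -
    have "col (s c) = col c" if "s permutes insert p0 Y" for s c
      using that colY permutes_in_image[OF that, of c]
      by (cases "c \<in> insert p0 Y") (auto simp: permutes_def)
    then show ?thesis by (auto simp: colperms_def cells0)
  qed
  define alt where "alt Z t = (\<Sum>q | q permutes Z. of_int (sign q) * V (t \<circ> q))" for Z :: "'a set" and t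
  have alt_insert: "alt (insert a Z) t = coset_sum True a Z (alt Z) t" if "finite Z" "a \<notin> Z" for a Z t
  proof -
    have "alt (insert a Z) t = (\<Sum>b\<in>insert a Z. \<Sum>q | q permutes Z.
        of_int (sign (transpose a b \<circ> q)) * V (t \<circ> (transpose a b \<circ> q)))"
      unfolding alt_def by (rule sum_over_permutations_insert[OF that])
    also have "\<dots> = (\<Sum>b\<in>insert a Z. twist True (transpose b a) * alt Z (t \<circ> transpose b a))"
      unfolding alt_def sum_distrib_left
    proof (intro sum.cong refl)
      fix b q assume "q \<in> {q. q permutes Z}"
      then have "permutation q" using that permutation_permutes by blast
      then show "of_int (sign (transpose a b \<circ> q)) * V (t \<circ> (transpose a b \<circ> q)) =
          twist True (transpose b a) * (of_int (sign q) * V (t \<circ> transpose b a \<circ> q))"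
        by (simp add: sign_compose permutation_swap_id twist_def o_assoc transpose_commute[of a])
    qed
    finally show ?thesis by (simp add: coset_sum_def)
  qed
  have U0: "coset_sum True p0 Y (alt Y) t = 0" for t
    using col0[of t] alt_insert[OF Y(1,2)] by (simp add: colsum_def colperms0 alt_def)
  have UA: "alt Y (t \<circ> transpose p p0) = alt Y t" if "p \<in> A" for p t
  proof -
    have "t \<circ> transpose p p0 \<circ> q = t \<circ> q \<circ> transpose p p0" if "q permutes Y" for q
    proof -
      have "q p = p" "q p0 = p0" using that \<open>p \<in> A\<close> p0 Y by (auto simp: permutes_def)
      then show ?thesis using bij_comp_transpose[OF permutes_bij[OF that], of p p0]
        by (metis o_assoc)
    qed
    then show ?thesis unfolding alt_def
      using eqv_transpose[OF V_eqv(1) that p0(1)] by (intro sum.cong refl) auto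
  qed
  have Up: "coset_sum True p Y (alt Y) t = 0" if p: "p \<in> A" for p t
  proof -
    have "transpose p p0 ` Y = Y" using p p0 Y by (auto simp: transpose_def image_iff)
    then have "coset_sum True p0 Y (alt Y) (t \<circ> transpose p p0) = coset_sum True p Y (\<lambda>t. alt Y (t \<circ> transpose p p0)) t"
      using coset_sum_conj[OF bij_transpose, of True p0 Y "alt Y" t p p0] by simp
    then show ?thesis by (simp add: UA[OF p] U0)
  qed
  \<comment> \<open>Summation over the first row gives \<open>card A\<close> times
    \<open>alt Y t\<close> on one side and, by \<open>V_raise_A\<close>, \<open>- card Y\<close>
    times it on the other.\<close>
  have U_zero: "alt Y t = 0" for t
  proof -
    have eqA: "alt Y t = (\<Sum>y\<in>Y. alt Y (t \<circ> transpose y p))" if "p \<in> A" for p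
      using Up[OF that, of t] that Y by (subst (asm) coset_sum_True) auto
    have "of_nat (card A) * alt Y t = (\<Sum>p\<in>A. alt Y t)" by simp
    also have "\<dots> = (\<Sum>p\<in>A. \<Sum>y\<in>Y. alt Y (t \<circ> transpose y p))"
      by (intro sum.cong refl eqA)
    also have "\<dots> = (\<Sum>p\<in>A. \<Sum>q | q permutes Y. \<Sum>y\<in>Y. of_int (sign q) * V (t \<circ> q \<circ> transpose y p))"
    proof (intro sum.cong refl)
      fix p assume p: "p \<in> A"
      have eq: "(\<Sum>y\<in>Y. of_int (sign q) * V (t \<circ> transpose y p \<circ> q)) =
          (\<Sum>y\<in>Y. of_int (sign q) * V (t \<circ> q \<circ> transpose y p))" if q: "q permutes Y" for q
      proof -
        have "t \<circ> transpose (q y) p \<circ> q = t \<circ> q \<circ> transpose y p" for y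
        proof -
          have "q p = p" using q p Y by (auto simp: permutes_def)
          then show ?thesis using bij_comp_transpose[OF permutes_bij[OF q], of y p]
            by (metis o_assoc)
        qed
        then show ?thesis
          by (subst sum.permute[OF q]) (simp add: o_def[of _ q] del: o_apply)
      qed
      show "(\<Sum>y\<in>Y. alt Y (t \<circ> transpose y p)) =
          (\<Sum>q | q permutes Y. \<Sum>y\<in>Y. of_int (sign q) * V (t \<circ> q \<circ> transpose y p))"
        unfolding alt_def by (subst sum.swap) (rule sum.cong[OF refl], rule eq, simp)
    qed
    also have "\<dots> = (\<Sum>q | q permutes Y. \<Sum>p\<in>A. \<Sum>y\<in>Y. of_int (sign q) * V (t \<circ> q \<circ> transpose p y))"
      by (subst sum.swap) (simp only: transpose_commute)
    also have "\<dots> = (\<Sum>q | q permutes Y. \<Sum>y\<in>Y. \<Sum>p\<in>A. of_int (sign q) * V (t \<circ> q \<circ> transpose p y))"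
      by (rule sum.cong[OF refl], rule sum.swap)
    also have "\<dots> = (\<Sum>q | q permutes Y. \<Sum>y\<in>Y. - (of_int (sign q) * V (t \<circ> q)))"
    proof (intro sum.cong refl)
      fix q y assume "y \<in> Y"
      then show "(\<Sum>p\<in>A. of_int (sign q) * V (t \<circ> q \<circ> transpose p y)) = - (of_int (sign q) * V (t \<circ> q))"
        using V_raise_A[of y "t \<circ> q"] Y(6) by (auto simp: sum_distrib_left[symmetric])
    qed
    also have "\<dots> = - of_nat (card Y) * alt Y t"
      by (simp add: alt_def sum_distrib_left sum_negf)
    finally have "of_nat (card A + card Y) * alt Y t = 0" by (simp add: algebra_simps)
    moreover have "card A + card Y \<noteq> 0" using p0 P'(2) by auto
    ultimately show ?thesis by (metis mult_eq_0_iff of_nat_eq_0_iff)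
  qed
  have altX: "alt X t = fact (card X) * V t" for t
  proof -
    have "alt X t = (\<Sum>q | q permutes X. V t)"
      unfolding alt_def using eqvD[OF V_eqv(3)]
      by (intro sum.cong refl) (simp add: twist_def flip: of_int_mult mult.assoc)
    then show ?thesis using card_permutations[OF refl P'(4)] by simp
  qed
  have Vz0: "coset_sum True z0 X V t = 0" for t
  proof -
    have "coset_sum True z0 X (alt X) t = 0" using alt_insert[OF P'(4) Y(5)] U_zero by (simp add: Y_def)
    moreover have "alt X = (\<lambda>t. fact (card X) * V t)" using altX by auto
    ultimately show ?thesis by (simp add: coset_sum_scale)
  qed
  have Vz: "V t = (\<Sum>x\<in>X. V (t \<circ> transpose x z))" if z: "z \<in> B" for z t
  proof -
    have "transpose z z0 ` X = X" using z z0 P' by (auto simp: transpose_def image_iff)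
    then have "coset_sum True z0 X V (t \<circ> transpose z z0) = coset_sum True z X (\<lambda>t. V (t \<circ> transpose z z0)) t"
      using coset_sum_conj[OF bij_transpose, of True z0 X V t z z0] by simp
    then have "coset_sum True z X V t = 0"
      using eqv_transpose[OF V_eqv(2) z z0(1)] by (simp add: Vz0)
    moreover have "coset_sum True z X V t = V t - (\<Sum>x\<in>X. V (t \<circ> transpose x z))"
      using z P' by (intro coset_sum_True) auto
    ultimately show ?thesis by simp
  qed
  \<comment> \<open>The same argument one row down: \<open>card B\<close> times \<open>V t\<close>
    equals \<open>- card X\<close> times \<open>V t\<close>.\<close>
  have "V t = 0" for t
  proof -
    have "of_nat (card B) * V t = (\<Sum>z\<in>B. V t)" by simp
    also have "\<dots> = (\<Sum>z\<in>B. \<Sum>x\<in>X. V (t \<circ> transpose x z))"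
      by (intro sum.cong refl Vz)
    also have "\<dots> = (\<Sum>x\<in>X. \<Sum>z\<in>B. V (t \<circ> transpose z x))"
      by (subst sum.swap) (simp add: transpose_commute)
    also have "\<dots> = - of_nat (card X) * V t" using V_raise_B by simp
    finally have "of_nat (card B + card X) * V t = 0" by (simp add: algebra_simps)
    moreover have "card B + card X \<noteq> 0" using z0 P'(3) by auto
    ultimately show ?thesis by (metis mult_eq_0_iff of_nat_eq_0_iff)
  qed
  then show ?thesis by auto
qed

end

section \<open>Polytabloids as highest weight vectors\<close>

lemma antisym_fn_fns: "antisym_fn u \<in> perm_fns N"
  by (simp add: antisym_fn_def perm_fns_def)

lemma antisym_fn_rows_inv:
  assumes p: "p permutes N" "p ` A = A" "p ` B = B" "\<And>x. x \<in> X \<Longrightarrow> p x = x"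
  shows "antisym_fn u (t \<circ> p) = antisym_fn u t"
proof -
  have "rows_eq A B X (t \<circ> p) w = rows_eq A B X t w" for w
    unfolding rows_eq_def comp_image p(2,3) using p(4) by simp
  then show ?thesis using permutes_comp_iff[OF p(1)] by (simp add: antisym_fn_def)
qed

lemma antisym_fn_eqv_A: "eqv False A (antisym_fn u)" and antisym_fn_eqv_B: "eqv False B (antisym_fn u)"
proof -
  show "eqv False A (antisym_fn u)"
    unfolding eqv_def
  proof (intro allI impI)
    fix p t assume p: "p permutes A"
    have "p permutes N" by (rule permutes_subset[OF p P'(5)])
    moreover have "p ` A = A" by (rule permutes_image[OF p])
    moreover have "p ` B = B" using permutes_image_disjoint[OF p] P'(8) by simp
    moreover have "\<And>x. x \<in> X \<Longrightarrow> p x = x" using P'(9) permutes_not_in[OF p] by auto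
    ultimately show "antisym_fn u (t \<circ> p) = twist False p * antisym_fn u t" using antisym_fn_rows_inv by (simp add: twist_def)
  qed
  show "eqv False B (antisym_fn u)"
    unfolding eqv_def
  proof (intro allI impI)
    fix p t assume p: "p permutes B"
    have "p permutes N" by (rule permutes_subset[OF p P'(6)])
    moreover have "p ` B = B" by (rule permutes_image[OF p])
    moreover have "p ` A = A" using permutes_image_disjoint[OF p] P'(8) by simp
    moreover have "\<And>x. x \<in> X \<Longrightarrow> p x = x" using P'(10) permutes_not_in[OF p] by auto
    ultimately show "antisym_fn u (t \<circ> p) = twist False p * antisym_fn u t" using antisym_fn_rows_inv by (simp add: twist_def)
  qed
qed

lemma colperms_X: "p permutes X \<Longrightarrow> p \<in> colperms (col ` B)"
proof -
  assume p: "p permutes X"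
  have "X \<subseteq> cells (col ` B)" using P' colX c0 by (auto simp: cells_def)
  moreover have "col (p c) = col c" for c
    using colX permutes_in_image[OF p, of c] p by (cases "c \<in> X") (auto simp: permutes_def)
  ultimately show ?thesis using permutes_subset[OF p] by (auto simp: colperms_def)
qed

text \<open>\<open>X\<close> lies in one column, so a permutation of \<open>X\<close> belongs to the
  column group and is absorbed in its signed sum.\<close>

lemma antisym_fn_eqv_X: "eqv True X (antisym_fn u)"
  unfolding eqv_def
proof (intro allI impI)
  fix p t :: "'a \<Rightarrow> 'a" assume p: "p permutes X"
  note pC = colperms_X[OF p] and pN = colperms_perm[OF colperms_X[OF p]]
  have perm_inner: "inv p permutes X" "inv p ` A = A" "inv p ` B = B" "p ` A = A" "p ` B = B"
    using permutes_inv[OF p] permutes_image_disjoint[OF p] permutes_image_disjoint[OF permutes_inv[OF p]] P'(9,10)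
    by simp_all
  have X: "(\<forall>x\<in>X. t (p x) = w x) \<longleftrightarrow> (\<forall>x\<in>X. t x = w (inv p x))" for w
  proof
    show "\<forall>x\<in>X. t x = w (inv p x)" if "\<forall>x\<in>X. t (p x) = w x"
      using that permutes_in_image[OF perm_inner(1)] permutes_inverses(1)[OF p] by metis
    show "\<forall>x\<in>X. t (p x) = w x" if "\<forall>x\<in>X. t x = w (inv p x)"
      using that permutes_in_image[OF p] permutes_inverses(2)[OF p] by metis
  qed
  have rows: "rows_eq A B X (t \<circ> p) w = rows_eq A B X t (w \<circ> inv p)" for w
    unfolding rows_eq_def comp_image perm_inner comp_apply X ..
  have "(\<Sum>s\<in>colperms (col ` B). of_int (sign s) * of_bool (rows_eq A B X (t \<circ> p) (u \<circ> s))) =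
      (\<Sum>s\<in>colperms (col ` B). of_int (sign (s \<circ> p)) * of_bool (rows_eq A B X (t \<circ> p) (u \<circ> (s \<circ> p))))"
    by (rule sum_colperms_comp[OF pC])
  also have "\<dots> = (\<Sum>s\<in>colperms (col ` B). of_int (sign p) * (of_int (sign s) * of_bool (rows_eq A B X t (u \<circ> s)) :: complex))"
    using colperms_permutation pC permutes_inv_o(1)[OF p]
    by (intro sum.cong refl) (simp add: rows sign_compose o_assoc[symmetric])
  finally show "antisym_fn u (t \<circ> p) = twist True p * antisym_fn u t"
    using permutes_comp_iff[OF pN] by (simp add: antisym_fn_def twist_def sum_distrib_left)
qed

text \<open>\<open>u \<circ> s0 \<circ> inv u\<close> permutes entries within the columns of the
  tableau \<open>u\<close>, and the column stabilizer acts on a polytabloid by its sign.\<close>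

lemma antisym_fn_left:
  assumes u: "u permutes N" and g: "s0 \<in> colperms (col ` B)"
  shows "antisym_fn u (u \<circ> s0 \<circ> inv u \<circ> t) = of_int (sign s0) * antisym_fn u t"
proof -
  have s0: "s0 permutes N" using colperms_perm[OF g] .
  define q where "q = u \<circ> s0 \<circ> inv u"
  have q: "q permutes N" unfolding q_def using u s0 by (intro permutes_compose permutes_inv)
  have qt: "q \<circ> t permutes N \<longleftrightarrow> t permutes N"
  proof
    assume "q \<circ> t permutes N"
    then have "inv q \<circ> (q \<circ> t) permutes N" using permutes_inv[OF q] by (rule permutes_compose)
    then show "t permutes N" using permutes_inv_o(2)[OF q] by (simp add: o_assoc)
  qed (use q in \<open>auto intro: permutes_compose\<close>)
  have "(\<Sum>s\<in>colperms (col ` B). of_int (sign s) * of_bool (rows_eq A B X (q \<circ> t) (u \<circ> s))) =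
      (\<Sum>s\<in>colperms (col ` B). of_int (sign (s0 \<circ> s)) * of_bool (rows_eq A B X (q \<circ> t) (u \<circ> (s0 \<circ> s))))"
    by (rule sum_colperms_comp_left[OF g])
  also have "\<dots> = (\<Sum>s\<in>colperms (col ` B). of_int (sign s0) * (of_int (sign s) * of_bool (rows_eq A B X t (u \<circ> s)) :: complex))"
  proof (intro sum.cong refl)
    fix s assume s: "s \<in> colperms (col ` B)"
    have "u \<circ> (s0 \<circ> s) = q \<circ> (u \<circ> s)"
      using permutes_inverses(2)[OF u] by (simp add: fun_eq_iff q_def)
    moreover have "rows_eq A B X (q \<circ> t) (q \<circ> w) = rows_eq A B X t w" for w
      by (rule rows_eq_left[OF permutes_inj[OF q]])
    ultimately show "of_int (sign (s0 \<circ> s)) * of_bool (rows_eq A B X (q \<circ> t) (u \<circ> (s0 \<circ> s))) =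
      of_int (sign s0) * (of_int (sign s) * of_bool (rows_eq A B X t (u \<circ> s)) :: complex)"
      using colperms_permutation g s by (simp add: sign_compose)
  qed
  finally show ?thesis unfolding q_def[symmetric] using qt by (simp add: antisym_fn_def sum_distrib_left)
qed

text \<open>The entries \<open>t c\<close> and \<open>t d\<close> stand in one column of
  \<open>u\<close>. Exchanging them negates \<open>D t\<close> by \<open>left\<close>, yet this is
  the exchange of the positions \<open>c\<close> and \<open>d\<close>, which leaves
  \<open>D t\<close> unchanged.\<close>

lemma vanish_same_column:
  assumes u: "u permutes N" and t: "t permutes N"
    and cd: "c \<in> N" "d \<in> N" "c \<noteq> d" "col (inv u (t c)) = col (inv u (t d))"
    and D: "D (t \<circ> transpose c d) = D t"
    and left: "\<And>s t. s \<in> colperms (col ` B) \<Longrightarrow> D (u \<circ> s \<circ> inv u \<circ> t) = of_int (sign s) * D t"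
  shows "D t = (0 :: complex)"
proof -
  define s where "s = inv u \<circ> t"
  have s: "s permutes N" unfolding s_def using u t by (intro permutes_compose permutes_inv)
  have sc: "s c \<in> N" "s d \<in> N" "s c \<noteq> s d" "col (s c) = col (s d)"
    using cd permutes_in_image[OF s] inj_eq[OF permutes_inj[OF s]] unfolding s_def by auto
  have "col (s c) \<in> col ` B"
  proof (rule ccontr)
    assume n: "col (s c) \<notin> col ` B"
    then have "s c \<in> A" "s d \<in> A" using sc A_if_col[of "s c"] A_if_col[of "s d"] by simp_all
    then show False using sc colA by (auto dest: inj_onD)
  qed
  then have tr: "transpose (s c) (s d) \<in> colperms (col ` B)"
    using sc by (intro colperms_transpose) (auto simp: cells_def)
  have "u \<circ> transpose (s c) (s d) \<circ> inv u \<circ> t = u \<circ> (transpose (s c) (s d) \<circ> s)"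
    by (simp add: s_def o_assoc)
  also have "\<dots> = u \<circ> (s \<circ> transpose c d)"
    using bij_comp_transpose[OF permutes_bij[OF s]] by simp
  also have "\<dots> = t \<circ> transpose c d"
    using permutes_inv_o(1)[OF u] by (simp add: s_def o_assoc)
  finally have "D (t \<circ> transpose c d) = of_int (sign (transpose (s c) (s d))) * D t"
    using left[OF tr, of t] by simp
  then show ?thesis using D sc by (simp add: sign_swap_id)
qed

text \<open>A raised function is symmetric in a row that has gained a cell. The entries of that row
  no longer fit into distinct columns of \<open>u\<close>, given in the second-row case that the
  first row does, and \<open>vanish_same_column\<close> applies.\<close>

lemma antisym_fn_hw_space:
  assumes u: "u permutes N"
  shows "antisym_fn u \<in> hw_space N A B X"
proof -
  have left: "coset_sum False y S (antisym_fn u) (u \<circ> s \<circ> inv u \<circ> t) = of_int (sign s) * coset_sum False y S (antisym_fn u) t"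
    if "s \<in> colperms (col ` B)" for y S s t
    using antisym_fn_left[OF u that] by (simp add: coset_sum_False sum_distrib_left comp_assoc)
  have zero: "coset_sum False y S (antisym_fn u) t = 0" if S: "insert y S \<subseteq> N" and not: "\<not> t permutes N" for y S t
    using coset_sum_fns[OF antisym_fn_fns S] not by (simp add: perm_fns_def)
  have s_image: "inv u (t c) \<in> N" if "t permutes N" "c \<in> N" for t c
    using that permutes_in_image[of t N c] permutes_in_image[OF permutes_inv[OF u], of "t c"] by simp
  have s_inj: "inv u (t c) = inv u (t d) \<longleftrightarrow> c = d" if "t permutes N" for t c d
    using that permutes_inj[OF permutes_inv[OF u]] permutes_inj[of t N] by (simp add: inj_eq)
  have col_N: "col c \<in> col ` A" if "c \<in> N" for c
    using that P'(11) colX c0 col_BA by auto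
  have A0: "coset_sum False y A (antisym_fn u) t = 0" if y: "y \<in> B \<union> X" for y t
  proof (cases "t permutes N")
    case t: True
    have yA: "y \<notin> A" "insert y A \<subseteq> N" using y P' by auto
    have "\<not> inj_on (\<lambda>c. col (inv u (t c))) (insert y A)"
    proof
      assume "inj_on (\<lambda>c. col (inv u (t c))) (insert y A)"
      then have "card (insert y A) \<le> card (col ` A)"
        using yA s_image[OF t] P' by (intro card_inj_on_le) (auto intro!: col_N)
      then show False using yA P' card_image[OF colA] by simp
    qed
    then obtain c d where cd: "c \<in> insert y A" "d \<in> insert y A" "c \<noteq> d"
      "col (inv u (t c)) = col (inv u (t d))" by (auto simp: inj_on_def)
    have "eqv False (insert y A) (coset_sum False y A (antisym_fn u))"
      using P' yA antisym_fn_eqv_A by (intro coset_sum_eqv) auto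
    from eqv_transpose[OF this cd(1,2), of t]
    have "coset_sum False y A (antisym_fn u) (t \<circ> transpose c d) = coset_sum False y A (antisym_fn u) t" by simp
    from vanish_same_column[of u t c d "coset_sum False y A (antisym_fn u)", OF u t _ _ cd(3,4) this left]
    show ?thesis using cd(1,2) yA by blast
  qed (use zero y P' in auto)
  have B0: "coset_sum False x B (antisym_fn u) t = 0" if x: "x \<in> X" for x t
  proof (cases "t permutes N")
    case t: True
    let ?f = "\<lambda>c. col (inv u (t c))"
    have xB: "x \<notin> B" "insert x B \<subseteq> N" "A \<inter> insert x B = {}" using x P' by auto
    \<comment> \<open>A first row with distinct columns fills all of them and so uses up the columns
      that are single cells. The enlarged second row is thereby confined to the columns of
      \<open>B\<close>, of which there are too few.\<close>
    have "\<not> (inj_on ?f A \<and> inj_on ?f (insert x B))"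
    proof
      assume inj: "inj_on ?f A \<and> inj_on ?f (insert x B)"
      have "?f ` A \<subseteq> col ` A" using s_image[OF t] P' by (auto intro!: col_N)
      then have fA: "?f ` A = col ` A"
        using inj P' card_image[OF colA] card_image[of ?f A] by (intro card_subset_eq) auto
      have "?f c \<in> col ` B" if c: "c \<in> insert x B" for c
      proof (rule ccontr)
        assume n: "?f c \<notin> col ` B"
        obtain c' where c': "c' \<in> A" "?f c' = ?f c"
          using fA col_N[OF s_image[OF t]] c xB by (metis (no_types, lifting) imageE subsetD)
        have "inv u (t c) \<in> A"
          using n s_image[OF t, of c] c xB by (intro A_if_col) auto
        moreover have "inv u (t c') \<in> A"
          using n c' s_image[OF t, of c'] P'(5) by (intro A_if_col) auto
        ultimately have "inv u (t c') = inv u (t c)" using c' colA by (auto dest: inj_onD)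
        then have "c' = c" using s_inj[OF t] by simp
        then show False using c c' xB by auto
      qed
      then have "card (insert x B) \<le> card (col ` B)"
        using inj P' by (intro card_inj_on_le[of ?f]) auto
      then show False using xB P' card_image[OF colB] by simp
    qed
    then obtain c d where cd: "c \<noteq> d" "?f c = ?f d"
      "(c \<in> A \<and> d \<in> A) \<or> (c \<in> insert x B \<and> d \<in> insert x B)" by (auto simp: inj_on_def)
    have "eqv False (insert x B) (coset_sum False x B (antisym_fn u))"
      using P' xB antisym_fn_eqv_B by (intro coset_sum_eqv) auto
    moreover have "eqv False A (coset_sum False x B (antisym_fn u))"
      using xB antisym_fn_eqv_A by (intro coset_sum_eqv_other) auto
    ultimately have "coset_sum False x B (antisym_fn u) (t \<circ> transpose c d) = coset_sum False x B (antisym_fn u) t"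
      using cd(3) eqv_transpose by fastforce
    from vanish_same_column[of u t c d "coset_sum False x B (antisym_fn u)", OF u t _ _ cd(1,2) this left]
    show ?thesis using cd(3) xB P'(5) by blast
  qed (use zero x P' in auto)
  show ?thesis
    using A0 B0 antisym_fn_fns antisym_fn_eqv_A antisym_fn_eqv_B antisym_fn_eqv_X by (auto simp: hw_space_def young_mod_def)
qed

lemma rows_eq_hw_space:
  assumes V: "V \<in> hw_space N A B X" and p: "p permutes N" "rows_eq A B X p id"
  shows "V (t \<circ> p) = V t"
proof -
  define a where "a = restrict_id p A"
  define b where "b = restrict_id p B"
  have pA: "p ` A = A" and pB: "p ` B = B" and pX: "\<And>x. x \<in> X \<Longrightarrow> p x = x"
    using p(2) by (auto simp: rows_eq_def)
  have a: "a permutes A" unfolding a_def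
    using pA permutes_inj_on[OF p(1)] by (intro permutes_restrict_id) (simp add: bij_betw_def)
  have b: "b permutes B" unfolding b_def
    using pB permutes_inj_on[OF p(1)] by (intro permutes_restrict_id) (simp add: bij_betw_def)
  have "p = a \<circ> b"
  proof
    fix c
    show "p c = (a \<circ> b) c"
      using pA pB pX P'(8-11) permutes_not_in[OF p(1), of c]
      by (auto simp: a_def b_def restrict_id_def)
  qed
  then show ?thesis
    using eqvD[OF V_eqv(1)[OF V] a] eqvD[OF V_eqv(2)[OF V] b]
    by (simp add: o_assoc twist_def)
qed

text \<open>\<open>V\<close> is constant on row classes, so pairing with a polytabloid reads off the
  column sum of \<open>V\<close> at \<open>u\<close>; the factor is the order of the row
  group.\<close>

lemma perm_inner_antisym_fn:
  assumes V: "V \<in> hw_space N A B X" and u: "u permutes N"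
  shows "perm_inner N (antisym_fn u) V =
    of_nat (card {p. p permutes N \<and> rows_eq A B X p id}) * cnj (colsum (col ` B) V u)"
proof -
  let ?S = "{t. t permutes N}" and ?C = "colperms (col ` B)"
  have inner: "(\<Sum>t\<in>?S. of_bool (rows_eq A B X t w) * cnj (V t)) =
      of_nat (card {p. p permutes N \<and> rows_eq A B X p id}) * cnj (V w)" if w: "w permutes N" for w
  proof -
    have "(\<Sum>t\<in>?S. of_bool (rows_eq A B X t w) * cnj (V t)) =
        (\<Sum>p\<in>?S. of_bool (rows_eq A B X (w \<circ> p) w) * cnj (V (w \<circ> p)))"
      by (rule setum_permutations_compose_left[OF w])
    also have "\<dots> = (\<Sum>p\<in>?S. of_bool (rows_eq A B X p id) * cnj (V w))"
    proof (intro sum.cong refl)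
      fix p assume p: "p \<in> ?S"
      have "rows_eq A B X (w \<circ> p) w = rows_eq A B X p id"
        using rows_eq_left[OF permutes_inj[OF w], of A B X p id] by simp
      then show "of_bool (rows_eq A B X (w \<circ> p) w) * cnj (V (w \<circ> p)) =
          of_bool (rows_eq A B X p id) * cnj (V w)"
        using rows_eq_hw_space[OF V, of p w] p by auto
    qed
    finally show ?thesis
      using finite_permutations[OF P'(1)]
      by (simp add: sum_distrib_right[symmetric] of_bool_def sum.If_cases Int_def)
  qed
  have "perm_inner N (antisym_fn u) V = (\<Sum>t\<in>?S. \<Sum>s\<in>?C. of_int (sign s) * (of_bool (rows_eq A B X t (u \<circ> s)) * cnj (V t)))"
    unfolding perm_inner_def by (intro sum.cong refl) (simp add: antisym_fn_def sum_distrib_right mult.assoc)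
  also have "\<dots> = (\<Sum>s\<in>?C. of_int (sign s) * (\<Sum>t\<in>?S. of_bool (rows_eq A B X t (u \<circ> s)) * cnj (V t)))"
    unfolding sum_distrib_left by (rule sum.swap)
  also have "\<dots> = (\<Sum>s\<in>?C. of_int (sign s) *
      (of_nat (card {p. p permutes N \<and> rows_eq A B X p id}) * cnj (V (u \<circ> s))))"
    using inner permutes_compose[OF colperms_perm u] by (intro sum.cong refl) simp
  also have "\<dots> = of_nat (card {p. p permutes N \<and> rows_eq A B X p id}) * cnj (colsum (col ` B) V u)"
    by (simp add: colsum_def sum_distrib_left mult_ac)
  finally show ?thesis .
qed

text \<open>By \<open>perm_inner_antisym_fn\<close>, orthogonality to all polytabloids says that
  every column sum vanishes, which \<open>nondegenerate\<close> excludes for nonzero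
  vectors.\<close>

lemma span_antisym_fn: "fun_vs.span (antisym_fn ` {u. u permutes N}) = hw_space N A B X"
proof (rule subspace_eq_if_orthogonal_zero[OF P'(1)])
  show "fun_vs.span (antisym_fn ` {u. u permutes N}) \<subseteq> hw_space N A B X"
    by (rule fun_vs.span_minimal) (auto simp: antisym_fn_hw_space hw_space_subspace)
  show "hw_space N A B X \<subseteq> perm_fns N" by (auto simp: hw_space_def young_mod_def)
  fix V assume V: "V \<in> hw_space N A B X"
    and orth: "\<And>w. w \<in> fun_vs.span (antisym_fn ` {u. u permutes N}) \<Longrightarrow> perm_inner N w V = 0"
  have "id \<in> {p. p permutes N \<and> rows_eq A B X p id}" by (simp add: permutes_id rows_eq_def)
  then have index_cell: "card {p. p permutes N \<and> rows_eq A B X p id} \<noteq> 0"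
    using finite_permutations[OF P'(1)] by (subst card_eq_0_iff) (blast intro: rev_finite_subset)
  have "colsum (col ` B) V u = 0" for u
  proof (cases "u permutes N")
    case True
    then have "perm_inner N (antisym_fn u) V = 0" by (intro orth fun_vs.span_base) auto
    then show ?thesis using perm_inner_antisym_fn[OF V True] index_cell by simp
  next
    case False
    then have "V (u \<circ> s) = 0" if "s \<in> colperms (col ` B)" for s
      using V permutes_comp_iff[OF colperms_perm[OF that]] by (auto simp: hw_space_def young_mod_def perm_fns_def)
    then show ?thesis by (simp add: colsum_def)
  qed
  then show "V = 0" by (rule nondegenerate[OF V])
qed (auto simp: hw_space_subspace)

end

section \<open>Traces on Young modules\<close>

lemma trace_on_eq_0:
  assumes "fin_dim V" "lin f" "\<And>v. v \<in> V \<Longrightarrow> f v = 0"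
  shows "trace_on V f = 0"
proof -
  obtain B where B: "basis_of B V" using fin_dim_basis assms(1) by blast
  then have BV: "b \<in> V" if "b \<in> B" for b using that fun_vs.span_superset by blast
  have "0 \<in> V" using B fun_vs.span_zero by blast
  then have "f ` V \<subseteq> V" using assms(3) by auto
  from trace_on_eq[OF B assms(2) this] show ?thesis
    using assms(3) BV by (simp add: fun_vs.representation_zero)
qed

definition delta :: "'a \<Rightarrow> 'a \<Rightarrow> complex" where
  "delta t = (\<lambda>u. if u = t then 1 else 0)"

lemma delta_expand:
  "finite T \<Longrightarrow> (\<Sum>t\<in>T. fun_scale (c t) (delta t)) u = (if u \<in> T then c u else 0)"
  by (induction rule: finite_induct) (auto simp: fun_scale_def delta_def)

lemma perm_fns_expand:
  assumes "finite N" "V \<in> perm_fns N"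
  shows "(\<Sum>t | t permutes N. fun_scale (V t) (delta t)) = V"
  using delta_expand[OF finite_permutations[OF assms(1)], of V] assms(2)
  by (auto simp: fun_eq_iff perm_fns_def)

lemma basis_perm_fns:
  assumes "finite N"
  shows "basis_of (delta ` {t. t permutes N}) (perm_fns N)"
proof (intro conjI)
  let ?S = "{t. t permutes N}"
  have fin: "finite ?S" by (rule finite_permutations[OF assms])
  have inj: "inj_on delta ?S" by (rule inj_onI) (metis delta_def zero_neq_one)
  show "finite (delta ` ?S)" using fin by simp
  show "fun_vs.independent (delta ` ?S)"
  proof (rule fun_vs.independent_if_scalars_zero)
    fix c and x :: "('a \<Rightarrow> 'a) \<Rightarrow> complex"
    assume c: "(\<Sum>x\<in>delta ` ?S. fun_scale (c x) x) = 0" and x: "x \<in> delta ` ?S"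
    obtain t where t: "t \<in> ?S" "x = delta t" using x by auto
    have "(\<Sum>t\<in>?S. fun_scale (c (delta t)) (delta t)) = 0"
      using c by (simp add: sum.reindex[OF inj] o_def)
    then show "c x = 0" using t delta_expand[OF fin, of "\<lambda>t. c (delta t)" t] by simp
  qed (use fin in simp)
  show "fun_vs.span (delta ` ?S) = perm_fns N"
  proof
    show "fun_vs.span (delta ` ?S) \<subseteq> perm_fns N"
      by (intro fun_vs.span_minimal perm_fns_subspace) (auto simp: perm_fns_def delta_def)
    show "perm_fns N \<subseteq> fun_vs.span (delta ` ?S)"
    proof
      fix V :: "('a \<Rightarrow> 'a) \<Rightarrow> complex" assume "V \<in> perm_fns N"
      then have "V = (\<Sum>t\<in>?S. fun_scale (V t) (delta t))" using perm_fns_expand[OF assms] by simp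
      also have "\<dots> \<in> fun_vs.span (delta ` ?S)"
        by (intro fun_vs.span_sum fun_vs.span_scale fun_vs.span_base) auto
      finally show "V \<in> fun_vs.span (delta ` ?S)" .
    qed
  qed
qed

lemma trace_perm_fns:
  assumes N: "finite N" and f: "lin f" "f ` perm_fns N \<subseteq> perm_fns N"
  shows "trace_on (perm_fns N) f = (\<Sum>t | t permutes N. f (delta t) t)"
proof -
  let ?S = "{t. t permutes N}" and ?B = "delta ` {t. t permutes N}"
  note B = basis_perm_fns[OF N]
  have inj: "inj_on delta ?S" by (rule inj_onI) (metis delta_def zero_neq_one)
  have d: "delta t \<in> perm_fns N" if "t \<in> ?S" for t
    using that by (auto simp: perm_fns_def delta_def)
  have rep: "fun_vs.representation ?B V (delta t) = V t" if V: "V \<in> perm_fns N" and t: "t \<in> ?S" for V t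
  proof -
    have "fun_vs.representation ?B V (delta t) =
        (\<Sum>u\<in>?S. V u * fun_vs.representation ?B (delta u) (delta t))"
      using representation_sum_scale[OF B d, of ?S "\<lambda>t. t" V "delta t"] perm_fns_expand[OF N V] by simp
    also have "\<dots> = (\<Sum>u\<in>?S. if u = t then V u else 0)"
      using t inj by (intro sum.cong refl) (auto simp: representation_of_basis[OF B] dest: inj_onD)
    also have "\<dots> = V t" using t finite_permutations[OF N] by simp
    finally show ?thesis .
  qed
  show ?thesis
    unfolding trace_on_eq[OF B f] sum.reindex[OF inj]
  proof (intro sum.cong refl)
    fix t assume t: "t \<in> ?S"
    then show "((\<lambda>b. fun_vs.representation ?B (f b) b) \<circ> delta) t = f (delta t) t"
      using rep[of "f (delta t)" t] d[OF t] f(2) by auto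
  qed
qed

definition young_grp :: "'a set \<Rightarrow> 'a set \<Rightarrow> 'a set \<Rightarrow> 'a set \<Rightarrow> ('a \<Rightarrow> 'a) set" where
  "young_grp N A B X = {s. s permutes N \<and> s ` A = A \<and> s ` B = B \<and> s ` X = X}"

text \<open>The idempotent of the Young subgroup for the character that is the sign on
  \<open>X\<close> and trivial on \<open>A\<close> and \<open>B\<close>; it projects
  \<open>perm_fns N\<close> onto \<open>young_mod N A B X\<close>.\<close>

definition young_avg :: "'a set \<Rightarrow> 'a set \<Rightarrow> 'a set \<Rightarrow> 'a set \<Rightarrow> (('a \<Rightarrow> 'a) \<Rightarrow> complex) \<Rightarrow> ('a \<Rightarrow> 'a) \<Rightarrow> complex" where
  "young_avg N A B X V t = (\<Sum>s\<in>young_grp N A B X. of_int (sign_on X s) * V (t \<circ> s)) / of_nat (card (young_grp N A B X))"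

lemma finite_young_grp: "finite N \<Longrightarrow> finite (young_grp N A B X)"
  using finite_permutations[of N] by (simp add: young_grp_def)

lemma card_young_grp: "finite N \<Longrightarrow> card (young_grp N A B X) \<noteq> 0"
proof -
  assume N: "finite N"
  have "id \<in> young_grp N A B X" by (simp add: young_grp_def permutes_id)
  then show ?thesis using finite_young_grp[OF N] by auto
qed

lemma young_grp_comp:
  assumes "r \<in> young_grp N A B X" "s \<in> young_grp N A B X"
  shows "r \<circ> s \<in> young_grp N A B X"
proof -
  have r: "r permutes N" "r ` A = A" "r ` B = B" "r ` X = X"
    and s: "s permutes N" "s ` A = A" "s ` B = B" "s ` X = X"
    using assms by (simp_all only: young_grp_def mem_Collect_eq)
  have "(r \<circ> s) ` A = A" "(r \<circ> s) ` B = B" "(r \<circ> s) ` X = X"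
    unfolding comp_image s r by (rule refl)+
  then show ?thesis using permutes_compose[OF s(1) r(1)] by (simp add: young_grp_def)
qed

lemma image_inv_eq: "p permutes N \<Longrightarrow> p ` S = S \<Longrightarrow> inv p ` S = S"
  by (metis image_inv_f_f permutes_inj)

lemma young_grp_inv: "r \<in> young_grp N A B X \<Longrightarrow> inv r \<in> young_grp N A B X"
  using image_inv_eq[of r N A] image_inv_eq[of r N B] image_inv_eq[of r N X]
  by (simp add: young_grp_def permutes_inv)

lemma young_grp_bij: "r \<in> young_grp N A B X \<Longrightarrow> bij_betw r X X"
  by (auto simp: young_grp_def bij_betw_def intro: permutes_inj_on)

lemma sign_on_sq: "sign_on S f * sign_on S f = 1"
  by (simp add: sign_on_def)

lemma young_avg_comp:
  assumes P: "blocks N A B X" and r: "r \<in> young_grp N A B X"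
  shows "young_avg N A B X V (t \<circ> r) = of_int (sign_on X r) * young_avg N A B X V t"
proof -
  let ?Y = "young_grp N A B X"
  have rr: "r \<circ> inv r = id" "inv r \<circ> r = id"
    using r permutes_inv_o[of r N] by (auto simp: young_grp_def)
  have "(\<Sum>s\<in>?Y. of_int (sign_on X s) * V (t \<circ> r \<circ> s)) =
      (\<Sum>s\<in>?Y. of_int (sign_on X r) * (of_int (sign_on X s) * V (t \<circ> s)))"
  proof (rule sum.reindex_bij_witness[of _ "\<lambda>s. inv r \<circ> s" "\<lambda>s. r \<circ> s"])
    fix s assume s: "s \<in> ?Y"
    show "inv r \<circ> (r \<circ> s) = s" "r \<circ> (inv r \<circ> s) = s" using rr by (simp_all add: o_assoc)
    show "r \<circ> s \<in> ?Y" "inv r \<circ> s \<in> ?Y" using r s by (auto intro: young_grp_comp young_grp_inv)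
    have "sign_on X (r \<circ> s) = sign_on X r * sign_on X s"
      using young_grp_bij r s partD[OF P] by (intro sign_on_compose) auto
    then have "sign_on X r * sign_on X (r \<circ> s) = sign_on X s"
      using sign_on_sq[of X r] by (simp add: mult.assoc[symmetric])
    then show "of_int (sign_on X r) * (of_int (sign_on X (r \<circ> s)) * V (t \<circ> (r \<circ> s))) =
        of_int (sign_on X s) * V (t \<circ> r \<circ> s)"
      by (simp add: o_assoc mult.assoc[symmetric] flip: of_int_mult)
  qed
  then show ?thesis by (simp add: young_avg_def sum_distrib_left)
qed

lemma permutes_young_grp:
  assumes P: "blocks N A B X"
  shows "p permutes A \<Longrightarrow> p \<in> young_grp N A B X" "p permutes B \<Longrightarrow> p \<in> young_grp N A B X"
    "p permutes X \<Longrightarrow> p \<in> young_grp N A B X"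
  using partD[OF P] permutes_image[of p] permutes_subset[of p _ N]
    permutes_image_disjoint[of p A] permutes_image_disjoint[of p B] permutes_image_disjoint[of p X]
  by (simp_all add: young_grp_def)

lemma young_avg_young_mod:
  assumes P: "blocks N A B X" and V: "V \<in> perm_fns N"
  shows "young_avg N A B X V \<in> young_mod N A B X"
proof -
  have one: "sign_on X p = 1" if "p permutes S" "S \<inter> X = {}" for p S
  proof -
    have "sign_on X p = sign_on X id"
      using that by (intro sign_on_cong) (auto simp: permutes_def)
    then show ?thesis by simp
  qed
  have "young_avg N A B X V t = 0" if "\<not> t permutes N" for t
  proof -
    have "V (t \<circ> s) = 0" if "s \<in> young_grp N A B X" for s
      using V permutes_comp_iff[of s N t] that \<open>\<not> t permutes N\<close> by (auto simp: perm_fns_def young_grp_def)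
    then show ?thesis by (simp add: young_avg_def)
  qed
  moreover have "eqv False A (young_avg N A B X V)" "eqv False B (young_avg N A B X V)"
    using young_avg_comp[OF P permutes_young_grp(1)[OF P]] young_avg_comp[OF P permutes_young_grp(2)[OF P]]
      one[of _ A] one[of _ B] partD[OF P] by (auto simp: eqv_def twist_def)
  moreover have "eqv True X (young_avg N A B X V)"
    using young_avg_comp[OF P permutes_young_grp(3)[OF P]] sign_on_permutes[of _ X X]
    by (auto simp: eqv_def twist_def)
  ultimately show ?thesis by (auto simp: young_mod_def perm_fns_def)
qed

lemma young_avg_id:
  assumes P: "blocks N A B X" and V: "V \<in> young_mod N A B X"
  shows "young_avg N A B X V = V"
proof
  fix t
  note P' = partD[OF P]
  have "V (t \<circ> s) = of_int (sign_on X s) * V t" if s: "s \<in> young_grp N A B X" for s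
  proof -
    have bij: "bij_betw s A A" "bij_betw s B B" "bij_betw s X X"
      using s by (auto simp: young_grp_def bij_betw_def intro: permutes_inj_on)
    note r = this[THEN permutes_restrict_id]
    have "s = restrict_id s A \<circ> restrict_id s B \<circ> restrict_id s X"
    proof
      fix c
      have sN: "s permutes N" "s ` A = A" "s ` B = B" "s ` X = X"
        using s by (auto simp only: young_grp_def mem_Collect_eq)
      have "s c \<in> A \<longleftrightarrow> c \<in> A" "s c \<in> B \<longleftrightarrow> c \<in> B" "s c \<in> X \<longleftrightarrow> c \<in> X"
        using inj_image_mem_iff[OF permutes_inj[OF sN(1)], of c] sN(2-4) by metis+
      then show "s c = (restrict_id s A \<circ> restrict_id s B \<circ> restrict_id s X) c"
        using P'(8-11) permutes_not_in[OF sN(1), of c] by (auto simp: restrict_id_def)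
    qed
    then have "V (t \<circ> s) = V (t \<circ> restrict_id s A \<circ> restrict_id s B \<circ> restrict_id s X)"
      by (metis o_assoc)
    also have "\<dots> = of_int (sign_on X s) * V t"
      using V eqvD[of False A V, OF _ r(1)] eqvD[of False B V, OF _ r(2)] eqvD[of True X V, OF _ r(3)]
      by (simp add: young_mod_def twist_def sign_on_def)
    finally show ?thesis .
  qed
  then have "(\<Sum>s\<in>young_grp N A B X. of_int (sign_on X s) * V (t \<circ> s)) = (\<Sum>s\<in>young_grp N A B X. V t)"
    using sign_on_sq[of X] by (intro sum.cong refl) (simp add: mult.assoc[symmetric] flip: of_int_mult)
  then show "young_avg N A B X V t = V t"
    using card_young_grp[OF P'(1)] by (simp add: young_avg_def)
qed

lemma lin_young_avg: "lin (young_avg N A B X)"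
proof (rule linI; rule ext)
  fix V W :: "('a \<Rightarrow> 'a) \<Rightarrow> complex" and c :: complex and t
  show "young_avg N A B X (V + W) t = (young_avg N A B X V + young_avg N A B X W) t"
    by (simp add: young_avg_def distrib_left sum.distrib add_divide_distrib)
  show "young_avg N A B X (fun_scale c V) t = fun_scale c (young_avg N A B X V) t"
    by (simp add: young_avg_def fun_scale_def sum_distrib_left mult.left_commute)
qed

definition fixed_sign :: "('a \<Rightarrow> 'a) \<Rightarrow> 'a set \<Rightarrow> 'a set \<Rightarrow> 'a set \<Rightarrow> complex" where
  "fixed_sign g A B X = (if g ` A = A \<and> g ` B = B \<and> g ` X = X then of_int (sign_on X g) else 0)"

definition block_triples :: "'a set \<Rightarrow> nat \<Rightarrow> nat \<Rightarrow> nat \<Rightarrow> ('a set \<times> 'a set \<times> 'a set) set" where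
  "block_triples N a b i = {(A, B, X). blocks N A B X \<and> card A = a \<and> card B = b \<and> card X = i}"

text \<open>The value at \<open>g\<close> of the induced character \<open>h_a h_b e_i\<close>, as a
  sum over the cosets of the Young subgroup fixed by \<open>g\<close>.\<close>

definition signed_fixed :: "('a \<Rightarrow> 'a) \<Rightarrow> 'a set \<Rightarrow> nat \<Rightarrow> nat \<Rightarrow> nat \<Rightarrow> complex" where
  "signed_fixed g N a b i = (\<Sum>(A, B, X)\<in>block_triples N a b i. fixed_sign g A B X)"

lemma finite_block_triples:
  assumes "finite N"
  shows "finite (block_triples N a b i)"
proof (rule finite_subset)
  show "block_triples N a b i \<subseteq> Pow N \<times> Pow N \<times> Pow N" by (auto simp: block_triples_def blocks_def)
  show "finite (Pow N \<times> Pow N \<times> Pow N)" using assms by simp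
qed

lemma sign_on_conj:
  assumes "finite N" "X \<subseteq> N" "t permutes N" "g permutes N" "g ` t ` X = t ` X"
  shows "sign_on X (inv t \<circ> g \<circ> t) = sign_on (t ` X) g"
proof -
  let ?r = "restrict_id g (t ` X)"
  have fin: "finite (t ` X)" using finite_subset[OF assms(2,1)] by simp
  have "bij_betw g (t ` X) (t ` X)"
    using assms by (auto simp: bij_betw_def intro: permutes_inj_on)
  then have r: "permutation ?r" by (intro permutes_imp_permutation[OF fin] permutes_restrict_id)
  have t: "permutation t" by (rule permutes_imp_permutation[OF assms(1,3)])
  have "restrict_id (inv t \<circ> g \<circ> t) X = inv t \<circ> ?r \<circ> t"
    using permutes_inverses(2)[OF assms(3)] inj_image_mem_iff[OF permutes_inj[OF assms(3)]]
    by (auto simp: restrict_id_def fun_eq_iff)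
  then show ?thesis
    using r t by (simp add: sign_on_def sign_compose sign_inverse permutation_compose permutation_inverse)
qed

lemma blocks_bij:
  assumes P: "blocks N A B X" and Q: "blocks N A' B' X'"
    and card: "card A = card A'" "card B = card B'" "card X = card X'"
  shows "\<exists>t. t permutes N \<and> t ` A = A' \<and> t ` B = B' \<and> t ` X = X'"
proof -
  note P' = partD[OF P] and Q' = partD[OF Q]
  obtain f1 f2 f3 where f: "bij_betw f1 A A'" "bij_betw f2 B B'" "bij_betw f3 X X'"
    using finite_same_card_bij P' Q' card by metis
  define t where "t c = (if c \<in> A then f1 c else if c \<in> B then f2 c else if c \<in> X then f3 c else c)" for c
  have im: "t ` A = A'" "t ` B = B'" "t ` X = X'"
  proof -
    have "t ` A = f1 ` A" "t ` B = f2 ` B" "t ` X = f3 ` X"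
      using P'(8-10) by (auto simp: t_def intro!: image_cong)
    then show "t ` A = A'" "t ` B = B'" "t ` X = X'" using f by (simp_all add: bij_betw_def)
  qed
  then have "t ` N = N" using P'(11) Q'(11) by (metis image_Un)
  then have "bij_betw t N N" using P'(1) by (simp add: bij_betw_def eq_card_imp_inj_on)
  then have "t permutes N" using P'(11) by (intro bij_imp_permutes) (auto simp: t_def)
  with im show ?thesis by blast
qed

text \<open>Combining \<open>g\<close> with the projection \<open>young_avg\<close> keeps the trace
  and allows it to be computed in the delta functions of \<open>perm_fns N\<close>. The diagonal
  entry at \<open>t\<close> is nonzero only if \<open>inv t \<circ> g \<circ> t\<close> lies in the
  Young subgroup, that is, if \<open>g\<close> preserves the images of the blocks under
  \<open>t\<close>; each triple of images comes from as many \<open>t\<close> as the subgroup has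
  elements.\<close>

lemma trace_young_mod_eq_signed_fixed:
  assumes P: "blocks N A B X" and g: "g permutes N"
  shows "trace_on (young_mod N A B X) (left_mult g) = signed_fixed g N (card A) (card B) (card X)"
proof -
  note P' = partD[OF P]
  let ?S = "{t. t permutes N}" and ?Y = "young_grp N A B X" and ?P = "young_avg N A B X"
  let ?f = "\<lambda>V. left_mult g (?P V)"
  have linf: "lin ?f"
    by (rule linI) (simp_all add: lin_add[OF lin_young_avg] lin_scale[OF lin_young_avg] lin_add[OF lin_left_mult] lin_scale[OF lin_left_mult])
  have f_young_mod: "?f V \<in> young_mod N A B X" if "V \<in> perm_fns N" for V
    using young_avg_young_mod[OF P that] left_mult_young_mod[OF g] by blast
  have f_fns: "?f ` perm_fns N \<subseteq> perm_fns N" using f_young_mod young_mod_fns[of N A B X] by blast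
  have img: "?P ` perm_fns N = young_mod N A B X"
  proof
    show "young_mod N A B X \<subseteq> ?P ` perm_fns N"
    proof
      fix V assume V: "V \<in> young_mod N A B X"
      then show "V \<in> ?P ` perm_fns N"
        using young_avg_id[OF P V] young_mod_fns[of N A B X] by (intro image_eqI[of _ _ V]) auto
    qed
    show "?P ` perm_fns N \<subseteq> young_mod N A B X" using young_avg_young_mod[OF P] by (rule image_subsetI)
  qed
  have 1: "trace_on (perm_fns N) ?f = trace_on {V \<in> perm_fns N. ?P V = 0} ?f + trace_on (young_mod N A B X) (left_mult g)"
  proof (rule trace_exact[OF fin_dim_perm_fns[OF P'(1)] lin_young_avg img linf _ lin_left_mult])
    show "?f ` perm_fns N \<subseteq> perm_fns N" by (rule f_fns)
    show "?P (?f V) = left_mult g (?P V)" if "V \<in> perm_fns N" for V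
      by (rule young_avg_id[OF P f_young_mod[OF that]])
  qed
  have sub: "fun_vs.subspace {V \<in> perm_fns N. ?P V = 0}"
    using perm_fns_subspace[of N]
    by (auto simp: fun_vs.subspace_def lin_add[OF lin_young_avg] lin_scale[OF lin_young_avg] lin_0[OF lin_young_avg])
  have 2: "trace_on {V \<in> perm_fns N. ?P V = 0} ?f = 0"
    using fin_dim_subset[OF fin_dim_perm_fns[OF P'(1)] _ sub] linf lin_0[OF lin_left_mult]
    by (intro trace_on_eq_0) auto
  have "trace_on (young_mod N A B X) (left_mult g) = (\<Sum>t\<in>?S. ?f (delta t) t)"
    using 1 2 trace_perm_fns[OF P'(1) linf f_fns] by simp
  also have "\<dots> = (\<Sum>t\<in>?S. fixed_sign g (t ` A) (t ` B) (t ` X) / of_nat (card ?Y))"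
  proof (intro sum.cong refl)
    fix t assume "t \<in> ?S"
    then have t: "t permutes N" by simp
    let ?u = "inv t \<circ> g \<circ> t"
    have u: "?u permutes N" using t g by (intro permutes_compose permutes_inv)
    have im: "?u ` S = S \<longleftrightarrow> g ` t ` S = t ` S" for S
    proof -
      have "t ` (?u ` S) = g ` t ` S" using permutes_inverses(1)[OF t] by (simp add: image_image)
      then show ?thesis using inj_image_eq_iff[OF permutes_inj[OF t], of "?u ` S" S] by simp
    qed
    have eq: "inv g \<circ> t \<circ> s = t \<longleftrightarrow> s = ?u" for s
    proof
      assume "inv g \<circ> t \<circ> s = t"
      then have "inv t \<circ> g \<circ> (inv g \<circ> t \<circ> s) = ?u" by (simp only: )
      then show "s = ?u" using permutes_inverses[OF g] permutes_inverses[OF t] by (simp add: fun_eq_iff)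
    qed (use permutes_inverses[OF g] permutes_inverses[OF t] in \<open>simp add: fun_eq_iff\<close>)
    have "?f (delta t) t = (\<Sum>s\<in>?Y. if s = ?u then of_int (sign_on X s) else 0) / of_nat (card ?Y)"
      unfolding left_mult_def young_avg_def delta_def eq by (simp add: if_distrib cong: if_cong)
    also have "(\<Sum>s\<in>?Y. if s = ?u then of_int (sign_on X s) else (0::complex)) =
        (if ?u \<in> ?Y then of_int (sign_on X ?u) else 0)"
      using finite_young_grp[OF P'(1)] by simp
    also have "\<dots> = fixed_sign g (t ` A) (t ` B) (t ` X)"
      using u im sign_on_conj[OF P'(1,7) t g] by (auto simp: young_grp_def fixed_sign_def)
    finally show "?f (delta t) t = fixed_sign g (t ` A) (t ` B) (t ` X) / of_nat (card ?Y)" .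
  qed
  also have "\<dots> = (\<Sum>t\<in>?S. fixed_sign g (t ` A) (t ` B) (t ` X)) / of_nat (card ?Y)"
    by (simp add: sum_divide_distrib)
  also have "(\<Sum>t\<in>?S. fixed_sign g (t ` A) (t ` B) (t ` X)) =
      (\<Sum>p\<in>block_triples N (card A) (card B) (card X). \<Sum>t\<in>{t\<in>?S. (t ` A, t ` B, t ` X) = p}.
        fixed_sign g (t ` A) (t ` B) (t ` X))"
  proof (rule sum.group[symmetric])
    show "finite ?S" by (rule finite_permutations[OF P'(1)])
    show "finite (block_triples N (card A) (card B) (card X))" by (rule finite_block_triples[OF P'(1)])
    show "(\<lambda>t. (t ` A, t ` B, t ` X)) ` ?S \<subseteq> block_triples N (card A) (card B) (card X)"
    proof clarify
      fix t assume t: "t permutes N"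
      have inj: "inj_on t S" for S using t by (rule permutes_inj_on)
      have "t ` A \<union> t ` B \<union> t ` X = N" using permutes_image[OF t] P'(11) by (metis image_Un)
      moreover have "t ` S \<inter> t ` T = t ` (S \<inter> T)" for S T
        using permutes_inj[OF t] by (simp add: image_Int)
      ultimately show "(t ` A, t ` B, t ` X) \<in> block_triples N (card A) (card B) (card X)"
        using P' card_image[OF inj] by (simp add: block_triples_def blocks_def)
    qed
  qed
  also have "\<dots> = (\<Sum>(A', B', X')\<in>block_triples N (card A) (card B) (card X).
      of_nat (card ?Y) * fixed_sign g A' B' X')"
  proof (intro sum.cong refl, clarify)
    fix A' B' X' assume p: "(A', B', X') \<in> block_triples N (card A) (card B) (card X)"
    then obtain t0 where t0: "t0 permutes N" "t0 ` A = A'" "t0 ` B = B'" "t0 ` X = X'"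
      using blocks_bij[OF P, of A' B' X'] by (auto simp: block_triples_def)
    let ?T = "{t \<in> ?S. (t ` A, t ` B, t ` X) = (A', B', X')}"
    have "bij_betw (\<lambda>s. t0 \<circ> s) ?Y ?T"
    proof (rule bij_betwI[where g = "\<lambda>t. inv t0 \<circ> t"])
      have tt: "inv t0 \<circ> t0 = id" "t0 \<circ> inv t0 = id" using permutes_inv_o[OF t0(1)] by auto
      have "t0 \<circ> s \<in> ?T" if s: "s \<in> ?Y" for s
      proof -
        have sN: "s permutes N" "s ` A = A" "s ` B = B" "s ` X = X"
          using s by (simp_all only: young_grp_def mem_Collect_eq)
        have "(t0 \<circ> s) ` A = A'" "(t0 \<circ> s) ` B = B'" "(t0 \<circ> s) ` X = X'"
          unfolding comp_image sN t0 by (rule refl)+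
        then show ?thesis using permutes_compose[OF sN(1) t0(1)] by simp
      qed
      then show "(\<lambda>s. t0 \<circ> s) \<in> ?Y \<rightarrow> ?T" by (rule Pi_I)
      have inv_im: "inv t0 ` A' = A" "inv t0 ` B' = B" "inv t0 ` X' = X"
        using t0 image_inv_f_f[OF permutes_inj[OF t0(1)]] by auto
      have "inv t0 \<circ> t \<in> ?Y" if t: "t \<in> ?T" for t
      proof -
        have tN: "t permutes N" "t ` A = A'" "t ` B = B'" "t ` X = X'" using t by simp_all
        have "(inv t0 \<circ> t) ` A = A" "(inv t0 \<circ> t) ` B = B" "(inv t0 \<circ> t) ` X = X"
          unfolding comp_image tN inv_im by (rule refl)+
        then show ?thesis
          using permutes_compose[OF tN(1) permutes_inv[OF t0(1)]] by (simp add: young_grp_def)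
      qed
      then show "(\<lambda>t. inv t0 \<circ> t) \<in> ?T \<rightarrow> ?Y" by (rule Pi_I)
      show "inv t0 \<circ> (t0 \<circ> s) = s" "t0 \<circ> (inv t0 \<circ> s) = s" for s using tt by (auto simp: o_assoc)
    qed
    then have "card ?T = card ?Y" by (rule bij_betw_same_card[THEN sym])
    moreover have "(\<Sum>t\<in>?T. fixed_sign g (t ` A) (t ` B) (t ` X)) = (\<Sum>t\<in>?T. fixed_sign g A' B' X')"
      by (intro sum.cong refl) auto
    ultimately show "(\<Sum>t\<in>?T. fixed_sign g (t ` A) (t ` B) (t ` X)) = of_nat (card ?Y) * fixed_sign g A' B' X'"
      by simp
  qed
  also have "\<dots> / of_nat (card ?Y) = signed_fixed g N (card A) (card B) (card X)"
    using card_young_grp[OF P'(1), of A B X]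
    by (simp add: signed_fixed_def sum_distrib_left[symmetric] case_prod_unfold)
  finally show ?thesis .
qed

section \<open>Signed counts of invariant sets\<close>

text \<open>Iteration of \<open>trace_young_mod\<close>: a kernel trace is a Young module trace
  minus the kernel trace with one point moved from \<open>X\<close> to \<open>B\<close>.\<close>

lemma trace_koszul_ker_signed_fixed:
  assumes "blocks N A B X" and g: "g permutes N"
  shows "trace_on (koszul_ker N A B X) (left_mult g) =
    (\<Sum>j\<le>card X. (-1) ^ j * signed_fixed g N (card A) (card B + j) (card X - j))"
  using assms(1)
proof (induction "card X" arbitrary: B X)
  case 0
  then have "X = {}" using partD(4)[OF 0(2)] by auto
  then have "koszul_ker N A B X = young_mod N A B X" by (auto simp: koszul_ker_def)
  then show ?case using trace_young_mod_eq_signed_fixed[OF 0(2) g] \<open>X = {}\<close> by simp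
next
  case (Suc i)
  note P' = partD[OF Suc(3)]
  obtain q where q: "q \<in> X" using Suc(2) by fastforce
  have P2: "blocks N A (insert q B) (X - {q})" using Suc(3) q by (auto simp: blocks_def)
  have c: "card (X - {q}) = i" "card (insert q B) = Suc (card B)"
    using q P'(3,4,10) Suc(2) by (simp, subst card_insert_disjoint) auto
  have "trace_on (koszul_ker N A (insert q B) (X - {q})) (left_mult g) =
      (\<Sum>j\<le>i. (-1) ^ j * signed_fixed g N (card A) (card B + Suc j) (i - j))"
    using Suc(1)[of "X - {q}" "insert q B"] P2 c by simp
  then have "trace_on (koszul_ker N A B X) (left_mult g) = signed_fixed g N (card A) (card B) (Suc i) +
      (\<Sum>j\<le>i. (-1) ^ Suc j * signed_fixed g N (card A) (card B + Suc j) (Suc i - Suc j))"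
    using trace_young_mod[OF Suc(3) q g] trace_young_mod_eq_signed_fixed[OF Suc(3) g]
    by (simp add: sum_negf Suc(2)[symmetric])
  then show ?case
    unfolding Suc(2)[symmetric] by (subst sum.atMost_Suc_shift) simp
qed

lemma signed_fixed_commute: "signed_fixed g N a b i = signed_fixed g N b a i"
  unfolding signed_fixed_def
  by (rule sum.reindex_bij_witness[of _ "\<lambda>(A, B, X). (B, A, X)" "\<lambda>(A, B, X). (B, A, X)"])
     (auto simp: block_triples_def blocks_def fixed_sign_def)

definition inv_sets :: "('a \<Rightarrow> 'a) \<Rightarrow> 'a set \<Rightarrow> 'a set set" where
  "inv_sets g C = {I. I \<subseteq> C \<and> g ` I = I}"

lemma finite_inv_sets: "finite C \<Longrightarrow> finite (inv_sets g C)"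
  by (rule finite_subset[of _ "Pow C"]) (auto simp: inv_sets_def)

text \<open>The first block has a fixed size, so it is the complement of an invariant set
  \<open>C\<close> of size \<open>K\<close>. The last block is an arbitrary invariant subset
  \<open>I\<close> of \<open>C\<close>, and \<open>l\<close> is its size.\<close>

lemma signed_fixed_sum:
  assumes N: "finite N" and g: "g permutes N" and K: "K \<le> card N"
  shows "(\<Sum>l\<le>K. w l * signed_fixed g N (card N - K) (K - l) l) =
    (\<Sum>C | C \<in> inv_sets g N \<and> card C = K. \<Sum>I\<in>inv_sets g C. w (card I) * of_int (sign_on I g))"
proof -
  let ?st = "\<lambda>(A, B, X). g ` A = A \<and> g ` B = B \<and> g ` X = X"
  let ?Q = "\<lambda>l. {p \<in> block_triples N (card N - K) (K - l) l. ?st p}"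
  let ?D = "{C. C \<in> inv_sets g N \<and> card C = K}"
  have fin: "finite (?Q l)" for l using finite_block_triples[OF N] by simp
  have finC: "finite (inv_sets g C)" if "C \<in> ?D" for C
    using that N finite_inv_sets finite_subset by (auto simp: inv_sets_def)
  have "signed_fixed g N (card N - K) (K - l) l = (\<Sum>(A, B, X)\<in>?Q l. of_int (sign_on X g))" for l
  proof -
    have "(case p of (A, B, X) \<Rightarrow> fixed_sign g A B X) =
        (if ?st p then case p of (A, B, X) \<Rightarrow> of_int (sign_on X g) else 0)" for p
      by (cases p) (simp add: fixed_sign_def)
    then show ?thesis
      unfolding signed_fixed_def sum.inter_filter[OF finite_block_triples[OF N]] by simp
  qed
  then have "(\<Sum>l\<le>K. w l * signed_fixed g N (card N - K) (K - l) l) =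
      (\<Sum>l\<le>K. \<Sum>(A, B, X)\<in>?Q l. w l * of_int (sign_on X g))"
    by (simp add: sum_distrib_left case_prod_unfold)
  also have "\<dots> = (\<Sum>(l, A, B, X)\<in>Sigma {..K} ?Q. w l * of_int (sign_on X g))"
    using fin by (subst sum.Sigma) (auto simp: case_prod_unfold)
  also have "\<dots> = (\<Sum>(C, I)\<in>Sigma ?D (inv_sets g). w (card I) * of_int (sign_on I g))"
  proof (rule sum.reindex_bij_witness[of _ "\<lambda>(C, I). (card I, N - C, C - I, I)" "\<lambda>(l, A, B, X). (B \<union> X, X)"])
    fix p assume "p \<in> Sigma {..K} ?Q"
    then obtain l A B X where p: "p = (l, A, B, X)" "blocks N A B X" "l \<le> K" "card B = K - l" "card X = l"
      "g ` A = A" "g ` B = B" "g ` X = X"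
      by (auto simp: block_triples_def)
    note P' = partD[OF p(2)]
    have "card (B \<union> X) = K" using P' p by (subst card_Un_disjoint) auto
    then show "(case p of (l, A, B, X) \<Rightarrow> (B \<union> X, X)) \<in> Sigma ?D (inv_sets g)"
      using p P' by (auto simp: inv_sets_def image_Un)
    show "(case case p of (l, A, B, X) \<Rightarrow> (B \<union> X, X) of (C, I) \<Rightarrow> (card I, N - C, C - I, I)) = p"
      using p P' by auto
    show "(case case p of (l, A, B, X) \<Rightarrow> (B \<union> X, X) of (C, I) \<Rightarrow> w (card I) * of_int (sign_on I g)) =
        (case p of (l, A, B, X) \<Rightarrow> w l * of_int (sign_on X g))"
      using p by simp
  next
    fix p assume "p \<in> Sigma ?D (inv_sets g)"
    then obtain C I where p: "p = (C, I)" "C \<subseteq> N" "g ` C = C" "card C = K" "I \<subseteq> C" "g ` I = I"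
      by (auto simp: inv_sets_def)
    have fin: "finite C" "finite I" using p N finite_subset by metis+
    have diff: "g ` (S - T) = g ` S - g ` T" for S T
      using permutes_inj[OF g] by (simp add: image_set_diff)
    have "blocks N (N - C) (C - I) I" using p N by (auto simp: blocks_def)
    moreover have "card (N - C) = card N - K" "card (C - I) = K - card I" "card I \<le> K"
      using p fin by (auto simp: card_Diff_subset intro: card_mono)
    ultimately show "(case p of (C, I) \<Rightarrow> (card I, N - C, C - I, I)) \<in> Sigma {..K} ?Q"
      using p permutes_image[OF g] by (auto simp: block_triples_def diff simp del: Diff_iff)
    show "(case case p of (C, I) \<Rightarrow> (card I, N - C, C - I, I) of (l, A, B, X) \<Rightarrow> (B \<union> X, X)) = p"
      using p by auto
  qed
  also have "\<dots> = (\<Sum>C\<in>?D. \<Sum>I\<in>inv_sets g C. w (card I) * of_int (sign_on I g))"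
    using N finC finite_inv_sets[OF N, of g] by (subst sum.Sigma) auto
  finally show ?thesis .
qed

text \<open>With no cells in the two rows the Koszul complex is exact, so its Euler characteristic vanishes.\<close>

lemma alternating_inv_sets:
  assumes C: "finite C" "C \<noteq> {}" and g: "inj g" "g ` C = C"
  shows "(\<Sum>I\<in>inv_sets g C. (-1) ^ card I * (of_int (sign_on I g) :: complex)) = 0"
proof -
  \<comment> \<open>The trace formula needs a permutation of \<open>C\<close> itself, so
    \<open>g\<close> is replaced by the identity outside \<open>C\<close>; invariant subsets and
    their signs stay the same.\<close>
  define h where "h = restrict_id g C"
  have h: "h permutes C" unfolding h_def
    using g by (intro permutes_restrict_id) (auto simp: bij_betw_def intro: inj_on_subset)
  have eq: "h c = g c" if "c \<in> C" for c using that by (simp add: h_def)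
  have sets: "inv_sets h C = inv_sets g C"
  proof -
    have "h ` I = g ` I" if "I \<subseteq> C" for I using that eq by (intro image_cong) auto
    then show ?thesis unfolding inv_sets_def by (intro Collect_cong conj_cong refl) simp
  qed
  have P: "blocks C {} {} C" using C by (simp add: blocks_def)
  \<comment> \<open>A coset sum with empty block is the identity, so the kernel condition at one
    point of \<open>C\<close> forces \<open>V = 0\<close>.\<close>
  have "V = 0" if "V \<in> koszul_ker C {} {} C" for V
  proof
    fix t
    obtain x where "x \<in> C" using C by auto
    then have "coset_sum False x {} V = 0" using that by (simp add: koszul_ker_def)
    then have "coset_sum False x {} V t = 0" by simp
    then show "V t = 0 t" by (simp add: coset_sum_split)
  qed
  moreover have "0 \<in> koszul_ker C {} {} C" using koszul_ker_subspace fun_vs.subspace_0 by blast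
  ultimately have "koszul_ker C {} {} C = {0}" by blast
  then have "0 = (\<Sum>j\<le>card C. (-1) ^ j * signed_fixed h C 0 j (card C - j))"
    using trace_koszul_ker_signed_fixed[OF P h] trace_on_0[OF lin_left_mult, of h] by simp
  also have "\<dots> = (\<Sum>l\<le>card C. (-1) ^ (card C - l) * signed_fixed h C 0 (card C - l) l)"
    by (rule sum.reindex_bij_witness[of _ "\<lambda>l. card C - l" "\<lambda>l. card C - l"]) auto
  also have "\<dots> = (-1) ^ card C * (\<Sum>l\<le>card C. (-1) ^ l * signed_fixed h C (card C - card C) (card C - l) l)"
    unfolding sum_distrib_left
    by (intro sum.cong refl) (simp add: minus_one_power_iff)
  also have "(\<Sum>l\<le>card C. (-1) ^ l * signed_fixed h C (card C - card C) (card C - l) l) =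
      (\<Sum>D | D \<in> inv_sets h C \<and> card D = card C. \<Sum>I\<in>inv_sets h D. (-1) ^ card I * of_int (sign_on I h))"
    by (rule signed_fixed_sum[OF C(1) h]) simp
  also have "{D. D \<in> inv_sets h C \<and> card D = card C} = {C}"
    using C(1) permutes_image[OF h] card_subset_eq[OF C(1)] by (auto simp: inv_sets_def)
  finally have "(\<Sum>I\<in>inv_sets h C. (-1) ^ card I * (of_int (sign_on I h) :: complex)) = 0"
    by (simp add: minus_one_power_iff split: if_splits)
  moreover have "sign_on I h = sign_on I g" if "I \<in> inv_sets g C" for I
    using that eq by (intro sign_on_cong) (auto simp: inv_sets_def)
  ultimately show ?thesis by (simp add: sets)
qed

section \<open>Weights that single out the orbits\<close>

lemma orbit_inv_set:
  assumes "g permutes N" "finite N"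
  shows "g ` orbit g x = orbit g x"
proof (rule endo_inj_surj)
  have "permutation g" using assms permutation_permutes by blast
  then show "finite (orbit g x)" by (intro finite_orbit permutation_self_in_orbit)
  show "g ` orbit g x \<subseteq> orbit g x" by (auto intro: orbit.step)
  show "inj_on g (orbit g x)" using assms by (intro permutes_inj_on)
qed

lemma orbit_subset_inv_set:
  assumes "g ` I = I" "x \<in> I"
  shows "orbit g x \<subseteq> I"
proof
  fix y assume "y \<in> orbit g x"
  then show "y \<in> I" using assms by induct auto
qed

text \<open>The factor \<open>card C - card I\<close> counts the points \<open>x\<close> of
  \<open>C\<close> outside \<open>I\<close>. For fixed \<open>x\<close>, the invariant sets avoiding
  \<open>x\<close> are those inside \<open>C - orbit g x\<close>, and their alternating sum is zero
  unless this difference is empty, that is, unless \<open>C\<close> is the orbit of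
  \<open>x\<close>.\<close>

lemma weighted_inv_sets:
  assumes g: "g permutes N" and N: "finite N" and C: "C \<in> inv_sets g N"
  shows "(\<Sum>I\<in>inv_sets g C. (-1) ^ card I * of_nat (card C - card I) * (of_int (sign_on I g) :: complex)) =
    (if C \<in> orbit g ` N then of_nat (card C) else 0)"
proof -
  have perm: "permutation g" using g N permutation_permutes by blast
  have self: "x \<in> orbit g x" for x by (rule permutation_self_in_orbit[OF perm])
  have orb_eq: "orbit g y = orbit g x" if "y \<in> orbit g x" for x y
    using orbit_cyclic_eq3[OF cyclic_on_orbit'[OF perm] that] .
  have CN: "C \<subseteq> N" "g ` C = C" using C by (auto simp: inv_sets_def)
  have finC: "finite C" using CN N finite_subset by blast
  let ?e = "\<lambda>I. (-1) ^ card I * (of_int (sign_on I g) :: complex)"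
  have "(\<Sum>I\<in>inv_sets g C. (-1) ^ card I * of_nat (card C - card I) * of_int (sign_on I g)) =
      (\<Sum>I\<in>inv_sets g C. \<Sum>x\<in>C. if x \<in> I then 0 else ?e I)"
  proof (intro sum.cong refl)
    fix I assume I: "I \<in> inv_sets g C"
    then have "I \<subseteq> C" "finite I" using finC finite_subset by (auto simp: inv_sets_def)
    have "(\<Sum>x\<in>C. if x \<in> I then 0 else ?e I) = (\<Sum>x\<in>C - I. ?e I)"
      using finC by (intro sum.mono_neutral_cong_right) auto
    then show "(-1) ^ card I * of_nat (card C - card I) * of_int (sign_on I g) =
        (\<Sum>x\<in>C. if x \<in> I then 0 else ?e I)"
      using \<open>I \<subseteq> C\<close> \<open>finite I\<close> by (simp add: card_Diff_subset)
  qed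
  also have "\<dots> = (\<Sum>x\<in>C. \<Sum>I\<in>inv_sets g C. if x \<in> I then 0 else ?e I)" by (rule sum.swap)
  also have "\<dots> = (\<Sum>x\<in>C. if orbit g x = C then 1 else 0)"
  proof (intro sum.cong refl)
    fix x assume x: "x \<in> C"
    let ?C = "C - orbit g x"
    have orbC: "orbit g x \<subseteq> C" by (rule orbit_subset_inv_set[OF CN(2) x])
    have "g ` ?C = ?C"
      using CN orbit_inv_set[OF g N] permutes_inj[OF g] by (simp add: image_set_diff)
    have sets: "{I \<in> inv_sets g C. x \<notin> I} = inv_sets g ?C"
    proof -
      have "I \<inter> orbit g x = {}" if I: "g ` I = I" "x \<notin> I" for I
      proof (rule ccontr)
        assume "I \<inter> orbit g x \<noteq> {}"
        then obtain y where y: "y \<in> I" "y \<in> orbit g x" by auto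
        have "x \<in> orbit g y" using orb_eq[OF y(2)] self by simp
        then show False using orbit_subset_inv_set[OF I(1) y(1)] I(2) by auto
      qed
      then show ?thesis using self by (auto simp: inv_sets_def)
    qed
    have "(\<Sum>I\<in>inv_sets g C. if x \<in> I then 0 else ?e I) = (\<Sum>I\<in>inv_sets g ?C. ?e I)"
      unfolding sets[symmetric] using finite_inv_sets[OF finC]
      by (intro sum.mono_neutral_cong_right) auto
    also have "\<dots> = (if orbit g x = C then 1 else 0)"
    proof (cases "?C = {}")
      case True
      then have "inv_sets g ?C = {{}}" by (auto simp: inv_sets_def)
      moreover have "sign_on {} g = 1"
        using sign_on_cong[of "{}" "{}" g id] by simp
      ultimately show ?thesis using True orbC by auto
    next
      case False
      then show ?thesis
        using alternating_inv_sets[OF _ False permutes_inj[OF g] \<open>g ` ?C = ?C\<close>] finC by auto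
    qed
    finally show "(\<Sum>I\<in>inv_sets g C. if x \<in> I then 0 else ?e I) = (if orbit g x = C then 1 else 0)" .
  qed
  also have "\<dots> = (if C \<in> orbit g ` N then of_nat (card C) else 0)"
  proof (cases "C \<in> orbit g ` N")
    case True
    then have "orbit g x = C" if "x \<in> C" for x using that orb_eq by auto
    then show ?thesis using True by simp
  next
    case False
    then have "orbit g x \<noteq> C" if "x \<in> C" for x using that CN by auto
    then show ?thesis using False by simp
  qed
  finally show ?thesis .
qed

text \<open>The function \<open>g(a, b, i)\<close> of the overview: the trace on
  \<open>koszul_ker\<close> for blocks of sizes \<open>a\<close>, \<open>b\<close> and
  \<open>i\<close>.\<close>

definition ker_trace :: "('a \<Rightarrow> 'a) \<Rightarrow> 'a set \<Rightarrow> nat \<Rightarrow> nat \<Rightarrow> nat \<Rightarrow> complex" where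
  "ker_trace g N a b i = (\<Sum>j\<le>i. (-1) ^ j * signed_fixed g N a (b + j) (i - j))"

lemma trace_hw_space:
  assumes P: "blocks N A B X" and g: "g permutes N" and B: "B \<noteq> {}" "card B \<le> card A"
  shows "trace_on (hw_space N A B X) (left_mult g) =
    ker_trace g N (card A) (card B) (card X) - ker_trace g N (card B - 1) (card A + 1) (card X)"
proof -
  note P' = partD[OF P]
  obtain r where r: "r \<in> B" using B by auto
  have "r \<notin> A" using r P' by auto
  then have c: "card (B - {r}) = card B - 1" "card (insert r A) = card A + 1" using r P' by auto
  show ?thesis
    using trace_koszul_ker[OF P r B(2) g] trace_koszul_ker_signed_fixed[OF P g] trace_koszul_ker_signed_fixed[OF blocks_swap[OF P r] g] c
    by (simp add: ker_trace_def)
qed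

text \<open>The summand depends only on \<open>l = i - j\<close>, and each \<open>l\<close> occurs
  for \<open>k - l\<close> values of \<open>i\<close>. This multiplicity is the weight in
  \<open>weighted_inv_sets\<close> for \<open>card C = k\<close>, so just the orbits of size
  \<open>k\<close> survive, each contributing \<open>k\<close>.\<close>

lemma cycles_formula:
  assumes g: "g permutes N" and N: "finite N" and k: "k \<le> card N"
  shows "(\<Sum>i<k. (-1) ^ i * ker_trace g N (card N - k) (k - i) i) =
    of_nat k * of_nat (card {C \<in> orbit g ` N. card C = k})"
proof -
  let ?m = "card N - k"
  define f where "f l = (-1) ^ l * signed_fixed g N ?m (k - l) l" for l
  have rev: "(\<Sum>j\<le>i. h (i - j)) = (\<Sum>l\<le>i. h l)" for h :: "nat \<Rightarrow> complex" and i
    by (rule sum.reindex_bij_witness[of _ "\<lambda>l. i - l" "\<lambda>l. i - l"]) auto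
  have "(\<Sum>i<k. (-1) ^ i * ker_trace g N ?m (k - i) i) = (\<Sum>i<k. \<Sum>j\<le>i. f (i - j))"
  proof (intro sum.cong refl)
    fix i assume i: "i \<in> {..<k}"
    have "(-1) ^ i * ((-1) ^ j * signed_fixed g N ?m (k - i + j) (i - j)) = f (i - j)" if "j \<le> i" for j
    proof -
      have "k - i + j = k - (i - j)" using i that by auto
      moreover have "(-1) ^ i * (-1) ^ j = ((-1) ^ (i - j) :: complex)"
        using that by (simp add: minus_one_power_iff)
      ultimately show ?thesis by (simp add: f_def mult.assoc[symmetric])
    qed
    then show "(-1) ^ i * ker_trace g N ?m (k - i) i = (\<Sum>j\<le>i. f (i - j))"
      by (simp add: ker_trace_def sum_distrib_left)
  qed
  also have "\<dots> = (\<Sum>i<k. \<Sum>l\<le>i. f l)" by (simp only: rev)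
  also have "\<dots> = (\<Sum>l\<le>k. of_nat (k - l) * f l)"
  proof -
    have "(\<Sum>i<K. \<Sum>l\<le>i. f l) = (\<Sum>l\<le>K. of_nat (K - l) * f l)" for K
    proof (induction K)
      case (Suc K)
      have "(\<Sum>l\<le>Suc K. of_nat (Suc K - l) * f l) = (\<Sum>l\<le>K. of_nat (Suc K - l) * f l)" by simp
      also have "\<dots> = (\<Sum>l\<le>K. of_nat (K - l) * f l + f l)"
        by (intro sum.cong refl) (simp add: Suc_diff_le algebra_simps del: of_nat_diff)
      finally have "(\<Sum>l\<le>Suc K. of_nat (Suc K - l) * f l) = (\<Sum>l\<le>K. of_nat (K - l) * f l + f l)" .
      then show ?case using Suc by (simp add: sum.distrib)
    qed simp
    then show ?thesis .
  qed
  also have "\<dots> = (\<Sum>l\<le>k. ((-1) ^ l * of_nat (k - l)) * signed_fixed g N ?m (k - l) l)"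
    by (simp add: f_def mult_ac)
  also have "\<dots> = (\<Sum>C | C \<in> inv_sets g N \<and> card C = k. \<Sum>I\<in>inv_sets g C.
      (-1) ^ card I * of_nat (k - card I) * of_int (sign_on I g))"
    by (rule signed_fixed_sum[OF N g k])
  also have "\<dots> = (\<Sum>C | C \<in> inv_sets g N \<and> card C = k. if C \<in> orbit g ` N then of_nat k else 0)"
    using weighted_inv_sets[OF g N] by (intro sum.cong refl) auto
  also have "\<dots> = (\<Sum>C\<in>{C \<in> orbit g ` N. card C = k}. of_nat k)"
  proof (intro sum.mono_neutral_cong_right)
    show "finite {C. C \<in> inv_sets g N \<and> card C = k}" using finite_inv_sets[OF N] by simp
    show "{C \<in> orbit g ` N. card C = k} \<subseteq> {C. C \<in> inv_sets g N \<and> card C = k}"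
      using orbit_inv_set[OF g N] permutes_orbit_subset[OF g] by (auto simp: inv_sets_def)
  qed auto
  finally show ?thesis by (simp add: mult.commute)
qed

text \<open>After exchanging the two symmetric blocks and grouping by \<open>j\<close>, the sum over
  \<open>l = i - j\<close> is an alternating sum over the invariant subsets of invariant sets of
  size \<open>k - 1 - j\<close>. It vanishes for nonempty sets; \<open>j = k - 1\<close> contributes
  1 from the empty set.\<close>

lemma trivial_formula:
  assumes g: "g permutes N" and N: "finite N" and k: "1 \<le> k" "k \<le> card N"
  shows "(\<Sum>i<k. (-1) ^ i * ker_trace g N (k - i - 1) (card N - k + 1) i) = 1"
proof -
  let ?m = "card N - k"
  define f where "f j l = (-1) ^ l * signed_fixed g N (?m + 1 + j) (k - 1 - j - l) l" for j l
  have zero: "(\<Sum>l\<le>K. (-1) ^ l * signed_fixed g N (card N - K) (K - l) l) = (if K = 0 then 1 else 0)"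
    if K: "K \<le> card N" for K
  proof -
    have "(\<Sum>l\<le>K. (-1) ^ l * signed_fixed g N (card N - K) (K - l) l) =
        (\<Sum>C | C \<in> inv_sets g N \<and> card C = K. \<Sum>I\<in>inv_sets g C. (-1) ^ card I * of_int (sign_on I g))"
      by (rule signed_fixed_sum[OF N g K])
    also have "\<dots> = (if K = 0 then 1 else 0)"
    proof (cases "K = 0")
      case True
      have "card C = 0 \<longleftrightarrow> C = {}" if "C \<subseteq> N" for C
        using finite_subset[OF that N] by simp
      then have "{C. C \<in> inv_sets g N \<and> card C = K} = {C. C = {}}"
        unfolding inv_sets_def True by (intro Collect_cong) auto
      moreover have "inv_sets g {} = {{}}" by (auto simp: inv_sets_def)
      moreover have "sign_on {} g = 1" using sign_on_cong[of "{}" "{}" g id] by simp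
      ultimately show ?thesis using True by simp
    next
      case False
      have "(\<Sum>I\<in>inv_sets g C. (-1) ^ card I * (of_int (sign_on I g) :: complex)) = 0"
        if "C \<in> inv_sets g N" "card C = K" for C
        using that False finite_subset[OF _ N, of C] permutes_inj[OF g]
        by (intro alternating_inv_sets) (auto simp: inv_sets_def)
      then show ?thesis using False by simp
    qed
    finally show ?thesis .
  qed
  have "(\<Sum>i<k. (-1) ^ i * ker_trace g N (k - i - 1) (?m + 1) i) = (\<Sum>i<k. \<Sum>j\<le>i. f j (i - j))"
  proof (intro sum.cong refl)
    fix i assume i: "i \<in> {..<k}"
    have "(-1) ^ i * ((-1) ^ j * signed_fixed g N (k - i - 1) (?m + 1 + j) (i - j)) = f j (i - j)" if "j \<le> i" for j
    proof -
      have "k - i - 1 = k - 1 - j - (i - j)" using i that by auto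
      moreover have "(-1) ^ i * (-1) ^ j = ((-1) ^ (i - j) :: complex)"
        using that by (simp add: minus_one_power_iff)
      ultimately show ?thesis
        using signed_fixed_commute[of g N "k - i - 1" "?m + 1 + j" "i - j"]
        by (simp add: f_def mult.assoc[symmetric])
    qed
    then show "(-1) ^ i * ker_trace g N (k - i - 1) (?m + 1) i = (\<Sum>j\<le>i. f j (i - j))"
      by (simp add: ker_trace_def sum_distrib_left)
  qed
  also have "\<dots> = (\<Sum>(j, l)\<in>{(j, l). j + l < k}. f j l)"
    by (rule sum.triangle_reindex[symmetric])
  also have "{(j, l). j + l < k} = Sigma {..<k} (\<lambda>j. {..k - 1 - j})" by auto
  also have "(\<Sum>(j, l)\<in>Sigma {..<k} (\<lambda>j. {..k - 1 - j}). f j l) = (\<Sum>j<k. \<Sum>l\<le>k - 1 - j. f j l)"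
    by (rule sum.Sigma[symmetric]) auto
  also have "\<dots> = (\<Sum>j<k. if j = k - 1 then 1 else 0)"
  proof (intro sum.cong refl)
    fix j assume j: "j \<in> {..<k}"
    have "card N - (k - 1 - j) = ?m + 1 + j" using j k by auto
    then show "(\<Sum>l\<le>k - 1 - j. f j l) = (if j = k - 1 then 1 else 0)"
      using zero[of "k - 1 - j"] j k by (auto simp: f_def)
  qed
  also have "\<dots> = 1" using k by simp
  finally show ?thesis .
qed

section \<open>Specht modules of near-hook shape\<close>

lemma sum_fun_apply: "(\<Sum>a\<in>S. f a) x = (\<Sum>a\<in>S. f a x)"
  by (induction S rule: infinite_finite_induct) auto

lemma lin_perm_left_mult: "lin (perm_act g)"
  by (rule linI) (auto simp: perm_act_def fun_scale_def)

text \<open>A column not met by \<open>B\<close> is a single cell of \<open>A\<close>, so preserving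
  that column means fixing its cell.\<close>

lemma (in near_hook) colperms_eq:
  "colperms (col ` B) = {s. s permutes N \<and> (\<forall>j. s ` cells {j} = cells {j})}"
proof (intro equalityI subsetI)
  fix s assume s: "s \<in> colperms (col ` B)"
  have sN: "s permutes N" by (rule colperms_perm[OF s])
  have "s ` cells {j} = cells {j}" for j
  proof (rule endo_inj_surj[OF finite_cells])
    show "s ` cells {j} \<subseteq> cells {j}"
      using s permutes_in_image[OF sN] by (auto simp: cells_def colperms_def)
  qed (rule permutes_inj_on[OF sN])
  then show "s \<in> {s. s permutes N \<and> (\<forall>j. s ` cells {j} = cells {j})}" using sN by simp
next
  fix s assume "s \<in> {s. s permutes N \<and> (\<forall>j. s ` cells {j} = cells {j})}"
  then have s: "s permutes N" "\<And>j. s ` cells {j} = cells {j}" by simp_all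
  have colN: "col (s c) = col c" if "c \<in> N" for c
  proof -
    have "c \<in> cells {col c}" using that by (simp add: cells_def)
    then have "s c \<in> cells {col c}" using s(2)[of "col c"] by blast
    then show ?thesis by (simp add: cells_def)
  qed
  have col: "col (s c) = col c" for c
    using colN permutes_not_in[OF s(1)] by (cases "c \<in> N") auto
  have "s c = c" if c: "c \<notin> cells (col ` B)" for c
  proof (cases "c \<in> N")
    case True
    have "s c \<in> N" using True permutes_in_image[OF s(1)] by simp
    then have "c \<in> A" "s c \<in> A" using c True col A_if_col by (auto simp: cells_def)
    then show ?thesis using colA col by (auto dest: inj_onD)
  qed (use permutes_not_in[OF s(1)] in simp)
  then have "s permutes cells (col ` B)" by (intro permutes_superset[OF s(1)]) auto
  then show "s \<in> colperms (col ` B)" using col by (simp add: colperms_def)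
qed

lemma polytabloid_apply:
  "polytabloid \<rho> t T = (\<Sum>p\<in>column_stabilizer \<rho> t. of_int (sign p) * of_bool (T = tabloid_of \<rho> (p \<circ> t)))"
  unfolding polytabloid_def sum_fun_apply fun_scale_def tabloid_vec_def
  by (intro sum.cong refl) simp

lemma polytabloid_cong:
  assumes "\<And>c. c \<in> young_diagram \<rho> \<Longrightarrow> t c = u c"
  shows "polytabloid \<rho> t = polytabloid \<rho> u"
proof -
  have "row_set \<rho> (p \<circ> t) = row_set \<rho> (p \<circ> u)" for p :: "nat \<Rightarrow> nat"
    using assms by (force simp: row_set_def fun_eq_iff)
  moreover have "column_set \<rho> t = column_set \<rho> u"
    using assms by (force simp: column_set_def fun_eq_iff)
  ultimately show ?thesis
    unfolding polytabloid_def column_stabilizer_def tabloid_of_def by simp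
qed

locale near_hook_shape =
  fixes a b i :: nat
  assumes b_pos: "1 \<le> b" and ba: "b \<le> a"
begin

definition "shape = [a, b] @ replicate i 1"
definition "cellsA = {1..a}"
definition "cellsB = {a + 1..a + b}"
definition "cellsX = {a + b + 1..a + b + i}"
definition "cellsN = {1..a + b + i}"

text \<open>Cells are numbered in reading order from 1, so that positions and entries form the same
  set. Rows count from 0, hence the first one-cell row is row 2 and receives the number
  \<open>a + b + 1\<close>.\<close>

definition cell_index :: "nat \<times> nat \<Rightarrow> nat" where
  "cell_index = (\<lambda>(r, c). if r = 0 then c + 1 else if r = 1 then a + c + 1 else a + b + r - 1)"

definition index_cell :: "nat \<Rightarrow> nat \<times> nat" where
  "index_cell x = (if x \<le> a then (0, x - 1) else if x \<le> a + b then (1, x - a - 1) else (x + 1 - a - b, 0))"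

definition column :: "nat \<Rightarrow> nat" where "column x = snd (index_cell x)"

lemma sum_shape: "sum_list shape = a + b + i"
  by (simp add: shape_def sum_list_replicate)

lemma diagram: "young_diagram shape = index_cell ` cellsN"
proof (intro equalityI subsetI)
  fix x assume "x \<in> young_diagram shape"
  then obtain r c where x: "x = (r, c)" "r < i + 2" "c < shape ! r"
    by (auto simp: young_diagram_def shape_def)
  consider "r = 0" | "r = 1" | l where "r = l + 2" by (metis One_nat_def add_2_eq_Suc' not0_implies_Suc)
  then show "x \<in> index_cell ` cellsN"
  proof cases
    case 1
    then show ?thesis using x by (intro image_eqI[of _ _ "c + 1"]) (auto simp: index_cell_def cellsN_def shape_def)
  next
    case 2
    then show ?thesis using x by (intro image_eqI[of _ _ "a + c + 1"]) (auto simp: index_cell_def cellsN_def shape_def)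
  next
    case 3
    then have "c = 0" using x by (auto simp: shape_def)
    then show ?thesis using x 3
      by (intro image_eqI[of _ _ "a + b + l + 1"]) (auto simp: index_cell_def cellsN_def)
  qed
next
  fix x assume "x \<in> index_cell ` cellsN"
  then obtain y where y: "x = index_cell y" "1 \<le> y" "y \<le> a + b + i" by (auto simp: cellsN_def)
  consider "y \<le> a" | "a < y" "y \<le> a + b" | l where "y = a + b + l + 1" "l < i"
  proof -
    assume h: "y \<le> a \<Longrightarrow> thesis" "a < y \<Longrightarrow> y \<le> a + b \<Longrightarrow> thesis"
      "\<And>l. y = a + b + l + 1 \<Longrightarrow> l < i \<Longrightarrow> thesis"
    show thesis
      using h(1,2) h(3)[of "y - (a + b + 1)"] y by (cases "y \<le> a"; cases "y \<le> a + b") auto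
  qed
  then show "x \<in> young_diagram shape"
    by cases (use y in \<open>auto simp: young_diagram_def shape_def index_cell_def\<close>)
qed

lemma cell_index_index_cell: "x \<in> cellsN \<Longrightarrow> cell_index (index_cell x) = x"
  by (auto simp: cell_index_def index_cell_def cellsN_def)

lemma inj_index_cell: "inj_on index_cell cellsN"
  by (metis inj_onI cell_index_index_cell)

lemma near_hook: "near_hook cellsN cellsA cellsB cellsX column 0"
proof
  show "blocks cellsN cellsA cellsB cellsX"
    by (auto simp: blocks_def cellsN_def cellsA_def cellsB_def cellsX_def)
  show "inj_on column cellsA" by (rule inj_onI) (auto simp: column_def index_cell_def cellsA_def)
  show "inj_on column cellsB" by (rule inj_onI) (auto simp: column_def index_cell_def cellsB_def)
  have "column ` cellsB \<subseteq> {..<b}" by (auto simp: column_def index_cell_def cellsB_def)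
  moreover have "{..<b} \<subseteq> column ` cellsA"
  proof
    fix j assume "j \<in> {..<b}"
    then show "j \<in> column ` cellsA"
      using ba by (intro image_eqI[of _ _ "j + 1"]) (auto simp: column_def index_cell_def cellsA_def)
  qed
  ultimately show "column ` cellsB \<subseteq> column ` cellsA" by blast
  show "column x = 0" if "x \<in> cellsX" for x using that by (auto simp: column_def index_cell_def cellsX_def)
  show "0 \<in> column ` cellsB"
    using b_pos by (intro image_eqI[of _ _ "a + 1"]) (auto simp: column_def index_cell_def cellsB_def)
qed

sublocale near_hook cellsN cellsA cellsB cellsX column 0
  by (rule near_hook)

section \<open>The dictionary between tableaux and permutations\<close>

lemma row_set_cell_index: "row_set shape (t \<circ> cell_index) r = t ` {x \<in> cellsN. fst (index_cell x) = r}"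
proof (intro equalityI subsetI)
  fix e assume "e \<in> row_set shape (t \<circ> cell_index) r"
  then obtain j x where x: "x \<in> cellsN" "(r, j) = index_cell x" "e = t (cell_index (r, j))"
    by (auto simp: row_set_def diagram)
  then show "e \<in> t ` {x \<in> cellsN. fst (index_cell x) = r}"
    using cell_index_index_cell[OF x(1)] by (intro image_eqI[of _ _ x]) (simp_all, metis fst_conv)
next
  fix e assume "e \<in> t ` {x \<in> cellsN. fst (index_cell x) = r}"
  then obtain x where x: "x \<in> cellsN" "index_cell x = (r, snd (index_cell x))" "e = t x" by fastforce
  then have "(r, snd (index_cell x)) \<in> index_cell ` cellsN" "e = (t \<circ> cell_index) (r, snd (index_cell x))"
    using cell_index_index_cell[OF x(1)] by (simp_all add: image_iff) (metis x(2))+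
  then show "e \<in> row_set shape (t \<circ> cell_index) r" unfolding row_set_def diagram by blast
qed

lemma column_set_cell_index: "column_set shape (t \<circ> cell_index) j = t ` cells {j}"
proof (intro equalityI subsetI)
  fix e assume "e \<in> column_set shape (t \<circ> cell_index) j"
  then obtain r x where x: "x \<in> cellsN" "(r, j) = index_cell x" "e = t (cell_index (r, j))"
    by (auto simp: column_set_def diagram)
  then show "e \<in> t ` cells {j}"
    using cell_index_index_cell[OF x(1)] unfolding cells_def column_def
    by (intro image_eqI[of _ _ x]) (simp_all, metis snd_conv)
next
  fix e assume "e \<in> t ` cells {j}"
  then obtain x where x: "x \<in> cellsN" "index_cell x = (fst (index_cell x), j)" "e = t x"
    unfolding cells_def column_def by fastforce
  then have "(fst (index_cell x), j) \<in> index_cell ` cellsN" "e = (t \<circ> cell_index) (fst (index_cell x), j)"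
    using cell_index_index_cell[OF x(1)] by (simp_all add: image_iff) (metis x(2))+
  then show "e \<in> column_set shape (t \<circ> cell_index) j" unfolding column_set_def diagram by blast
qed

lemma rows: "{x \<in> cellsN. fst (index_cell x) = 0} = cellsA" "{x \<in> cellsN. fst (index_cell x) = 1} = cellsB"
  "2 \<le> r \<Longrightarrow> {x \<in> cellsN. fst (index_cell x) = r} = {x \<in> cellsX. x = a + b + r - 1}"
  by (auto simp: index_cell_def cellsN_def cellsA_def cellsB_def cellsX_def split: if_splits)

lemma tabloid_eq_iff:
  "tabloid_of shape (t \<circ> cell_index) = tabloid_of shape (u \<circ> cell_index) \<longleftrightarrow> rows_eq cellsA cellsB cellsX t u"
proof
  assume eq: "tabloid_of shape (t \<circ> cell_index) = tabloid_of shape (u \<circ> cell_index)"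
  have *: "t ` {x \<in> cellsN. fst (index_cell x) = r} = u ` {x \<in> cellsN. fst (index_cell x) = r}" for r
    using fun_cong[OF eq, of r] by (simp only: tabloid_of_def row_set_cell_index)
  have "t x = u x" if x: "x \<in> cellsX" for x
  proof -
    have "2 \<le> x + 1 - a - b" "x = a + b + (x + 1 - a - b) - 1" using x by (auto simp: cellsX_def)
    then have "{y \<in> cellsN. fst (index_cell y) = x + 1 - a - b} = {x}" using rows(3) x by auto
    then show ?thesis using *[of "x + 1 - a - b"] by simp
  qed
  then show "rows_eq cellsA cellsB cellsX t u"
    using *[of 0] *[of 1] by (simp only: rows_eq_def rows) simp
next
  assume R: "rows_eq cellsA cellsB cellsX t u"
  have "t ` {x \<in> cellsN. fst (index_cell x) = r} = u ` {x \<in> cellsN. fst (index_cell x) = r}" for r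
  proof -
    consider "r = 0" | "r = 1" | "2 \<le> r" by linarith
    then show ?thesis
    proof cases
      case 3
      then show ?thesis using R unfolding rows(3)[OF 3] by (intro image_cong) (auto simp: rows_eq_def)
    qed (use R in \<open>simp_all only: rows rows_eq_def\<close>)
  qed
  then show "tabloid_of shape (t \<circ> cell_index) = tabloid_of shape (u \<circ> cell_index)"
    by (intro ext) (simp only: tabloid_of_def row_set_cell_index)
qed

text \<open>Pullback along the map from permutations, read as tableaux through the numbering of
  cells, to tabloids. It embeds the Specht module into the space where the root vectors act.\<close>

definition on_perms :: "(tabloid \<Rightarrow> complex) \<Rightarrow> (nat \<Rightarrow> nat) \<Rightarrow> complex" where
  "on_perms f t = (if t permutes cellsN then f (tabloid_of shape (t \<circ> cell_index)) else 0)"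

lemma lin_on_perms: "lin on_perms"
  by (rule linI) (auto simp: on_perms_def fun_scale_def fun_eq_iff)

text \<open>The column stabilizer of a tableau moves entries, \<open>colperms\<close> moves
  positions; conjugation by \<open>u\<close> passes from one to the other.\<close>

lemma column_stabilizer_cell_index:
  assumes u: "u permutes cellsN"
  shows "bij_betw (\<lambda>s. u \<circ> s \<circ> inv u) (colperms (column ` cellsB)) (column_stabilizer shape (u \<circ> cell_index))"
proof (rule bij_betwI[where g = "\<lambda>p. inv u \<circ> p \<circ> u"])
  note uu = permutes_inverses[OF u]
  show "inv u \<circ> (u \<circ> s \<circ> inv u) \<circ> u = s" "u \<circ> (inv u \<circ> s \<circ> u) \<circ> inv u = s" for s :: "nat \<Rightarrow> nat"
    using uu by (auto simp: fun_eq_iff)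
  show "(\<lambda>s. u \<circ> s \<circ> inv u) \<in> colperms (column ` cellsB) \<rightarrow> column_stabilizer shape (u \<circ> cell_index)"
  proof (rule Pi_I)
    fix s assume s: "s \<in> colperms (column ` cellsB)"
    have sN: "s permutes cellsN" "\<And>j. s ` cells {j} = cells {j}"
      using s unfolding colperms_eq by blast+
    have "(u \<circ> s \<circ> inv u) ` u ` cells {j} = u ` cells {j}" for j
    proof -
      have "inv u ` u ` cells {j} = cells {j}" using uu by (simp add: image_image)
      then show ?thesis by (simp only: comp_image sN(2))
    qed
    moreover have "u \<circ> s \<circ> inv u permutes cellsN"
      using u sN(1) by (intro permutes_compose permutes_inv)
    ultimately show "u \<circ> s \<circ> inv u \<in> column_stabilizer shape (u \<circ> cell_index)"
      by (simp add: column_stabilizer_def sum_shape column_set_cell_index cellsN_def)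
  qed
  show "(\<lambda>p. inv u \<circ> p \<circ> u) \<in> column_stabilizer shape (u \<circ> cell_index) \<rightarrow> colperms (column ` cellsB)"
  proof (rule Pi_I)
    fix p assume "p \<in> column_stabilizer shape (u \<circ> cell_index)"
    then have p: "p permutes cellsN" "\<And>j. p ` u ` cells {j} = u ` cells {j}"
      by (simp_all only: column_stabilizer_def sum_shape column_set_cell_index cellsN_def mem_Collect_eq)
    have "(inv u \<circ> p \<circ> u) ` cells {j} = cells {j}" for j
    proof -
      have "inv u ` u ` cells {j} = cells {j}" using uu by (simp add: image_image)
      then show ?thesis by (simp only: comp_image p(2))
    qed
    moreover have "inv u \<circ> p \<circ> u permutes cellsN"
      using u p(1) by (intro permutes_compose permutes_inv)
    ultimately show "inv u \<circ> p \<circ> u \<in> colperms (column ` cellsB)"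
      unfolding colperms_eq by blast
  qed
qed

lemma on_perms_polytabloid:
  assumes u: "u permutes cellsN"
  shows "on_perms (polytabloid shape (u \<circ> cell_index)) = antisym_fn u"
proof
  fix t
  show "on_perms (polytabloid shape (u \<circ> cell_index)) t = antisym_fn u t"
  proof (cases "t permutes cellsN")
    case True
    have perm: "permutation u" using u P'(1) permutation_permutes by blast
    have "polytabloid shape (u \<circ> cell_index) (tabloid_of shape (t \<circ> cell_index)) =
        (\<Sum>s\<in>colperms (column ` cellsB). of_int (sign (u \<circ> s \<circ> inv u)) *
          of_bool (tabloid_of shape (t \<circ> cell_index) = tabloid_of shape ((u \<circ> s \<circ> inv u) \<circ> (u \<circ> cell_index))))"
      unfolding polytabloid_apply
      by (rule sum.reindex_bij_betw[OF column_stabilizer_cell_index[OF u], symmetric])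
    also have "\<dots> = (\<Sum>s\<in>colperms (column ` cellsB). of_int (sign s) *
        of_bool (rows_eq cellsA cellsB cellsX t (u \<circ> s)))"
    proof (intro sum.cong refl)
      fix s assume s: "s \<in> colperms (column ` cellsB)"
      have "(u \<circ> s \<circ> inv u) \<circ> (u \<circ> cell_index) = (u \<circ> s) \<circ> cell_index"
        using permutes_inverses(2)[OF u] by (auto simp: fun_eq_iff)
      moreover have "sign (u \<circ> s \<circ> inv u) = sign s"
        using perm colperms_permutation[OF s]
        by (simp add: sign_compose permutation_compose permutation_inverse sign_inverse mult.assoc[symmetric])
      ultimately show "of_int (sign (u \<circ> s \<circ> inv u)) *
          of_bool (tabloid_of shape (t \<circ> cell_index) = tabloid_of shape ((u \<circ> s \<circ> inv u) \<circ> (u \<circ> cell_index))) =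
          of_int (sign s) * (of_bool (rows_eq cellsA cellsB cellsX t (u \<circ> s)) :: complex)"
        by (simp only: tabloid_eq_iff)
    qed
    finally show ?thesis using True by (simp add: on_perms_def antisym_fn_def)
  qed (simp add: on_perms_def antisym_fn_def)
qed

lemma polytabloid_image:
  "polytabloid shape ` tableaux shape = (\<lambda>u. polytabloid shape (u \<circ> cell_index)) ` {u. u permutes cellsN}"
proof (intro equalityI subsetI)
  have bij_pos: "bij_betw index_cell cellsN (young_diagram shape)"
    using inj_index_cell diagram by (simp add: bij_betw_def)
  {
    fix e assume "e \<in> polytabloid shape ` tableaux shape"
    then obtain t where t: "bij_betw t (young_diagram shape) cellsN" "e = polytabloid shape t"
      by (auto simp: tableaux_def sum_shape cellsN_def)
    define u where "u x = (if x \<in> cellsN then t (index_cell x) else x)" for x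
    have "bij_betw (t \<circ> index_cell) cellsN cellsN" using bij_betw_trans[OF bij_pos t(1)] .
    then have "bij_betw u cellsN cellsN" by (rule bij_betw_cong[THEN iffD1, rotated]) (simp add: u_def)
    then have u: "u permutes cellsN" by (rule bij_imp_permutes) (simp add: u_def)
    have "polytabloid shape t = polytabloid shape (u \<circ> cell_index)"
      by (rule polytabloid_cong) (auto simp: diagram cell_index_index_cell u_def)
    then show "e \<in> (\<lambda>u. polytabloid shape (u \<circ> cell_index)) ` {u. u permutes cellsN}" using u t by blast
  }
  {
    fix e assume "e \<in> (\<lambda>u. polytabloid shape (u \<circ> cell_index)) ` {u. u permutes cellsN}"
    then obtain u where u: "u permutes cellsN" "e = polytabloid shape (u \<circ> cell_index)" by auto
    have "bij_betw cell_index (young_diagram shape) cellsN"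
      by (rule bij_betw_byWitness[where f' = index_cell]) (auto simp: diagram cell_index_index_cell)
    then have "bij_betw (u \<circ> cell_index) (young_diagram shape) cellsN"
      using permutes_imp_bij[OF u(1)] by (rule bij_betw_trans)
    then show "e \<in> polytabloid shape ` tableaux shape"
      using u by (auto simp: tableaux_def sum_shape cellsN_def)
  }
qed

lemma on_perms_specht: "on_perms ` specht_module shape = hw_space cellsN cellsA cellsB cellsX"
proof -
  have "on_perms ` specht_module shape = fun_vs.span (on_perms ` polytabloid shape ` tableaux shape)"
    unfolding specht_module_def
    using module_hom.span_image[of fun_scale fun_scale on_perms] lin_on_perms by (simp add: module_hom_iff_linear)
  also have "on_perms ` polytabloid shape ` tableaux shape = antisym_fn ` {u. u permutes cellsN}"
    unfolding polytabloid_image image_image by (intro image_cong refl) (simp add: on_perms_polytabloid)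
  finally show ?thesis by (simp only: span_antisym_fn)
qed

text \<open>The type of tabloids also contains sequences of sets that come from no tableau.
  \<open>on_perms\<close> forgets the values there and becomes injective on functions that vanish at
  them.\<close>

definition tabloid_fns :: "(tabloid \<Rightarrow> complex) set" where
  "tabloid_fns = {f. \<forall>T. f T \<noteq> 0 \<longrightarrow> (\<exists>t. t permutes cellsN \<and> T = tabloid_of shape (t \<circ> cell_index))}"

lemma tabloid_fns_subspace: "fun_vs.subspace tabloid_fns"
proof (rule fun_vs.subspaceI)
  fix f h assume fh: "f \<in> tabloid_fns" "h \<in> tabloid_fns"
  have "f T \<noteq> 0 \<or> h T \<noteq> 0" if "(f + h) T \<noteq> 0" for T using that by auto
  then show "f + h \<in> tabloid_fns" using fh unfolding tabloid_fns_def mem_Collect_eq by blast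
qed (auto simp: tabloid_fns_def fun_scale_def)

lemma specht_tabloid_fns: "specht_module shape \<subseteq> tabloid_fns"
  unfolding specht_module_def
proof (rule fun_vs.span_minimal)
  show "fun_vs.subspace tabloid_fns" by (rule tabloid_fns_subspace)
  show "polytabloid shape ` tableaux shape \<subseteq> tabloid_fns"
    unfolding polytabloid_image
  proof clarify
    fix u assume u: "u permutes cellsN"
    have "\<exists>t. t permutes cellsN \<and> T = tabloid_of shape (t \<circ> cell_index)"
      if "polytabloid shape (u \<circ> cell_index) T \<noteq> 0" for T
    proof -
      obtain p where p: "p \<in> column_stabilizer shape (u \<circ> cell_index)" "T = tabloid_of shape (p \<circ> (u \<circ> cell_index))"
      proof (rule ccontr)
        assume "\<not> thesis"
        then have "polytabloid shape (u \<circ> cell_index) T = 0"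
          unfolding polytabloid_apply using that by (intro sum.neutral) auto
        then show False using \<open>polytabloid shape (u \<circ> cell_index) T \<noteq> 0\<close> by simp
      qed
      have "p \<circ> u permutes cellsN"
        using p(1) u permutes_compose by (auto simp: column_stabilizer_def sum_shape cellsN_def)
      then show ?thesis using p(2) by (intro exI[of _ "p \<circ> u"]) (simp add: o_assoc)
    qed
    then show "polytabloid shape (u \<circ> cell_index) \<in> tabloid_fns" by (simp add: tabloid_fns_def)
  qed
qed

lemma on_perms_inj:
  assumes f: "f \<in> tabloid_fns" and 0: "on_perms f = 0"
  shows "f = 0"
proof
  fix T
  show "f T = 0 T"
  proof (rule ccontr)
    assume "f T \<noteq> 0 T"
    then obtain t where t: "t permutes cellsN" "T = tabloid_of shape (t \<circ> cell_index)" "f T \<noteq> 0"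
      using f by (auto simp: tabloid_fns_def)
    then show False using fun_cong[OF 0, of t] by (simp add: on_perms_def)
  qed
qed

text \<open>Injectivity of \<open>on_perms\<close> on \<open>tabloid_fns\<close> lets membership be
  tested on the image, so that invariance under \<open>perm_act\<close> can be inherited from
  \<open>hw_space\<close>.\<close>

lemma specht_eq: "specht_module shape = {f \<in> tabloid_fns. on_perms f \<in> hw_space cellsN cellsA cellsB cellsX}"
proof (intro equalityI subsetI CollectI conjI)
  fix f assume "f \<in> {f \<in> tabloid_fns. on_perms f \<in> hw_space cellsN cellsA cellsB cellsX}"
  then have f: "f \<in> tabloid_fns" "on_perms f \<in> hw_space cellsN cellsA cellsB cellsX" by simp_all
  then obtain h where h: "h \<in> specht_module shape" "on_perms h = on_perms f"
    using on_perms_specht by (metis imageE)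
  have "f - h \<in> tabloid_fns"
    using f(1) h(1) specht_tabloid_fns by (intro fun_vs.subspace_diff tabloid_fns_subspace) auto
  moreover have "on_perms (f - h) = 0" using h(2) by (simp add: lin_diff[OF lin_on_perms] del: minus_apply)
  ultimately have "f - h = 0" by (rule on_perms_inj)
  then show "f \<in> specht_module shape" using h(1) by simp
qed (use specht_tabloid_fns on_perms_specht in blast)+

lemma on_perms_left_mult:
  assumes g: "g permutes cellsN"
  shows "on_perms (perm_act g f) = left_mult g (on_perms f)"
proof
  fix t
  have ig: "inv g permutes cellsN" by (rule permutes_inv[OF g])
  have "inv g \<circ> t permutes cellsN \<longleftrightarrow> t permutes cellsN"
  proof
    assume "inv g \<circ> t permutes cellsN"
    from permutes_compose[OF this g] show "t permutes cellsN"
      using permutes_inv_o(1)[OF g] by (simp add: o_assoc)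
  next
    assume "t permutes cellsN"
    then show "inv g \<circ> t permutes cellsN" using ig by (rule permutes_compose)
  qed
  moreover have "(\<lambda>r. inv g ` tabloid_of shape (t \<circ> cell_index) r) = tabloid_of shape (inv g \<circ> t \<circ> cell_index)"
    by (rule ext) (simp only: tabloid_of_def row_set_cell_index comp_image)
  ultimately show "on_perms (perm_act g f) t = left_mult g (on_perms f) t"
    by (simp add: on_perms_def left_mult_def perm_act_def)
qed

lemma perm_act_specht:
  assumes g: "g permutes cellsN"
  shows "perm_act g ` specht_module shape \<subseteq> specht_module shape"
proof (rule image_subsetI)
  fix f assume f: "f \<in> specht_module shape"
  have "\<exists>t. t permutes cellsN \<and> T = tabloid_of shape (t \<circ> cell_index)" if "perm_act g f T \<noteq> 0" for T
  proof -
    have "f (\<lambda>r. inv g ` T r) \<noteq> 0" using that by (simp add: perm_act_def)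
    then obtain t where t: "t permutes cellsN" "(\<lambda>r. inv g ` T r) = tabloid_of shape (t \<circ> cell_index)"
      using f specht_tabloid_fns by (auto simp: tabloid_fns_def)
    have inv_T: "inv g ` T r = tabloid_of shape (t \<circ> cell_index) r" for r
      using fun_cong[OF t(2), of r] by simp
    have "T r = g ` tabloid_of shape (t \<circ> cell_index) r" for r
      unfolding inv_T[symmetric] using permutes_inverses(1)[OF g] by (simp add: image_image)
    then have "T = tabloid_of shape (g \<circ> t \<circ> cell_index)"
      by (intro ext) (simp only: tabloid_of_def row_set_cell_index comp_image)
    then show ?thesis using permutes_compose[OF t(1) g] by blast
  qed
  then have "perm_act g f \<in> tabloid_fns" by (simp add: tabloid_fns_def)
  moreover have "on_perms (perm_act g f) \<in> hw_space cellsN cellsA cellsB cellsX"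
    using f left_mult_hw_space[OF g] unfolding on_perms_left_mult[OF g] specht_eq by blast
  ultimately show "perm_act g f \<in> specht_module shape" unfolding specht_eq by simp
qed

lemma specht_character_formula:
  assumes g: "g permutes cellsN"
  shows "specht_character shape g = ker_trace g cellsN a b i - ker_trace g cellsN (b - 1) (a + 1) i"
proof -
  have "fin_dim (specht_module shape)"
    unfolding fin_dim_def specht_module_def polytabloid_image
    using finite_permutations[OF P'(1)]
    by (intro conjI exI[of _ "(\<lambda>u. polytabloid shape (u \<circ> cell_index)) ` {u. u permutes cellsN}"])
       (auto intro: fun_vs.subspace_span)
  then have "specht_character shape g = trace_on (hw_space cellsN cellsA cellsB cellsX) (left_mult g)"
    unfolding specht_character_def
    using on_perms_inj specht_tabloid_fns
    by (intro trace_iso[OF _ lin_on_perms on_perms_specht lin_perm_left_mult perm_act_specht[OF g] lin_left_mult])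
       (auto simp: on_perms_left_mult[OF g])
  also have "\<dots> = ker_trace g cellsN (card cellsA) (card cellsB) (card cellsX) -
      ker_trace g cellsN (card cellsB - 1) (card cellsA + 1) (card cellsX)"
    using b_pos ba by (intro trace_hw_space[OF P g]) (auto simp: cellsA_def cellsB_def)
  finally show ?thesis by (simp add: cellsA_def cellsB_def cellsX_def)
qed

end

text \<open>The one-row shape is outside \<open>near_hook_shape\<close>, where the second row is
  nonempty. Its columns are single cells, so all polytabloids equal the unique tabloid, which
  \<open>g\<close> fixes, and the module is a line.\<close>

lemma trivial_character:
  assumes n: "1 \<le> n" and g: "g permutes {1..n}"
  shows "specht_character [n] g = 1"
proof -
  define T :: tabloid where "T = (\<lambda>r. if r = 0 then {1..n} else {})"
  have D: "young_diagram [n] = {(0, j) | j. j < n}" by (auto simp: young_diagram_def)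
  have "polytabloid [n] t = tabloid_vec T" if t: "t \<in> tableaux [n]" for t
  proof -
    have bij: "bij_betw t {(0, j) | j. j < n} {1..n}" using t D by (simp add: tableaux_def)
    have tab: "tabloid_of [n] t = T"
    proof
      fix r show "tabloid_of [n] t r = T r"
        using bij unfolding tabloid_of_def row_set_def D T_def bij_betw_def by (auto simp: image_iff)
    qed
    have "p = id" if p: "p \<in> column_stabilizer [n] t" for p
    proof
      fix x show "p x = id x"
      proof (cases "x \<in> {1..n}")
        case True
        then have "x \<in> t ` {(0, j) | j. j < n}" using bij by (simp only: bij_betw_def)
        then obtain j where j: "x = t (0, j)" "j < n" by blast
        have "column_set [n] t j = {x}" using j by (auto simp: column_set_def D)
        then have "p ` {x} = {x}" using p by (auto simp: column_stabilizer_def)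
        then show ?thesis by simp
      next
        case False
        then show ?thesis using p permutes_not_in[of p "{1..n}" x] by (simp add: column_stabilizer_def)
      qed
    qed
    moreover have "id \<in> column_stabilizer [n] t" by (simp add: column_stabilizer_def permutes_id)
    ultimately have "column_stabilizer [n] t = {id}" by blast
    then show ?thesis by (simp add: polytabloid_def tab fun_scale_def)
  qed
  moreover have "(\<lambda>(r, j). j + 1) \<in> tableaux [n]"
    unfolding tableaux_def D mem_Collect_eq
    by (rule bij_betw_byWitness[where f' = "\<lambda>x. (0, x - 1)"]) auto
  ultimately have "polytabloid [n] ` tableaux [n] = {tabloid_vec T}" by auto
  then have V: "specht_module [n] = fun_vs.span {tabloid_vec T}" by (simp add: specht_module_def)
  have nz: "tabloid_vec T \<noteq> 0" by (auto simp: tabloid_vec_def fun_eq_iff)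
  have fix1: "perm_act g (tabloid_vec T) = tabloid_vec T"
  proof
    fix S :: tabloid
    have "(\<lambda>r. inv g ` S r) = T \<longleftrightarrow> S = T"
    proof
      assume eq: "(\<lambda>r. inv g ` S r) = T"
      have inv_S: "inv g ` S r = T r" for r using fun_cong[OF eq, of r] by simp
      have "S r = g ` T r" for r
        unfolding inv_S[symmetric] using permutes_inverses(1)[OF g] by (simp add: image_image)
      then show "S = T" using permutes_image[OF g] by (auto simp: T_def fun_eq_iff)
    next
      assume "S = T"
      then show "(\<lambda>r. inv g ` S r) = T" using permutes_image[OF permutes_inv[OF g]] by (auto simp: T_def fun_eq_iff)
    qed
    then show "perm_act g (tabloid_vec T) S = tabloid_vec T S" by (simp add: perm_act_def tabloid_vec_def)
  qed
  have B: "basis_of {tabloid_vec T} (specht_module [n])"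
    using nz V by simp
  have "perm_act g ` specht_module [n] \<subseteq> specht_module [n]"
    unfolding V fun_vs.span_singleton using fix1 lin_scale[OF lin_perm_left_mult, of g] by auto
  from trace_on_eq[OF B lin_perm_left_mult this] show ?thesis
    using representation_of_basis[OF B] fix1 by (simp add: specht_character_def)
qed

section \<open>Assembling the sum over all partitions\<close>

lemma finite_partitions: "finite (partitions_of n)"
proof (rule finite_subset)
  have "length \<rho> \<le> sum_list \<rho>" if "\<forall>p\<in>set \<rho>. p > 0" for \<rho> :: "nat list"
    using that by (induction \<rho>) auto
  then show "partitions_of n \<subseteq> {\<rho>. set \<rho> \<subseteq> {..n} \<and> length \<rho> \<le> n}"
    by (auto simp: partitions_of_def dest: member_le_sum_list)
qed (rule finite_lists_length_le, simp)

theorem theorem3: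
  fixes n k :: nat and g :: "nat \<Rightarrow> nat"
  assumes "n \<ge> 1" and "1 \<le> k" and "k \<le> n"
    and "g permutes {1..n}"
  shows "of_nat (cycles_of_length n k g) =
    1 / of_nat k * (\<Sum>\<rho>\<in>partitions_of n. of_int (cycle_coeff n k \<rho>) * specht_character \<rho> g)"
proof -
  define m where "m = n - k"
  have n: "n = m + k" using assms by (simp add: m_def)
  let ?N = "{1..n}"
  \<comment> \<open>The omitted index with \<open>k - i = m + 1\<close> lies between the two
    families: there \<open>(m, k - i)\<close> is fixed by the reflection
    \<open>(a, b) \<mapsto> (b - 1, a + 1)\<close>.\<close>
  define I where "I = {i. i < k \<and> k - i \<noteq> m + 1}"
  \<comment> \<open>Of the pair \<open>(m, k - i)\<close> and its reflection, for \<open>i\<close>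
    in \<open>I\<close> this takes the one that is weakly decreasing; the two cases are the second
    and the first family of shapes.\<close>
  define sh where "sh i = (if k - i \<le> m then [m, k - i] else [k - i - 1, m + 1]) @ replicate i 1" for i
  let ?t = "\<lambda>\<rho>. of_int (cycle_coeff n k \<rho>) * specht_character \<rho> g"
  let ?G = "\<lambda>i. (-1) ^ i * (ker_trace g ?N m (k - i) i - ker_trace g ?N (k - i - 1) (m + 1) i)"
  have len: "length (sh i) = i + 2" for i by (simp add: sh_def)
  have shape1: "coeff_shape1 n k \<rho> i \<longleftrightarrow> i < k \<and> m + 2 \<le> k - i \<and> \<rho> = sh i" for \<rho> i
    unfolding coeff_shape1_def sh_def n by auto
  have shape2: "coeff_shape2 n k \<rho> i \<longleftrightarrow> i < k \<and> k - i \<le> m \<and> \<rho> = sh i" for \<rho> i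
    unfolding coeff_shape2_def sh_def n by auto
  have sh_inj: "sh i = sh j \<longleftrightarrow> i = j" for i j using len by (metis add_right_cancel)
  have sh_n: "sh i \<noteq> [n]" for i using len[of i] by auto
  have coeff: "cycle_coeff n k (sh i) = (if k - i \<le> m then (-1) ^ i else (-1) ^ (i + 1))" if "i \<in> I" for i
  proof (cases "k - i \<le> m")
    case True
    have "coeff_shape1 n k (sh i) = (\<lambda>j. False)"
      using True by (auto simp: fun_eq_iff shape1 sh_inj)
    moreover have "coeff_shape2 n k (sh i) = (\<lambda>j. j = i)"
      using True that by (auto simp: fun_eq_iff shape2 sh_inj I_def)
    ultimately show ?thesis using True by (simp add: cycle_coeff_def sh_n)
  next
    case False
    have "coeff_shape1 n k (sh i) = (\<lambda>j. j = i)"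
      using False that by (auto simp: fun_eq_iff shape1 sh_inj I_def)
    then show ?thesis using False by (simp add: cycle_coeff_def sh_n)
  qed
  have coeff0: "cycle_coeff n k \<rho> = 0" if "\<rho> \<noteq> [n]" "\<rho> \<notin> sh ` I" for \<rho>
    using that by (auto simp: cycle_coeff_def shape1 shape2 I_def)
  have coeffn: "cycle_coeff n k [n] = 1" by (simp add: cycle_coeff_def)
  have rep: "sorted_wrt (\<ge>) (replicate j (1::nat))" for j by (induction j) auto
  have sh_blocks: "sh i \<in> partitions_of n" if "i \<in> I" for i
    using that rep by (auto simp: partitions_of_def sh_def I_def n sorted_wrt_append sum_list_replicate)
  have "[n] \<in> partitions_of n" using assms by (simp add: partitions_of_def)
  \<comment> \<open>For the reflected pair the two traces are exchanged, and the extra sign in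
    \<open>(-1) ^ (i + 1)\<close> undoes this.\<close>
  have term_sh: "?t (sh i) = ?G i" if i: "i \<in> I" for i
  proof (cases "k - i \<le> m")
    case True
    interpret S: near_hook_shape m "k - i" i
      using i True by unfold_locales (auto simp: I_def)
    have "S.cellsN = ?N" "S.shape = sh i" using i True by (auto simp: S.cellsN_def S.shape_def sh_def I_def n)
    then have "specht_character (sh i) g = ker_trace g ?N m (k - i) i - ker_trace g ?N (k - i - 1) (m + 1) i"
      using S.specht_character_formula[of g] assms(4) by simp
    then show ?thesis using coeff[OF i] True by simp
  next
    case False
    interpret S: near_hook_shape "k - i - 1" "m + 1" i
      using i False by unfold_locales (auto simp: I_def)
    have sizes: "k - i - 1 + (m + 1) + i = n" "k - i - 1 + 1 = k - i" "m + 1 - 1 = m"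
      using i by (auto simp: I_def n)
    have eqs: "S.cellsN = ?N" "S.shape = sh i"
      unfolding S.cellsN_def S.shape_def sizes(1) using False by (simp_all add: sh_def)
    have "specht_character (sh i) g = ker_trace g ?N (k - i - 1) (m + 1) i - ker_trace g ?N m (k - i) i"
      using S.specht_character_formula[unfolded eqs, OF assms(4)] unfolding sizes .
    then show ?thesis using coeff[OF i] False by (simp add: right_diff_distrib)
  qed
  have "(\<Sum>\<rho>\<in>partitions_of n. ?t \<rho>) = (\<Sum>\<rho>\<in>insert [n] (sh ` I). ?t \<rho>)"
    using sh_blocks \<open>[n] \<in> partitions_of n\<close> coeff0 finite_partitions
    by (intro sum.mono_neutral_right) auto
  also have "\<dots> = ?t [n] + (\<Sum>i\<in>I. ?t (sh i))"
  proof -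
    have "[n] \<notin> sh ` I" using sh_n by (metis imageE)
    moreover have "finite I" by (simp add: I_def)
    moreover have "inj_on sh I" using sh_inj by (simp add: inj_on_def)
    ultimately show ?thesis by (simp add: sum.reindex)
  qed
  also have "(\<Sum>i\<in>I. ?t (sh i)) = (\<Sum>i\<in>I. ?G i)" using term_sh by (rule sum.cong[OF refl])
  \<comment> \<open>At the omitted index the two traces in \<open>?G\<close> coincide, so its term
    is zero and the range can be completed.\<close>
  also have "\<dots> = (\<Sum>i<k. ?G i)"
    by (rule sum.mono_neutral_left) (auto simp: I_def)
  also have "\<dots> = (\<Sum>i<k. (-1) ^ i * ker_trace g ?N (card ?N - k) (k - i) i) -
      (\<Sum>i<k. (-1) ^ i * ker_trace g ?N (k - i - 1) (card ?N - k + 1) i)"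
    by (simp add: right_diff_distrib sum_subtractf m_def)
  also have "(\<Sum>i<k. (-1) ^ i * ker_trace g ?N (card ?N - k) (k - i) i) =
      of_nat k * of_nat (card {C \<in> orbit g ` ?N. card C = k})"
    using assms by (intro cycles_formula) auto
  \<comment> \<open>This subtracted 1 is cancelled by the contribution of the trivial character
    \<open>[n]\<close>.\<close>
  also have "(\<Sum>i<k. (-1) ^ i * ker_trace g ?N (k - i - 1) (card ?N - k + 1) i) = 1"
    using assms by (intro trivial_formula) auto
  also have "?t [n] = 1" using trivial_character[OF assms(1,4)] coeffn by simp
  finally have "(\<Sum>\<rho>\<in>partitions_of n. ?t \<rho>) = of_nat k * of_nat (cycles_of_length n k g)"
    by (simp add: cycles_of_length_def)
  then show ?thesis using assms by simp
qed

end
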